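(* Let $\mathcal{C}$ be a unital C$^*$-algebra and $n\ge1$. Every Heisenberg smooth operator $A\in\mathcal{L}_\mathcal{C}(E_n)$ maps $\mathcal{S}^\mathcal{C}(\mathbb{R}^n)$ into $\mathcal{S}^\mathcal{C}(\mathbb{R}^n)$.
   Context: $\mathcal{S}^\mathcal{C}(\mathbb{R}^n)$: $\mathcal{C}$-valued Schwartz functions on $\mathbb{R}^n$. $E_n$: Hilbert $\mathcal{C}$-module completion of $\mathcal{S}^\mathcal{C}(\mathbb{R}^n)$ in the norm $\|f\|_2=\|\int_{\mathbb{R}^n}f(x)^*f(x)\,dx\|_\mathcal{C}^{1/2}$; $\mathcal{L}_\mathcal{C}(E_n)$: adjointable operators on $E_n$ with operator norm. Unitaries $\mathcal{U}_{a,b,c}$ ($a,b\in\mathbb{R}^n,c\in\mathbb{R}$) on $E_n$ extend $\mathcal{U}_{a,b,c}(f)(x)=e^{ic}e^{i\langle b,x\rangle}f(x-a)$. $A\in\mathcal{L}_\mathcal{C}(E_n)$ is Heisenberg smooth if $(a,b)\mapsto\mathcal{U}_{a,b,0}A\,\mathcal{U}_{a,b,0}^{-1}$ is a $C^\infty$ map from $\mathbb{R}^{2n}$ into $\mathcal{L}_\mathcal{C}(E_n)$ with the operator norm. *)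

theory Defs
  imports "HOL-Analysis.Analysis"
begin

text \<open>There is no complex-vector-space class in the library.  A unital C*-algebra is
  modelled as a real unital Banach algebra ('c) together with a complex scalar
  multiplication cscale extending the real one (making it a complex Banach algebra)
  and an involution star satisfying the C*-identity.\<close>

definition unital_cstar_algebra ::
  "(complex \<Rightarrow> 'c::{real_normed_algebra_1,banach} \<Rightarrow> 'c) \<Rightarrow> ('c \<Rightarrow> 'c) \<Rightarrow> bool" where
  "unital_cstar_algebra cscale star \<longleftrightarrow>
     (\<forall>r x. cscale (complex_of_real r) x = r *\<^sub>R x) \<and>
     (\<forall>a b x. cscale (a + b) x = cscale a x + cscale b x) \<and>
     (\<forall>a x y. cscale a (x + y) = cscale a x + cscale a y) \<and>
     (\<forall>a b x. cscale a (cscale b x) = cscale (a * b) x) \<and>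
     (\<forall>a x. norm (cscale a x) = cmod a * norm x) \<and>
     (\<forall>a x y. cscale a (x * y) = cscale a x * y) \<and>
     (\<forall>a x y. cscale a (x * y) = x * cscale a y) \<and>
     (\<forall>x y. star (x + y) = star x + star y) \<and>
     (\<forall>a x. star (cscale a x) = cscale (cnj a) (star x)) \<and>
     (\<forall>x y. star (x * y) = star y * star x) \<and>
     (\<forall>x. star (star x) = x) \<and>
     (\<forall>x. norm (star x * x) = (norm x)\<^sup>2)"

definition dir_deriv :: "('a::real_normed_vector \<Rightarrow> 'b::real_normed_vector) \<Rightarrow> 'a \<Rightarrow> 'a \<Rightarrow> 'b" where
  "dir_deriv f v x = vector_derivative (\<lambda>t. f (x + t *\<^sub>R v)) (at 0)"

fun iter_pd :: "'a::real_normed_vector list \<Rightarrow> ('a \<Rightarrow> 'b::real_normed_vector) \<Rightarrow> 'a \<Rightarrow> 'b" where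
  "iter_pd [] f = f"
| "iter_pd (v # vs) f = dir_deriv (iter_pd vs f) v"

definition smooth :: "('a::euclidean_space \<Rightarrow> 'b::real_normed_vector) \<Rightarrow> bool" where
  "smooth f \<longleftrightarrow>
     (\<forall>vs. set vs \<subseteq> Basis \<longrightarrow>
        continuous_on UNIV (iter_pd vs f) \<and>
        (\<forall>v\<in>Basis. \<forall>x. (\<lambda>t. iter_pd vs f (x + t *\<^sub>R v)) differentiable (at 0)))"

definition schwartz :: "(real^'n \<Rightarrow> 'c::real_normed_vector) \<Rightarrow> bool" where
  "schwartz f \<longleftrightarrow> smooth f \<and>
     (\<forall>vs. set vs \<subseteq> Basis \<longrightarrow>
        (\<forall>k::nat. bounded (range (\<lambda>x. ((1 + norm x) ^ k) *\<^sub>R iter_pd vs f x))))"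

text \<open>E_n is specified up to isomorphism as a completion: a Banach space 'e with a
  C-valued inner product inn and right C-action ract, and a map emb from the Schwartz
  functions onto a dense subspace, such that the inner product of embedded Schwartz
  functions is the integral of f* g and the norm is the square root of the norm of the
  inner product.\<close>

definition En_completion ::
  "('c::{real_normed_algebra_1,banach} \<Rightarrow> 'c) \<Rightarrow> ('e::banach \<Rightarrow> 'e \<Rightarrow> 'c) \<Rightarrow> ('e \<Rightarrow> 'c \<Rightarrow> 'e)
    \<Rightarrow> ((real^'n \<Rightarrow> 'c) \<Rightarrow> 'e) \<Rightarrow> bool" where
  "En_completion star inn ract emb \<longleftrightarrow>
     bounded_bilinear inn \<and> bounded_bilinear ract \<and>
     (\<forall>x. ract x 1 = x) \<and>
     (\<forall>x. norm x = sqrt (norm (inn x x))) \<and>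
     (\<forall>f g. schwartz f \<longrightarrow> schwartz g \<longrightarrow> emb (\<lambda>x. f x + g x) = emb f + emb g) \<and>
     (\<forall>f c. schwartz f \<longrightarrow> emb (\<lambda>x. f x * c) = ract (emb f) c) \<and>
     (\<forall>f g. schwartz f \<longrightarrow> schwartz g \<longrightarrow>
        inn (emb f) (emb g) = integral UNIV (\<lambda>x. star (f x) * g x)) \<and>
     closure (emb ` {f. schwartz f}) = UNIV"

definition adjointable :: "('e \<Rightarrow> 'e \<Rightarrow> 'c) \<Rightarrow> ('e \<Rightarrow> 'e) \<Rightarrow> bool" where
  "adjointable inn A \<longleftrightarrow> (\<exists>B. \<forall>x y. inn (A x) y = inn x (B y))"

definition Ushift ::
  "(complex \<Rightarrow> 'c \<Rightarrow> 'c) \<Rightarrow> real^'n \<Rightarrow> real^'n \<Rightarrow> (real^'n \<Rightarrow> 'c) \<Rightarrow> (real^'n \<Rightarrow> 'c)" where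
  "Ushift cscale a b f = (\<lambda>x. cscale (cis (b \<bullet> x)) (f (x - a)))"

text \<open>U_{a,b,0} on E_n: the (unique) bounded extension of Ushift.\<close>
definition Uop ::
  "(complex \<Rightarrow> 'c::real_normed_vector \<Rightarrow> 'c) \<Rightarrow> ((real^'n \<Rightarrow> 'c) \<Rightarrow> 'e::real_normed_vector)
     \<Rightarrow> real^'n \<Rightarrow> real^'n \<Rightarrow> 'e \<Rightarrow>\<^sub>L 'e" where
  "Uop cscale emb a b =
     (THE U. \<forall>f. schwartz f \<longrightarrow> blinfun_apply U (emb f) = emb (Ushift cscale a b f))"

definition Uinv ::
  "(complex \<Rightarrow> 'c::real_normed_vector \<Rightarrow> 'c) \<Rightarrow> ((real^'n \<Rightarrow> 'c) \<Rightarrow> 'e::real_normed_vector)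
     \<Rightarrow> real^'n \<Rightarrow> real^'n \<Rightarrow> 'e \<Rightarrow>\<^sub>L 'e" where
  "Uinv cscale emb a b =
     (THE V. V o\<^sub>L Uop cscale emb a b = id_blinfun \<and> Uop cscale emb a b o\<^sub>L V = id_blinfun)"

definition heisenberg_smooth ::
  "(complex \<Rightarrow> 'c::real_normed_vector \<Rightarrow> 'c) \<Rightarrow> ((real^'n \<Rightarrow> 'c) \<Rightarrow> 'e::real_normed_vector)
     \<Rightarrow> ('e \<Rightarrow>\<^sub>L 'e) \<Rightarrow> bool" where
  "heisenberg_smooth cscale emb A \<longleftrightarrow>
     smooth (\<lambda>p::(real^'n) \<times> (real^'n).
        Uop cscale emb (fst p) (snd p) o\<^sub>L A o\<^sub>L Uinv cscale emb (fst p) (snd p))"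

end

theory Submission
  imports Defs
begin

text \<open>
  Conjugating \<open>A f\<close> by the Heisenberg unitaries and using the product rule, \<open>h = A f\<close> is a smooth
  vector: every word in the generators \<open>X\<^sub>v\<close> (the operators \<open>-\<partial>\<^sub>j\<close> and \<open>i x\<^sub>j\<close>) applies to \<open>h\<close>
  inside \<open>E\<^sub>n\<close>.  Every smooth vector is a Schwartz function, for two reasons.

  First, \<open>1 - X\<^sub>v\<close> has an inverse of norm at most 1 (dissipativity) which preserves Schwartz functions
  and which commutes with the other generators up to lower order, so one can approximate \<open>h\<close> by
  Schwartz functions \<open>f\<^sub>k\<close> such that every word applied to \<open>f\<^sub>k - h\<close> tends to 0 in \<open>E\<^sub>n\<close>.

  Second, there is a Sobolev inequality
  \<open>\<parallel>f(x)\<parallel> \<le> C \<parallel>\<Prod>\<^sub>j (1 - \<partial>\<^sub>j) f\<parallel>\<close> with the norm of \<open>E\<^sub>n\<close> on the right: the fundamental solution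
  \<open>\<Prod>\<^sub>j e\<^sup>-\<^sup>s 1\<^bsub>s>0\<^esub>\<close> of \<open>\<Prod>\<^sub>j (1 + \<partial>\<^sub>j)\<close> is square integrable, and it is approximated by the
  Schwartz kernels in which the step function is replaced by a logistic function.

  Hence \<open>f\<^sub>k\<close> is Cauchy in every Schwartz seminorm, and its limit represents \<open>h\<close>.
\<close>

text \<open>Elements of \<open>E_n\<close> are abstract: only images under \<open>emb\<close> are
  functions, so pointwise information has to be extracted from \<open>inn\<close>, by pairing with
  scalar kernels times the unit of the algebra. Boundedness of \<open>inn\<close> stands in for
  Cauchy-Schwarz there. Using one first-order factor per coordinate keeps the kernels products, so
  that all integrals become one-dimensional; the logistic function is a smooth step whose
  derivatives are polynomials in itself, which keeps all derivatives of the kernel explicit.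
  Schwartz functions are dense only for the norm of \<open>E_n\<close>, while the generators are
  unbounded. Solving \<open>f - X f = F\<close> among Schwartz functions trades one generator for an
  approximation problem with one letter fewer, and the commutators met on the way are scalars, so
  they only shorten words. Adjointability enters by forcing \<open>A\<close> to commute with complex
  scalars: this lets the phases of the projective representation cancel in the conjugated
  operator.\<close>

section \<open>Schwartz functions\<close>

text \<open>The Schwartz condition speaks of all iterated partials. Instead of computing them,
  functions are described by codes \<open>a\<close> with meaning \<open>T a\<close>: it suffices
  that differentiation acts on codes and that every coded function decays. The later closure proofs
  only have to choose suitable codes.\<close>

lemma schwartz_coinduct:
  fixes T :: "'a \<Rightarrow> real^'n \<Rightarrow> 'c::real_normed_vector"
  assumes "Q a"
    and cont: "\<And>a. Q a \<Longrightarrow> continuous_on UNIV (T a)"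
    and deriv: "\<And>a b. Q a \<Longrightarrow> b \<in> Basis \<Longrightarrow>
      \<exists>a'. Q a' \<and> (\<forall>x. ((\<lambda>t. T a (x + t *\<^sub>R b)) has_vector_derivative T a' x) (at 0))"
    and bdd: "\<And>a k. Q a \<Longrightarrow> \<exists>B. \<forall>x. (1 + norm x) ^ k * norm (T a x) \<le> B"
  shows "schwartz (T a)"
proof -
  have diff: "(\<lambda>t. T a (x + t *\<^sub>R b)) differentiable (at 0)" if "Q a" "b \<in> Basis" for a b x
    using deriv[OF that] differentiableI_vector by blast
  have dir: "\<exists>a'. Q a' \<and> dir_deriv (T a) b = T a'" if a: "Q a" and b: "b \<in> Basis" for a b
  proof -
    obtain a' where a': "Q a'" "\<And>x. ((\<lambda>t. T a (x + t *\<^sub>R b)) has_vector_derivative T a' x) (at 0)"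
      using deriv[OF a b] by blast
    have "dir_deriv (T a) b = T a'"
      unfolding dir_deriv_def using a'(2) vector_derivative_at by blast
    with a'(1) show ?thesis by blast
  qed
  have iter: "\<exists>a'. Q a' \<and> iter_pd vs (T a) = T a'" if "set vs \<subseteq> Basis" for vs
    using that
  proof (induction vs)
    case Nil
    then show ?case using \<open>Q a\<close> by auto
  next
    case (Cons v vs)
    then show ?case using dir by fastforce
  qed
  have "bounded (range (\<lambda>x. ((1 + norm x) ^ k) *\<^sub>R T a x))" if Qa: "Q a" for a and k :: nat
  proof -
    obtain B where "\<And>x. (1 + norm x) ^ k * norm (T a x) \<le> B"
      using bdd[OF Qa] by blast
    then show ?thesis
      by (auto simp: bounded_iff intro!: exI[of _ B])
  qed
  note bounded = this
  have "continuous_on UNIV (iter_pd vs (T a)) \<and>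
      (\<forall>v\<in>Basis. \<forall>x. (\<lambda>t. iter_pd vs (T a) (x + t *\<^sub>R v)) differentiable (at 0)) \<and>
      (\<forall>k. bounded (range (\<lambda>x. ((1 + norm x) ^ k) *\<^sub>R iter_pd vs (T a) x)))"
    if vs: "set vs \<subseteq> Basis" for vs
  proof -
    obtain a' where a': "Q a'" "iter_pd vs (T a) = T a'"
      using iter[OF vs] by blast
    show ?thesis
      unfolding a'(2) using cont[OF a'(1)] diff[OF a'(1)] bounded[OF a'(1)] by blast
  qed
  then show ?thesis
    unfolding schwartz_def smooth_def by blast
qed

text \<open>\<open>iter_pd\<close> adds the outermost derivative at the head. Peeling off the
  innermost one instead is what shows that a derivative of a Schwartz function is Schwartz.\<close>

lemma iter_pd_snoc: "iter_pd (vs @ [b]) f = iter_pd vs (dir_deriv f b)"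
  by (induction vs) auto

lemma schwartz_continuous: "schwartz f \<Longrightarrow> continuous_on UNIV f"
  unfolding schwartz_def smooth_def by (metis empty_subsetI iter_pd.simps(1) list.set(1))

lemma schwartz_dir_deriv: "schwartz f \<Longrightarrow> b \<in> Basis \<Longrightarrow> schwartz (dir_deriv f b)"
  unfolding schwartz_def smooth_def by (simp flip: iter_pd_snoc)

lemma schwartz_iter_pd: "schwartz f \<Longrightarrow> set vs \<subseteq> Basis \<Longrightarrow> schwartz (iter_pd vs f)"
  by (induction vs) (auto simp: schwartz_dir_deriv)

text \<open>\<open>smooth\<close> differentiates each line only at parameter 0. Moving the base
  point along the line gives the derivative at every \<open>s\<close>, as the chain rule and the
  fundamental theorem of calculus require.\<close>

lemma schwartz_has_vector_derivative:
  assumes "schwartz f" "b \<in> Basis"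
  shows "((\<lambda>t. f (x + t *\<^sub>R b)) has_vector_derivative dir_deriv f b (x + s *\<^sub>R b)) (at s)"
proof -
  have "(\<lambda>t. iter_pd [] f (y + t *\<^sub>R b)) differentiable (at 0)" for y
    using assms unfolding schwartz_def smooth_def by (metis empty_subsetI list.set(1))
  then have "((\<lambda>t. f ((x + s *\<^sub>R b) + t *\<^sub>R b)) has_vector_derivative dir_deriv f b (x + s *\<^sub>R b)) (at 0)"
    unfolding dir_deriv_def by (simp add: vector_derivative_works[symmetric])
  then have "(((\<lambda>t. f (x + s *\<^sub>R b + t *\<^sub>R b)) \<circ> (\<lambda>t. t - s)) has_vector_derivative
      (1 *\<^sub>R dir_deriv f b (x + s *\<^sub>R b))) (at s)"
    by (intro vector_diff_chain_at) (auto intro!: derivative_eq_intros)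
  moreover have "((\<lambda>t. f (x + s *\<^sub>R b + t *\<^sub>R b)) \<circ> (\<lambda>t. t - s)) = (\<lambda>t. f (x + t *\<^sub>R b))"
    by (auto simp: algebra_simps)
  ultimately show ?thesis by simp
qed

lemma schwartz_has_vector_derivative_0:
  assumes "schwartz f" "b \<in> Basis"
  shows "((\<lambda>t. f (x + t *\<^sub>R b)) has_vector_derivative dir_deriv f b x) (at 0)"
  using schwartz_has_vector_derivative[OF assms, of x 0] by simp

lemma schwartz_bound:
  assumes "schwartz f"
  obtains B where "B > 0" "\<And>x. (1 + norm x) ^ k * norm (f x) \<le> B"
proof -
  have "bounded (range (\<lambda>x. ((1 + norm x) ^ k) *\<^sub>R iter_pd [] f x))"
    using assms unfolding schwartz_def by (metis empty_subsetI list.set(1))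
  then show ?thesis
    using that unfolding bounded_pos by auto
qed

lemma schwartz_bounded_linear:
  fixes f :: "real^'n \<Rightarrow> 'c::real_normed_vector" and L :: "'c \<Rightarrow> 'd::real_normed_vector"
  assumes "schwartz f" "bounded_linear L"
  shows "schwartz (\<lambda>x. L (f x))"
proof (rule schwartz_coinduct[where Q = schwartz and T = "\<lambda>f x. L (f x)", OF assms(1)])
  fix f :: "real^'n \<Rightarrow> 'c" assume f: "schwartz f"
  show "continuous_on UNIV (\<lambda>x. L (f x))"
    by (rule bounded_linear.continuous_on[OF assms(2) schwartz_continuous[OF f]])
  show "\<exists>f'. schwartz f' \<and> (\<forall>x. ((\<lambda>t. L (f (x + t *\<^sub>R b))) has_vector_derivative L (f' x)) (at 0))"
    if "b \<in> Basis" for b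
    using bounded_linear.has_vector_derivative[OF assms(2) schwartz_has_vector_derivative_0[OF f that]]
      schwartz_dir_deriv[OF f that] by blast
  fix k
  obtain B where B: "B > 0" "\<And>x. (1 + norm x) ^ k * norm (f x) \<le> B"
    using schwartz_bound[OF f] by blast
  obtain K where K: "K > 0" "\<And>x. norm (L x) \<le> norm x * K"
    using bounded_linear.pos_bounded[OF assms(2)] by blast
  have "(1 + norm x) ^ k * norm (L (f x)) \<le> B * K" for x
  proof -
    have "(1 + norm x) ^ k * norm (L (f x)) \<le> (1 + norm x) ^ k * (norm (f x) * K)"
      using K by (intro mult_left_mono) auto
    also have "\<dots> \<le> B * K"
      using B(2)[of x] K(1) by (simp add: mult.assoc[symmetric])
    finally show ?thesis .
  qed
  then show "\<exists>B. \<forall>x. (1 + norm x) ^ k * norm (L (f x)) \<le> B" by blast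
qed

lemma schwartz_add:
  fixes f g :: "real^'n \<Rightarrow> 'c::real_normed_vector"
  assumes "schwartz f" "schwartz g"
  shows "schwartz (\<lambda>x. f x + g x)"
proof -
  let ?Q = "\<lambda>(f :: real^'n \<Rightarrow> 'c, g :: real^'n \<Rightarrow> 'c). schwartz f \<and> schwartz g"
    and ?T = "\<lambda>(f :: real^'n \<Rightarrow> 'c, g) x. f x + g x"
  have "schwartz (?T (f, g))"
  proof (rule schwartz_coinduct[where Q = ?Q])
    show "?Q (f, g)" using assms by simp
    fix fg assume "?Q fg"
    then obtain f g where fg: "fg = (f, g)" "schwartz f" "schwartz g" by blast
    show "continuous_on UNIV (?T fg)"
      unfolding fg(1) prod.case by (intro continuous_on_add schwartz_continuous fg)
    show "\<exists>fg'. ?Q fg' \<and> (\<forall>x. ((\<lambda>t. ?T fg (x + t *\<^sub>R b)) has_vector_derivative ?T fg' x) (at 0))"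
      if "b \<in> Basis" for b
      using fg that by (intro exI[of _ "(dir_deriv f b, dir_deriv g b)"])
        (auto intro!: schwartz_dir_deriv has_vector_derivative_add schwartz_has_vector_derivative_0)
    fix k
    obtain B where B: "\<And>x. (1 + norm x) ^ k * norm (f x) \<le> B"
      using schwartz_bound[OF fg(2)] by blast
    obtain C where C: "\<And>x. (1 + norm x) ^ k * norm (g x) \<le> C"
      using schwartz_bound[OF fg(3)] by blast
    have "(1 + norm x) ^ k * norm (f x + g x) \<le> B + C" for x
    proof -
      have "(1 + norm x) ^ k * norm (f x + g x) \<le> (1 + norm x) ^ k * (norm (f x) + norm (g x))"
        by (intro mult_left_mono) (auto simp: norm_triangle_ineq)
      also have "\<dots> \<le> B + C"
        using B[of x] C[of x] by (simp add: distrib_left)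
      finally show ?thesis .
    qed
    then show "\<exists>B. \<forall>x. (1 + norm x) ^ k * norm (?T fg x) \<le> B" unfolding fg(1) prod.case by blast
  qed
  then show ?thesis by simp
qed

lemma schwartz_scaleR: "schwartz f \<Longrightarrow> schwartz (\<lambda>x. r *\<^sub>R f x)"
  by (rule schwartz_bounded_linear) (auto intro: bounded_linear_scaleR_right)

lemma schwartz_minus: "schwartz f \<Longrightarrow> schwartz (\<lambda>x. - f x)"
  using schwartz_scaleR[of f "-1"] by simp

lemma schwartz_diff: "schwartz f \<Longrightarrow> schwartz g \<Longrightarrow> schwartz (\<lambda>x. f x - g x)"
  using schwartz_add[of f "\<lambda>x. - g x"] schwartz_minus by fastforce

lemma schwartz_translate:
  fixes f :: "real^'n \<Rightarrow> 'c::real_normed_vector"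
  assumes "schwartz f"
  shows "schwartz (\<lambda>x. f (x - a))"
proof (rule schwartz_coinduct[where Q = schwartz and T = "\<lambda>f x. f (x - a)", OF assms])
  fix f :: "real^'n \<Rightarrow> 'c" assume f: "schwartz f"
  show "continuous_on UNIV (\<lambda>x. f (x - a))"
    by (auto intro!: continuous_on_compose2[OF schwartz_continuous[OF f]] continuous_intros)
  show "\<exists>f'. schwartz f' \<and> (\<forall>x. ((\<lambda>t. f (x + t *\<^sub>R b - a)) has_vector_derivative f' (x - a)) (at 0))"
    if b: "b \<in> Basis" for b
  proof -
    have "((\<lambda>t. f (x + t *\<^sub>R b - a)) has_vector_derivative dir_deriv f b (x - a)) (at 0)" for x
      using schwartz_has_vector_derivative_0[OF f b, of "x - a"] by (simp add: algebra_simps)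
    then show ?thesis using schwartz_dir_deriv[OF f b] by blast
  qed
  fix k
  obtain B where B: "B > 0" "\<And>x. (1 + norm x) ^ k * norm (f x) \<le> B"
    using schwartz_bound[OF f] by blast
  have "(1 + norm x) ^ k * norm (f (x - a)) \<le> (1 + norm a) ^ k * B" for x
  proof -
    have "norm x \<le> norm (x - a) + norm a"
      by (metis diff_add_cancel norm_triangle_ineq)
    \<comment> \<open>A Peetre-type inequality: a translation costs a constant factor in the
      weight.\<close>
    then have "1 + norm x \<le> (1 + norm a) * (1 + norm (x - a))"
      using mult_nonneg_nonneg[of "norm a" "norm (x - a)"] by (simp add: algebra_simps del: mult_nonneg_nonneg)
    then have "(1 + norm x) ^ k \<le> ((1 + norm a) * (1 + norm (x - a))) ^ k"
      by (intro power_mono) auto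
    then have "(1 + norm x) ^ k * norm (f (x - a)) \<le> ((1 + norm a) * (1 + norm (x - a))) ^ k * norm (f (x - a))"
      by (intro mult_right_mono) auto
    also have "\<dots> = (1 + norm a) ^ k * ((1 + norm (x - a)) ^ k * norm (f (x - a)))"
      by (simp add: power_mult_distrib)
    also have "\<dots> \<le> (1 + norm a) ^ k * B"
      using B by (intro mult_left_mono) auto
    finally show ?thesis .
  qed
  then show "\<exists>B. \<forall>x. (1 + norm x) ^ k * norm (f (x - a)) \<le> B" by blast
qed

section \<open>Schwartz functions with values in a C*-algebra, and their multipliers\<close>

locale cstar =
  fixes cscale :: "complex \<Rightarrow> 'c::{real_normed_algebra_1,banach} \<Rightarrow> 'c"
    and star :: "'c \<Rightarrow> 'c"
  assumes unital_cstar: "unital_cstar_algebra cscale star"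
begin

lemma cscale_simps [simp]:
  "cscale (complex_of_real r) x = r *\<^sub>R x"
  "cscale a (cscale b x) = cscale (a * b) x"
  "norm (cscale a x) = cmod a * norm x"
  and cscale_add: "cscale (a + b) x = cscale a x + cscale b x" "cscale a (x + y) = cscale a x + cscale a y"
  and cscale_mult: "cscale a x * y = cscale a (x * y)" "x * cscale a y = cscale a (x * y)"
  and star_add: "star (x + y) = star x + star y"
  and star_cscale [simp]: "star (cscale a x) = cscale (cnj a) (star x)"
  and star_mult: "star (x * y) = star y * star x"
  and star_star [simp]: "star (star x) = x"
  and norm_star_mult: "norm (star x * x) = (norm x)\<^sup>2"
  using unital_cstar unfolding unital_cstar_algebra_def by metis+

lemma cscale_1 [simp]: "cscale 1 x = x"
  using cscale_simps(1)[of 1 x] by simp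

lemma bounded_bilinear_cscale: "bounded_bilinear cscale"
proof (rule bounded_bilinear.intro)
  show "cscale (r *\<^sub>R a) x = r *\<^sub>R cscale a x" for r a x
    using cscale_simps(1)[of r "cscale a x"] by (simp add: scaleR_conv_of_real)
  show "cscale a (r *\<^sub>R x) = r *\<^sub>R cscale a x" for r a x
    using cscale_simps(1)[of r "cscale a x"] cscale_simps(2)[of a "of_real r" x]
    by (simp add: mult.commute)
qed (auto simp: cscale_add intro!: exI[of _ 1])

sublocale cscale: bounded_bilinear cscale
  by (rule bounded_bilinear_cscale)

lemma star_1 [simp]: "star 1 = 1"
  by (metis mult.right_neutral star_mult star_star)

lemma norm_star [simp]: "norm (star x) = norm x"
proof -
  have *: "norm y \<le> norm (star y)" for y
  proof (cases "y = 0")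
    case False
    have "(norm y)\<^sup>2 \<le> norm (star y) * norm y"
      using norm_star_mult[of y] norm_mult_ineq[of "star y" y] by simp
    then show ?thesis using False by (simp add: power2_eq_square)
  qed simp
  from *[of x] *[of "star x"] show ?thesis by simp
qed

lemma bounded_linear_star: "bounded_linear star"
proof (rule bounded_linear_intro[of _ 1])
  show "star (r *\<^sub>R x) = r *\<^sub>R star x" for r x
    using star_cscale[of "of_real r" x] by simp
qed (auto simp: star_add)

lemma schwartz_cscale: "schwartz f \<Longrightarrow> schwartz (\<lambda>x. cscale a (f x))"
  by (rule schwartz_bounded_linear) (auto intro: cscale.bounded_linear_right)

lemma schwartz_Ushift:
  fixes f :: "real^'n \<Rightarrow> 'c"
  assumes "schwartz f"
  shows "schwartz (Ushift cscale a b f)"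
proof -
  have "schwartz (\<lambda>x. cscale (cis (b \<bullet> x)) (f x))" if "schwartz f" for f
  proof (rule schwartz_coinduct[where Q = schwartz and T = "\<lambda>f x. cscale (cis (b \<bullet> x)) (f x)", OF that])
    fix f :: "real^'n \<Rightarrow> 'c" assume f: "schwartz f"
    show "continuous_on UNIV (\<lambda>x. cscale (cis (b \<bullet> x)) (f x))"
      by (intro cscale.continuous_on schwartz_continuous[OF f]) (intro continuous_intros)
    show "\<exists>f'. schwartz f' \<and> (\<forall>x. ((\<lambda>t. cscale (cis (b \<bullet> (x + t *\<^sub>R v))) (f (x + t *\<^sub>R v))) has_vector_derivative
        cscale (cis (b \<bullet> x)) (f' x)) (at 0))" if v: "v \<in> Basis" for v
    proof (intro exI conjI allI)
      \<comment> \<open>The derivative of the modulation is a multiple of the modulation, so the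
        phase factors out and only the code \<open>f\<close> changes.\<close>
      let ?f' = "\<lambda>x. cscale (\<i> * of_real (b \<bullet> v)) (f x) + dir_deriv f v x"
      show "schwartz ?f'"
        using f v by (intro schwartz_add schwartz_cscale schwartz_dir_deriv)
      fix x
      have "((\<lambda>t. cis (b \<bullet> (x + t *\<^sub>R v))) has_vector_derivative
          (b \<bullet> v) *\<^sub>R (\<i> * cis (b \<bullet> x))) (at 0)"
        unfolding has_vector_derivative_def
        by (auto intro!: derivative_eq_intros ext simp: inner_add_right)
      from cscale.has_vector_derivative[OF this schwartz_has_vector_derivative_0[OF f v, of x]]
      show "((\<lambda>t. cscale (cis (b \<bullet> (x + t *\<^sub>R v))) (f (x + t *\<^sub>R v))) has_vector_derivative
          cscale (cis (b \<bullet> x)) (?f' x)) (at 0)"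
        by (simp add: cscale_add scaleR_conv_of_real algebra_simps)
    qed
    show "\<exists>B. \<forall>x. (1 + norm x) ^ k * norm (cscale (cis (b \<bullet> x)) (f x)) \<le> B" for k
      using schwartz_bound[OF f, of k] by auto
  qed
  from this[OF schwartz_translate[OF assms]] show ?thesis
    unfolding Ushift_def .
qed

text \<open>The product rule leaves a term without the coordinate factor, so these multiples alone
  are not closed under differentiation. The codes are therefore pairs \<open>(f, g)\<close>,
  standing for \<open>i (b . x) f + g\<close>.\<close>

lemma schwartz_coord_mult:
  fixes f :: "real^'n \<Rightarrow> 'c"
  assumes "schwartz f"
  shows "schwartz (\<lambda>x. cscale (\<i> * of_real (b \<bullet> x)) (f x))"
proof -
  let ?M = "\<lambda>f x. cscale (\<i> * of_real (b \<bullet> x)) (f x)"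
  let ?Q = "\<lambda>(f :: real^'n \<Rightarrow> 'c, g :: real^'n \<Rightarrow> 'c). schwartz f \<and> schwartz g" and ?T = "\<lambda>(f, g) x. ?M f x + g x"
  have "schwartz (?T (f, g))" if "schwartz f" "schwartz g" for f g :: "real^'n \<Rightarrow> 'c"
  proof (rule schwartz_coinduct[where Q = ?Q])
    show "?Q (f, g)" using that by simp
    fix fg assume "?Q fg"
    then obtain f g where fg: "fg = (f, g)" and f: "schwartz f" "schwartz g" by blast
    show "continuous_on UNIV (?T fg)"
      unfolding fg prod.case
      by (intro continuous_on_add cscale.continuous_on schwartz_continuous[OF f(1)] schwartz_continuous[OF f(2)])
        (intro continuous_intros)
    show "\<exists>fg'. ?Q fg' \<and> (\<forall>x. ((\<lambda>t. ?T fg (x + t *\<^sub>R v)) has_vector_derivative ?T fg' x) (at 0))"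
      if v: "v \<in> Basis" for v
    proof (intro exI conjI allI)
      let ?g' = "\<lambda>x. cscale (\<i> * of_real (b \<bullet> v)) (f x) + dir_deriv g v x"
      show "?Q (dir_deriv f v, ?g')"
        using f v by (auto intro!: schwartz_add schwartz_cscale schwartz_dir_deriv)
      fix x
      have "((\<lambda>t. \<i> * of_real (b \<bullet> (x + t *\<^sub>R v))) has_vector_derivative \<i> * of_real (b \<bullet> v)) (at 0)"
        by (auto intro!: derivative_eq_intros simp: inner_add_right)
      from has_vector_derivative_add[OF
          cscale.has_vector_derivative[OF this schwartz_has_vector_derivative_0[OF f(1) v, of x]]
          schwartz_has_vector_derivative_0[OF f(2) v, of x]]
      show "((\<lambda>t. ?T fg (x + t *\<^sub>R v)) has_vector_derivative ?T (dir_deriv f v, ?g') x) (at 0)"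
        by (simp add: fg add.assoc)
    qed
    fix k
    \<comment> \<open>One extra power of the weight pays for the factor
      \<open>b . x\<close>.\<close>
    obtain B where B: "B > 0" "\<And>x. (1 + norm x) ^ (Suc k) * norm (f x) \<le> B"
      using schwartz_bound[OF f(1)] by blast
    obtain C where C: "C > 0" "\<And>x. (1 + norm x) ^ k * norm (g x) \<le> C"
      using schwartz_bound[OF f(2)] by blast
    have "(1 + norm x) ^ k * norm (?M f x + g x) \<le> norm b * B + C" for x
    proof -
      have "\<bar>b \<bullet> x\<bar> \<le> norm b * (1 + norm x)"
        using Cauchy_Schwarz_ineq2[of b x] by (simp add: distrib_left add_increasing)
      then have "norm (?M f x) \<le> norm b * (1 + norm x) * norm (f x)"
        by (simp add: norm_mult mult_right_mono)
      then have "norm (?M f x + g x) \<le> norm b * (1 + norm x) * norm (f x) + norm (g x)"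
        using norm_triangle_ineq[of "?M f x" "g x"] by linarith
      then have "(1 + norm x) ^ k * norm (?M f x + g x) \<le> (1 + norm x) ^ k * (norm b * (1 + norm x) * norm (f x) + norm (g x))"
        by (intro mult_left_mono) auto
      also have "\<dots> = norm b * ((1 + norm x) ^ (Suc k) * norm (f x)) + (1 + norm x) ^ k * norm (g x)"
        by (simp add: algebra_simps)
      also have "\<dots> \<le> norm b * B + C"
        by (intro add_mono mult_left_mono B C) auto
      finally show ?thesis .
    qed
    then show "\<exists>B. \<forall>x. (1 + norm x) ^ k * norm (?T fg x) \<le> B" unfolding fg prod.case by blast
  qed
  \<comment> \<open>The zero function in the second slot, written as \<open>f - f\<close>.\<close>
  from this[OF assms, of "\<lambda>x. f x - f x"] show ?thesis
    using schwartz_diff[OF assms assms] by simp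
qed

text \<open>A code \<open>(N, f)\<close> stands for \<open>f\<close> divided by the N-th power of
  \<open>d x = 1 - i (b . x)\<close>: each derivative, put over a common denominator, raises
  \<open>N\<close> by one. As the modulus of \<open>d\<close> is at least 1, dividing never worsens
  the decay.\<close>

lemma schwartz_coord_resolvent:
  fixes f :: "real^'n \<Rightarrow> 'c"
  assumes "schwartz f"
  shows "schwartz (\<lambda>x. cscale (inverse (1 - \<i> * of_real (b \<bullet> x))) (f x))"
proof -
  define d where "d x = 1 - \<i> * complex_of_real (b \<bullet> x)" for x
  have d0: "d x \<noteq> 0" for x
    by (auto simp: d_def complex_eq_iff)
  have d1: "cmod (d x) \<ge> 1" for x
    using abs_Re_le_cmod[of "d x"] by (simp add: d_def)
  let ?T = "\<lambda>(N, f) x. cscale (inverse (d x) ^ N) (f x)"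
  have "schwartz (?T (Suc 0, f))"
  proof (rule schwartz_coinduct[where Q = "\<lambda>(N, f). schwartz f"])
    show "(\<lambda>(N, f). schwartz f) (Suc 0, f)" using assms by simp
    fix Nf :: "nat \<times> (real^'n \<Rightarrow> 'c)" assume "(\<lambda>(N, f). schwartz f) Nf"
    then obtain N f where Nf: "Nf = (N, f)" and f: "schwartz f" by blast
    have "continuous_on UNIV d" unfolding d_def by (intro continuous_intros)
    then have "continuous_on UNIV (\<lambda>x. inverse (d x) ^ N)"
      by (intro continuous_on_power continuous_on_inverse) (auto simp: d0)
    then show "continuous_on UNIV (?T Nf)"
      unfolding Nf prod.case by (intro cscale.continuous_on schwartz_continuous[OF f])
    show "\<exists>Nf'. (\<lambda>(N, f). schwartz f) Nf' \<and>
        (\<forall>x. ((\<lambda>t. ?T Nf (x + t *\<^sub>R v)) has_vector_derivative ?T Nf' x) (at 0))" if v: "v \<in> Basis" for v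
    proof (intro exI conjI allI)
      let ?F = "\<lambda>x. cscale (d x) (dir_deriv f v x) + cscale (of_nat N * (\<i> * of_real (b \<bullet> v))) (f x)"
      \<comment> \<open>The product of \<open>d\<close> and \<open>dir_deriv f v\<close>, expanded
        so that \<open>schwartz_coord_mult\<close> applies.\<close>
      have "schwartz (\<lambda>x. (dir_deriv f v x - cscale (\<i> * of_real (b \<bullet> x)) (dir_deriv f v x)) +
          cscale (of_nat N * (\<i> * of_real (b \<bullet> v))) (f x))"
        using f v by (intro schwartz_add schwartz_diff schwartz_cscale schwartz_dir_deriv schwartz_coord_mult)
      then show "(\<lambda>(N, f). schwartz f) (Suc N, ?F)" by (simp add: d_def cscale.diff_left)
      fix x
      have dd: "cscale (inverse (d x) ^ Suc N) (cscale (d x) y) = cscale (inverse (d x) ^ N) y" for y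
      proof -
        have "inverse (d x) ^ Suc N * d x = inverse (d x) ^ N"
          using d0[of x] by simp
        then show ?thesis by (simp del: power_Suc)
      qed
      have der: "((\<lambda>t. d (x + t *\<^sub>R v)) has_vector_derivative - (\<i> * of_real (b \<bullet> v))) (at 0)"
        unfolding d_def
        by (auto intro!: derivative_eq_intros simp: inner_add_right)
      have "((\<lambda>z. inverse z ^ N) has_field_derivative - (of_nat N * inverse (d x) ^ Suc N)) (at (d (x + 0 *\<^sub>R v)))"
        using DERIV_power[OF DERIV_inverse[OF d0[of x]], of N] by (cases N) (auto simp: mult_ac)
      from field_vector_diff_chain_at[OF der this]
      have "((\<lambda>t. inverse (d (x + t *\<^sub>R v)) ^ N) has_vector_derivative
          (\<i> * of_real (b \<bullet> v)) * (of_nat N * inverse (d x) ^ Suc N)) (at 0)"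
        by (simp add: o_def)
      from cscale.has_vector_derivative[OF this schwartz_has_vector_derivative_0[OF f v, of x]]
      show "((\<lambda>t. ?T Nf (x + t *\<^sub>R v)) has_vector_derivative ?T (Suc N, ?F) x) (at 0)"
        unfolding Nf prod.case cscale_add dd by (simp add: mult_ac)
    qed
    fix k
    obtain B where B: "\<And>x. (1 + norm x) ^ k * norm (f x) \<le> B"
      using schwartz_bound[OF f] by blast
    have "(1 + norm x) ^ k * norm (cscale (inverse (d x) ^ N) (f x)) \<le> B" for x
    proof -
      have "cmod (inverse (d x) ^ N) \<le> 1"
        using d1[of x] by (simp add: norm_power norm_inverse power_le_one inverse_le_1_iff)
      then have "norm (cscale (inverse (d x) ^ N) (f x)) \<le> 1 * norm (f x)"
        unfolding cscale_simps by (intro mult_right_mono) auto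
      then have "(1 + norm x) ^ k * norm (cscale (inverse (d x) ^ N) (f x)) \<le> (1 + norm x) ^ k * norm (f x)"
        by (intro mult_left_mono) auto
      with B[of x] show ?thesis by linarith
    qed
    then show "\<exists>B. \<forall>x. (1 + norm x) ^ k * norm (?T Nf x) \<le> B" unfolding Nf prod.case by blast
  qed
  then show ?thesis by (simp add: d_def)
qed

end

section \<open>The resolvent of translations and product kernels\<close>

lemma power_le_fact_mult_exp:
  fixes y :: real
  assumes "y \<ge> 0"
  shows "y ^ k \<le> fact k * exp y"
proof -
  have "(\<Sum>n\<in>{k}. y ^ n /\<^sub>R fact n) \<le> (\<Sum>n. y ^ n /\<^sub>R fact n)"
    using assms summable_exp_generic[of y] by (intro sum_le_suminf) auto
  then show ?thesis
    by (simp add: exp_def field_simps)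
qed

text \<open>With \<open>s = -2 ln u\<close> this says that \<open>e^(-s/2) (1 + s)^k\<close> is
  bounded: the factor \<open>u\<close> in \<open>2 u du = e^(-s) ds\<close> is strong enough to
  absorb any polynomial loss caused by a translation by \<open>s\<close>.\<close>

lemma add_mult_ln_power_bounded:
  obtains C where "C > 0" "\<And>u::real. u \<in> {0..1} \<Longrightarrow> u * (1 + \<bar>2 * ln u\<bar>) ^ k \<le> C"
proof
  show "2 ^ k * fact k * exp (1/2) > (0::real)" by simp
  fix u :: real assume u: "u \<in> {0..1}"
  show "u * (1 + \<bar>2 * ln u\<bar>) ^ k \<le> 2 ^ k * fact k * exp (1/2)"
  proof (cases "u = 0")
    case False
    \<comment> \<open>This is \<open>(1 + s) / 2\<close>. Then \<open>exp y\<close> equals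
      \<open>exp (1/2) / u\<close>, which cancels the factor \<open>u\<close> exactly; halving
      produces the \<open>2 ^ k\<close>.\<close>
    define y where "y = (1 + \<bar>2 * ln u\<bar>) / 2"
    have l: "ln u \<le> 0" "u > 0" using u False by auto
    have y: "y \<ge> 0" by (simp add: y_def)
    have "1 + \<bar>2 * ln u\<bar> = 2 * y"
      by (simp add: y_def)
    then have "(1 + \<bar>2 * ln u\<bar>) ^ k = 2 ^ k * y ^ k"
      by (simp only: power_mult_distrib)
    also have "\<dots> \<le> 2 ^ k * (fact k * exp y)"
      using power_le_fact_mult_exp[OF y] by (intro mult_left_mono) auto
    also have "exp y = exp (1/2) * inverse u"
    proof -
      have a: "\<bar>2 * ln u\<bar> = - (2 * ln u)"
        using mult_nonneg_nonpos[of 2 "ln u"] l(1) by (intro abs_of_nonpos) auto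
      have "y = 1/2 - ln u"
        unfolding y_def a by (simp add: field_simps)
      then show ?thesis
        by (simp only: exp_diff exp_ln[OF l(2)] divide_inverse[of "exp (1/2)"])
    qed
    finally have "u * (1 + \<bar>2 * ln u\<bar>) ^ k \<le> u * (2 ^ k * (fact k * (exp (1/2) * inverse u)))"
      using l by (intro mult_left_mono) auto
    also have "\<dots> = 2 ^ k * fact k * exp (1/2)"
      using l(2) by simp
    finally show ?thesis .
  qed simp
qed

text \<open>The resolvent \<open>\<integral>\<^sub>0\<^sup>\<infinity> e\<^sup>-\<^sup>s f (x - s b) ds\<close> of the translation group, after the
  substitution \<open>s = - 2 ln u\<close>, which makes the integrand continuous on \<open>[0, 1]\<close>.\<close>

definition transl_res :: "real^'n \<Rightarrow> (real^'n \<Rightarrow> 'c::banach) \<Rightarrow> real^'n \<Rightarrow> 'c" where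
  "transl_res b f x = integral (cbox 0 1) (\<lambda>u. (2 * u) *\<^sub>R f (x + (2 * ln u) *\<^sub>R b))"

text \<open>The delicate point is \<open>u = 0\<close>, where the argument of \<open>f\<close> has
  in general no limit. Boundedness of \<open>f\<close> and the factor \<open>2 u\<close> force the
  integrand to 0 there, whatever value \<open>ln\<close> takes at 0. The plain substitution
  \<open>s = - ln u\<close> would leave no such factor.\<close>

lemma transl_res_integrand_continuous:
  fixes f :: "real^'n \<Rightarrow> 'c::banach" and X :: "'a::t2_space \<Rightarrow> real^'n"
  assumes "schwartz f" "continuous_on UNIV X"
  shows "continuous_on (UNIV \<times> cbox 0 1) (\<lambda>(t, u). (2 * u) *\<^sub>R f (X t + (2 * ln u) *\<^sub>R b))"
proof -
  obtain B where B: "B > 0" "\<And>x. (1 + norm x) ^ 0 * norm (f x) \<le> B"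
    using schwartz_bound[OF assms(1)] by blast
  have "((\<lambda>p. (2 * snd p) *\<^sub>R f (X (fst p) + (2 * ln (snd p)) *\<^sub>R b)) \<longlongrightarrow>
      (2 * u) *\<^sub>R f (X t + (2 * ln u) *\<^sub>R b)) (at (t, u) within UNIV \<times> cbox 0 1)"
    if "u \<in> cbox 0 1" for t :: 'a and u :: real
  proof (cases "u = 0")
    case True
    have "((\<lambda>p::'a \<times> real. 2 * \<bar>snd p\<bar> * B) \<longlongrightarrow> 2 * \<bar>snd (t, u)\<bar> * B) (at (t, u) within UNIV \<times> cbox 0 1)"
      by (intro tendsto_intros)
    then have "((\<lambda>p::'a \<times> real. 2 * \<bar>snd p\<bar> * B) \<longlongrightarrow> 0) (at (t, u) within UNIV \<times> cbox 0 1)"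
      using True by simp
    then have "((\<lambda>p. (2 * snd p) *\<^sub>R f (X (fst p) + (2 * ln (snd p)) *\<^sub>R b)) \<longlongrightarrow> 0)
        (at (t, u) within UNIV \<times> cbox 0 1)"
    proof (rule Lim_null_comparison[rotated])
      have "norm ((2 * snd p) *\<^sub>R f (X (fst p) + (2 * ln (snd p)) *\<^sub>R b)) \<le> 2 * \<bar>snd p\<bar> * B" for p :: "'a \<times> real"
        using B(2) by (simp add: abs_mult mult_left_mono)
      then show "\<forall>\<^sub>F p in at (t, u) within UNIV \<times> cbox 0 1.
          norm ((2 * snd p) *\<^sub>R f (X (fst p) + (2 * ln (snd p)) *\<^sub>R b)) \<le> 2 * \<bar>snd p\<bar> * B"
        by (intro always_eventually allI)
    qed
    then show ?thesis using True by simp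
  next
    case False
    have cf: "isCont f y" for y
      using schwartz_continuous[OF assms(1)] by (simp add: continuous_on_eq_continuous_at)
    have cX: "isCont X t"
      using assms(2) by (simp add: continuous_on_eq_continuous_at)
    let ?F = "at (t, u) within UNIV \<times> cbox 0 1"
    have 1: "(fst \<longlongrightarrow> t) ?F" "(snd \<longlongrightarrow> u) ?F"
      using tendsto_fst[OF tendsto_ident_at[of "(t, u)" "UNIV \<times> cbox 0 1"]]
        tendsto_snd[OF tendsto_ident_at[of "(t, u)" "UNIV \<times> cbox 0 1"]] by simp_all
    have 2: "((\<lambda>p. X (fst p)) \<longlongrightarrow> X t) ?F"
      by (rule isCont_tendsto_compose[OF cX 1(1)])
    have 3: "((\<lambda>p. ln (snd p)) \<longlongrightarrow> ln u) ?F"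
      by (rule tendsto_ln[OF 1(2) False])
    have "((\<lambda>p. X (fst p) + (2 * ln (snd p)) *\<^sub>R b) \<longlongrightarrow> X t + (2 * ln u) *\<^sub>R b) ?F"
      by (rule tendsto_add[OF 2 tendsto_scaleR[OF tendsto_mult_left[OF 3] tendsto_const]])
    from tendsto_scaleR[OF tendsto_mult_left[OF 1(2)] isCont_tendsto_compose[OF cf this]]
    have "((\<lambda>p. (2 * snd p) *\<^sub>R f (X (fst p) + (2 * ln (snd p)) *\<^sub>R b)) \<longlongrightarrow>
        (2 * u) *\<^sub>R f (X t + (2 * ln u) *\<^sub>R b)) ?F" .
    then show ?thesis .
  qed
  note lim = this
  have "\<forall>p\<in>UNIV \<times> cbox 0 1. ((\<lambda>p. (2 * snd p) *\<^sub>R f (X (fst p) + (2 * ln (snd p)) *\<^sub>R b)) \<longlongrightarrow>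
      (2 * snd p) *\<^sub>R f (X (fst p) + (2 * ln (snd p)) *\<^sub>R b)) (at p within UNIV \<times> cbox 0 1)"
  proof
    fix p :: "'a \<times> real" assume "p \<in> UNIV \<times> cbox 0 1"
    then show "((\<lambda>p. (2 * snd p) *\<^sub>R f (X (fst p) + (2 * ln (snd p)) *\<^sub>R b)) \<longlongrightarrow>
      (2 * snd p) *\<^sub>R f (X (fst p) + (2 * ln (snd p)) *\<^sub>R b)) (at p within UNIV \<times> cbox 0 1)"
      using lim[of "snd p" "fst p"] by (simp only: mem_Times_iff prod.collapse)
  qed
  then show ?thesis
    unfolding continuous_on_def split_beta .
qed

lemma transl_res_integrable:
  fixes f :: "real^'n \<Rightarrow> 'c::banach"
  assumes "schwartz f"
  shows "continuous_on (cbox 0 1) (\<lambda>u. (2 * u) *\<^sub>R f (x + (2 * ln u) *\<^sub>R b))"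
    and "(\<lambda>u. (2 * u) *\<^sub>R f (x + (2 * ln u) *\<^sub>R b)) integrable_on cbox 0 1"
proof -
  let ?h = "\<lambda>u. (2 * u) *\<^sub>R f (x + (2 * ln u) *\<^sub>R b)"
  have "continuous_on (cbox 0 1) ((\<lambda>(t::real, u). (2 * u) *\<^sub>R f (x + (2 * ln u) *\<^sub>R b)) \<circ> (\<lambda>u. (0, u)))"
    by (intro continuous_on_compose continuous_on_subset[OF transl_res_integrand_continuous[OF assms]]
      continuous_intros) auto
  then show "continuous_on (cbox 0 1) ?h"
    by (simp add: o_def)
  then show "?h integrable_on cbox 0 1"
    by (rule integrable_continuous)
qed

lemma transl_res_has_vector_derivative:
  fixes f :: "real^'n \<Rightarrow> 'c::banach"
  assumes "schwartz f" "v \<in> Basis"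
  shows "((\<lambda>t. transl_res b f (x + t *\<^sub>R v)) has_vector_derivative
      transl_res b (dir_deriv f v) x) (at 0)"
proof -
  have "((\<lambda>t. integral (cbox 0 1) (\<lambda>u. (2 * u) *\<^sub>R f ((x + t *\<^sub>R v) + (2 * ln u) *\<^sub>R b))) has_vector_derivative
      integral (cbox 0 1) (\<lambda>u. (2 * u) *\<^sub>R dir_deriv f v ((x + 0 *\<^sub>R v) + (2 * ln u) *\<^sub>R b))) (at 0 within UNIV)"
  proof (rule leibniz_rule_vector_derivative)
    fix t u :: real
    have "((\<lambda>t. f ((x + (2 * ln u) *\<^sub>R b) + t *\<^sub>R v)) has_vector_derivative
        dir_deriv f v ((x + (2 * ln u) *\<^sub>R b) + t *\<^sub>R v)) (at t)"
      by (rule schwartz_has_vector_derivative[OF assms])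
    then have "((\<lambda>t. f (x + t *\<^sub>R v + (2 * ln u) *\<^sub>R b)) has_vector_derivative
        dir_deriv f v (x + t *\<^sub>R v + (2 * ln u) *\<^sub>R b)) (at t)"
      by (simp add: algebra_simps)
    then show "((\<lambda>t. (2 * u) *\<^sub>R f (x + t *\<^sub>R v + (2 * ln u) *\<^sub>R b)) has_vector_derivative
        (2 * u) *\<^sub>R dir_deriv f v (x + t *\<^sub>R v + (2 * ln u) *\<^sub>R b)) (at t within UNIV)"
      using bounded_linear.has_vector_derivative[OF bounded_linear_scaleR_right] by blast
  next
    show "continuous_on (UNIV \<times> cbox 0 1) (\<lambda>(t, u). (2 * u) *\<^sub>R dir_deriv f v (x + t *\<^sub>R v + (2 * ln u) *\<^sub>R b))"
      by (intro transl_res_integrand_continuous schwartz_dir_deriv assms continuous_intros)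
  qed (use transl_res_integrable(2)[OF assms(1)] in auto)
  then show ?thesis
    by (simp add: transl_res_def)
qed

lemma schwartz_transl_res:
  fixes f :: "real^'n \<Rightarrow> 'c::banach"
  assumes "schwartz f" and b: "b \<in> Basis"
  shows "schwartz (transl_res b f)"
proof (rule schwartz_coinduct[where Q = schwartz, OF assms(1)])
  fix f :: "real^'n \<Rightarrow> 'c" assume f: "schwartz f"
  show "continuous_on UNIV (transl_res b f)"
    unfolding transl_res_def[abs_def]
    by (intro integral_continuous_on_param transl_res_integrand_continuous f continuous_intros)
  show "\<exists>f'. schwartz f' \<and> (\<forall>x. ((\<lambda>t. transl_res b f (x + t *\<^sub>R v)) has_vector_derivative
      transl_res b f' x) (at 0))" if "v \<in> Basis" for v
    using transl_res_has_vector_derivative[OF f that] schwartz_dir_deriv[OF f that] by blast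
  fix k
  obtain B where B: "B > 0" "\<And>x. (1 + norm x) ^ k * norm (f x) \<le> B"
    using schwartz_bound[OF f] by blast
  obtain C where C: "C > 0" "\<And>u::real. u \<in> {0..1} \<Longrightarrow> u * (1 + \<bar>2 * ln u\<bar>) ^ k \<le> C"
    using add_mult_ln_power_bounded by blast
  have "(1 + norm x) ^ k * norm (transl_res b f x) \<le> 2 * C * B" for x
  proof -
    let ?h = "\<lambda>u. (1 + norm x) ^ k *\<^sub>R ((2 * u) *\<^sub>R f (x + (2 * ln u) *\<^sub>R b))"
    have "norm (integral (cbox 0 1) ?h) \<le> 2 * C * B * measure lborel (cbox 0 (1::real))"
    proof (rule has_integral_bound)
      show "(?h has_integral integral (cbox 0 1) ?h) (cbox 0 1)"
        by (intro integrable_integral integrable_cmul transl_res_integrable(2) f)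
    next
      fix u :: real assume u: "u \<in> cbox 0 1"
      let ?y = "x + (2 * ln u) *\<^sub>R b"
      have "norm x \<le> norm ?y + norm ((2 * ln u) *\<^sub>R b)"
        using norm_triangle_ineq4[of ?y "(2 * ln u) *\<^sub>R b"] by simp
      \<comment> \<open>Moving by \<open>s = -2 ln u\<close> loses a factor
        \<open>(1 + s)^k\<close>, which the factor \<open>u\<close> of the integrand pays for
        through the bound \<open>C\<close>.\<close>
      then have "1 + norm x \<le> (1 + \<bar>2 * ln u\<bar>) * (1 + norm ?y)"
        using mult_nonneg_nonneg[of "\<bar>2 * ln u\<bar>" "norm ?y"] b by (simp add: algebra_simps del: mult_nonneg_nonneg)
      then have "(1 + norm x) ^ k \<le> ((1 + \<bar>2 * ln u\<bar>) * (1 + norm ?y)) ^ k"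
        by (intro power_mono) auto
      then have "(1 + norm x) ^ k * (2 * u * norm (f ?y)) \<le> ((1 + \<bar>2 * ln u\<bar>) * (1 + norm ?y)) ^ k * (2 * u * norm (f ?y))"
        using u by (intro mult_right_mono) auto
      also have "\<dots> = 2 * (u * (1 + \<bar>2 * ln u\<bar>) ^ k) * ((1 + norm ?y) ^ k * norm (f ?y))"
        by (simp add: power_mult_distrib)
      also have "\<dots> \<le> 2 * C * B"
        using C(1) C(2)[of u] B(1) B(2)[of ?y] u by (intro mult_mono mult_left_mono) auto
      finally show "norm (?h u) \<le> 2 * C * B"
        using u by simp
    qed (use B C in auto)
    then show ?thesis
      by (simp add: transl_res_def del: scaleR_scaleR)
  qed
  then show "\<exists>B. \<forall>x. (1 + norm x) ^ k * norm (transl_res b f x) \<le> B" by blast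
qed

text \<open>The two integrands add up to the derivative of \<open>u^2 f(x + 2 ln u b)\<close>, which
  equals \<open>f x\<close> at \<open>u = 1\<close> and vanishes at \<open>u = 0\<close>.\<close>

lemma transl_res_eq:
  fixes f :: "real^'n \<Rightarrow> 'c::banach"
  assumes f: "schwartz f" and b: "b \<in> Basis"
  shows "transl_res b f x + dir_deriv (transl_res b f) b x = f x"
proof -
  have "dir_deriv (transl_res b f) b x = transl_res b (dir_deriv f b) x"
    unfolding dir_deriv_def[of "transl_res b f"]
    using transl_res_has_vector_derivative[OF assms] vector_derivative_at by blast
  then have eq: "transl_res b f x + dir_deriv (transl_res b f) b x =
      integral (cbox 0 1) (\<lambda>u. (2 * u) *\<^sub>R f (x + (2 * ln u) *\<^sub>R b) + (2 * u) *\<^sub>R dir_deriv f b (x + (2 * ln u) *\<^sub>R b))"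
    unfolding transl_res_def
    by (simp add: integral_add transl_res_integrable(2)[unfolded cbox_interval] f b schwartz_dir_deriv)
  have "((\<lambda>u. (2 * u) *\<^sub>R f (x + (2 * ln u) *\<^sub>R b) + (2 * u) *\<^sub>R dir_deriv f b (x + (2 * ln u) *\<^sub>R b)) has_integral
      ((1::real)\<^sup>2 *\<^sub>R f (x + (2 * ln 1) *\<^sub>R b) - 0\<^sup>2 *\<^sub>R f (x + (2 * ln 0) *\<^sub>R b))) {0..1}"
  proof (rule fundamental_theorem_of_calculus_interior)
    have "continuous_on {0..1} (\<lambda>u. (2 * u) *\<^sub>R f (x + (2 * ln u) *\<^sub>R b))"
      using transl_res_integrable(1)[OF f] by simp
    then have "continuous_on {0..1} (\<lambda>u. (u / 2) *\<^sub>R ((2 * u) *\<^sub>R f (x + (2 * ln u) *\<^sub>R b)))"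
      by (rule continuous_on_scaleR[rotated]) (intro continuous_intros, simp)
    then show "continuous_on {0..1} (\<lambda>u. u\<^sup>2 *\<^sub>R f (x + (2 * ln u) *\<^sub>R b))"
      by (simp add: power2_eq_square)
  next
    fix u :: real assume u: "u \<in> {0<..<1}"
    have "((\<lambda>u. 2 * ln u) has_vector_derivative 2 / u) (at u)"
      using u by (auto intro!: derivative_eq_intros simp flip: has_real_derivative_iff_has_vector_derivative)
    from vector_diff_chain_at[OF this schwartz_has_vector_derivative[OF f b, of x]]
    have "((\<lambda>u. f (x + (2 * ln u) *\<^sub>R b)) has_vector_derivative (2 / u) *\<^sub>R dir_deriv f b (x + (2 * ln u) *\<^sub>R b)) (at u)"
      by (simp add: o_def)
    moreover have "((\<lambda>u. u\<^sup>2) has_real_derivative 2 * u) (at u)"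
      by (auto intro!: derivative_eq_intros)
    ultimately have "((\<lambda>u. u\<^sup>2 *\<^sub>R f (x + (2 * ln u) *\<^sub>R b)) has_vector_derivative
        (u\<^sup>2 *\<^sub>R ((2 / u) *\<^sub>R dir_deriv f b (x + (2 * ln u) *\<^sub>R b)) + (2 * u) *\<^sub>R f (x + (2 * ln u) *\<^sub>R b))) (at u)"
      by (intro has_vector_derivative_scaleR)
    then show "((\<lambda>u. u\<^sup>2 *\<^sub>R f (x + (2 * ln u) *\<^sub>R b)) has_vector_derivative
        ((2 * u) *\<^sub>R f (x + (2 * ln u) *\<^sub>R b) + (2 * u) *\<^sub>R dir_deriv f b (x + (2 * ln u) *\<^sub>R b))) (at u)"
      using u by (simp add: power2_eq_square add.commute mult.commute[of u 2])
  qed simp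
  then show ?thesis
    using eq by (simp add: integral_unique)
qed

section \<open>Products of one-variable functions\<close>

lemma one_plus_sum_le_prod:
  fixes a :: "'a \<Rightarrow> real"
  assumes "finite S" "\<And>i. i \<in> S \<Longrightarrow> a i \<ge> 0"
  shows "1 + sum a S \<le> (\<Prod>i\<in>S. 1 + a i)"
  using assms
proof (induction S rule: finite_induct)
  case (insert i S)
  then have "(1 + a i) * (1 + sum a S) \<le> (1 + a i) * (\<Prod>i\<in>S. 1 + a i)"
    by (intro mult_left_mono) auto
  moreover have "0 \<le> a i * sum a S"
    using insert by (intro mult_nonneg_nonneg sum_nonneg) auto
  ultimately show ?case
    using insert by (simp add: algebra_simps)
qed simp

text \<open>Read \<open>q b i\<close> as the i-th derivative of the factor in direction
  \<open>b\<close>, and the function \<open>i\<close> as a multi-index. A partial derivative touches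
  one factor and raises one entry, so multi-indices can serve as codes for
  \<open>schwartz_coinduct\<close>.\<close>

lemma prod_kernel_has_vector_derivative:
  fixes q :: "real^'n \<Rightarrow> nat \<Rightarrow> real \<Rightarrow> real" and c :: "'c::real_normed_vector"
  assumes q: "\<And>b i s. (q b i has_real_derivative q b (Suc i) s) (at s)" and v: "v \<in> Basis"
  shows "((\<lambda>t. (\<Prod>b\<in>Basis. q b (i b) ((x + t *\<^sub>R v) \<bullet> b)) *\<^sub>R c) has_vector_derivative
    (\<Prod>b\<in>Basis. q b ((i(v := Suc (i v))) b) (x \<bullet> b)) *\<^sub>R c) (at 0)"
proof -
  let ?r = "\<Prod>b\<in>Basis - {v}. q b (i b) (x \<bullet> b)"
  have 1: "(\<Prod>b\<in>Basis. q b (i b) ((x + t *\<^sub>R v) \<bullet> b)) = q v (i v) (x \<bullet> v + t) * ?r" for t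
  proof -
    have "(\<Prod>b\<in>Basis - {v}. q b (i b) ((x + t *\<^sub>R v) \<bullet> b)) = ?r"
      using v by (intro prod.cong) (auto simp: inner_add_left inner_Basis)
    then show ?thesis
      using v by (simp add: prod.remove[of Basis v] inner_add_left inner_Basis)
  qed
  have 2: "(\<Prod>b\<in>Basis. q b ((i(v := Suc (i v))) b) (x \<bullet> b)) = q v (Suc (i v)) (x \<bullet> v) * ?r"
  proof -
    have "(\<Prod>b\<in>Basis - {v}. q b ((i(v := Suc (i v))) b) (x \<bullet> b)) = ?r"
      by (intro prod.cong) auto
    then show ?thesis
      using v by (simp add: prod.remove[of Basis v])
  qed
  have "((\<lambda>t. q v (i v) (x \<bullet> v + t) * ?r) has_real_derivative q v (Suc (i v)) (x \<bullet> v) * ?r) (at 0)"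
    using q[of v "i v" "x \<bullet> v"] by (intro DERIV_cmult_right) (simp add: DERIV_shift[symmetric] add.commute)
  then have "((\<lambda>t. (q v (i v) (x \<bullet> v + t) * ?r) *\<^sub>R c) has_vector_derivative
      (q v (i v) (x \<bullet> v + 0) * ?r) *\<^sub>R 0 + (q v (Suc (i v)) (x \<bullet> v) * ?r) *\<^sub>R c) (at 0)"
    by (intro has_vector_derivative_scaleR has_vector_derivative_const)
  then show ?thesis
    by (simp only: 1 2) simp
qed

lemma dir_deriv_prod_kernel:
  fixes q :: "real^'n \<Rightarrow> nat \<Rightarrow> real \<Rightarrow> real" and c :: "'c::real_normed_vector"
  assumes "\<And>b i s. (q b i has_real_derivative q b (Suc i) s) (at s)" and "v \<in> Basis"
  shows "dir_deriv (\<lambda>x. (\<Prod>b\<in>Basis. q b (i b) (x \<bullet> b)) *\<^sub>R c) v =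
    (\<lambda>x. (\<Prod>b\<in>Basis. q b ((i(v := Suc (i v))) b) (x \<bullet> b)) *\<^sub>R c)"
  unfolding dir_deriv_def
  using prod_kernel_has_vector_derivative[of q, OF assms] vector_derivative_at by blast

lemma schwartz_prod_kernel:
  fixes q :: "real^'n \<Rightarrow> nat \<Rightarrow> real \<Rightarrow> real" and c :: "'c::real_normed_vector"
  assumes q: "\<And>b i s. (q b i has_real_derivative q b (Suc i) s) (at s)"
    and bdd: "\<And>b i k. \<exists>B. \<forall>s. (1 + \<bar>s\<bar>) ^ k * \<bar>q b i s\<bar> \<le> B"
  shows "schwartz (\<lambda>x. (\<Prod>b\<in>Basis. q b (i b) (x \<bullet> b)) *\<^sub>R c)"
proof (rule schwartz_coinduct[where Q = "\<lambda>_. True" and T = "\<lambda>i x. (\<Prod>b\<in>Basis. q b (i b) (x \<bullet> b)) *\<^sub>R c"])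
  fix i :: "real^'n \<Rightarrow> nat"
  have "continuous_on UNIV (q b j)" for b j
    using q DERIV_isCont continuous_at_imp_continuous_on by blast
  then have "continuous_on UNIV (\<lambda>x. q b (i b) (x \<bullet> b))" for b
    by (rule continuous_on_compose2) (auto intro!: continuous_intros)
  then show "continuous_on UNIV (\<lambda>x. (\<Prod>b\<in>Basis. q b (i b) (x \<bullet> b)) *\<^sub>R c)"
    by (intro continuous_on_scaleR continuous_on_prod continuous_on_const)
  show "\<exists>i'. True \<and> (\<forall>x. ((\<lambda>t. (\<Prod>b\<in>Basis. q b (i b) ((x + t *\<^sub>R v) \<bullet> b)) *\<^sub>R c) has_vector_derivative
      (\<Prod>b\<in>Basis. q b (i' b) (x \<bullet> b)) *\<^sub>R c) (at 0))" if v: "v \<in> Basis" for v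
    by (intro exI[of _ "i(v := Suc (i v))"] conjI allI TrueI prod_kernel_has_vector_derivative[of q, OF q v])
  fix k
  obtain B where B: "\<And>b s. (1 + \<bar>s\<bar>) ^ k * \<bar>q b (i b) s\<bar> \<le> B b"
    using choice[OF allI, of "\<lambda>b B. \<forall>s. (1 + \<bar>s\<bar>) ^ k * \<bar>q b (i b) s\<bar> \<le> B", OF bdd] by auto
  have "(1 + norm x) ^ k * norm ((\<Prod>b\<in>Basis. q b (i b) (x \<bullet> b)) *\<^sub>R c) \<le> (\<Prod>b\<in>Basis. B b) * norm c" for x
  proof -
    \<comment> \<open>The weight is dominated by a product of one-variable weights, so that each
      factor absorbs its own.\<close>
    have "1 + norm x \<le> 1 + (\<Sum>b\<in>Basis. \<bar>x \<bullet> b\<bar>)"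
      using norm_le_l1[of x] by simp
    also have "\<dots> \<le> (\<Prod>b\<in>Basis. 1 + \<bar>x \<bullet> b\<bar>)"
      by (intro one_plus_sum_le_prod) auto
    finally have "(1 + norm x) ^ k \<le> (\<Prod>b\<in>Basis. 1 + \<bar>x \<bullet> b\<bar>) ^ k"
      by (intro power_mono) auto
    then have "(1 + norm x) ^ k * norm ((\<Prod>b\<in>Basis. q b (i b) (x \<bullet> b)) *\<^sub>R c) \<le> (\<Prod>b\<in>Basis. 1 + \<bar>x \<bullet> b\<bar>) ^ k * norm ((\<Prod>b\<in>Basis. q b (i b) (x \<bullet> b)) *\<^sub>R c)"
      by (intro mult_right_mono) auto
    also have "\<dots> = (\<Prod>b\<in>Basis. (1 + \<bar>x \<bullet> b\<bar>) ^ k * \<bar>q b (i b) (x \<bullet> b)\<bar>) * norm c"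
      by (simp add: prod.distrib prod_power_distrib abs_prod)
    also have "\<dots> \<le> (\<Prod>b\<in>Basis. B b) * norm c"
      using B by (intro mult_right_mono prod_mono) auto
    finally show ?thesis .
  qed
  then show "\<exists>B. \<forall>x. (1 + norm x) ^ k * norm ((\<Prod>b\<in>Basis. q b (i b) (x \<bullet> b)) *\<^sub>R c) \<le> B" by blast
qed simp

section \<open>Integration and the Hilbert module\<close>

text \<open>Fubini in coordinates: Lebesgue measure is the image of the product of one-dimensional
  Lebesgue measures over \<open>Basis\<close>.\<close>

lemma lborel_prod_kernel:
  fixes g :: "'a::euclidean_space \<Rightarrow> real \<Rightarrow> real"
  assumes "\<And>b. b \<in> Basis \<Longrightarrow> integrable lborel (g b)"
  shows "integrable lborel (\<lambda>x. \<Prod>b\<in>Basis. g b (x \<bullet> b))"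
    and "(\<integral>x. (\<Prod>b\<in>Basis. g b (x \<bullet> b)) \<partial>lborel) = (\<Prod>b\<in>Basis. integral\<^sup>L lborel (g b))"
proof -
  interpret product_sigma_finite "\<lambda>_::'a. lborel :: real measure" ..
  have [measurable]: "g b \<in> borel_measurable borel" if "b \<in> Basis" for b
    using borel_measurable_integrable[OF assms[OF that]] by simp
  have eq: "(\<Prod>b\<in>Basis. g b ((\<Sum>c\<in>Basis. f c *\<^sub>R c) \<bullet> b)) = (\<Prod>b\<in>Basis. g b (f b))" for f :: "'a \<Rightarrow> real"
    by (intro prod.cong) auto
  show "integrable lborel (\<lambda>x. \<Prod>b\<in>Basis. g b (x \<bullet> b))"
    by (subst lborel_eq, subst integrable_distr_eq) (auto simp: eq intro!: product_integrable_prod assms)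
  show "(\<integral>x. (\<Prod>b\<in>Basis. g b (x \<bullet> b)) \<partial>lborel) = (\<Prod>b\<in>Basis. integral\<^sup>L lborel (g b))"
    by (subst lborel_eq, subst integral_distr) (auto simp: eq intro!: product_integral_prod assms)
qed

lemma integrable_even_FTC:
  fixes f F :: "real \<Rightarrow> real"
  assumes f: "continuous_on UNIV f" "\<And>s. f (- s) = f s" "\<And>s. f s \<ge> 0"
    and F: "\<And>s. s \<ge> 0 \<Longrightarrow> DERIV F s :> f s" "(F \<longlongrightarrow> T) at_top"
  shows "integrable lborel f" and "integral\<^sup>L lborel f \<le> 2 * (T - F 0)"
proof -
  have [measurable]: "f \<in> borel_measurable borel"
    using f(1) by (rule borel_measurable_continuous_onI)
  define h where "h s = f s * indicator {0..} s" for s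
  have [measurable]: "h \<in> borel_measurable borel"
    unfolding h_def by measurable
  have nn: "(\<integral>\<^sup>+x. ennreal (h x) \<partial>lborel) = T - F 0"
    using nn_integral_FTC_atLeast[of f 0 F T] f F by (simp add: h_def ennreal_mult' ennreal_indicator mult.commute)
  have h0: "h s \<ge> 0" for s using f by (simp add: h_def)
  have ih: "integrable lborel h"
    using nn h0 by (intro integrableI_nonneg) auto
  have T: "T - F 0 \<ge> 0"
  proof -
    have "F 0 \<le> F s" if "s \<ge> 0" for s
      using that F(1) f(3) by (intro DERIV_nonneg_imp_nondecreasing[of 0 s F]) auto
    then have "\<forall>\<^sub>F s in at_top. F 0 \<le> F s"
      by (intro eventually_mono[OF eventually_ge_at_top[of 0]])
    then have "F 0 \<le> T"
      by (intro tendsto_lowerbound[OF F(2)]) auto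
    then show ?thesis by simp
  qed
  have inth: "integral\<^sup>L lborel h = T - F 0"
    using nn h0 T by (simp add: integral_eq_nn_integral)
  have ih': "integrable lborel (\<lambda>s. h (- s))"
    using lborel_integrable_real_affine[OF ih, of "-1" 0] by simp
  have inth': "(\<integral>s. h (- s) \<partial>lborel) = T - F 0"
    using lborel_integral_real_affine[of "-1" h 0] inth by simp
  \<comment> \<open>Both halves count at 0, so this is an inequality, and so is the resulting bound
    for the integral.\<close>
  have le: "f s \<le> h s + h (- s)" for s
    using f h0 by (auto simp: h_def indicator_def)
  show "integrable lborel f"
    by (rule Bochner_Integration.integrable_bound[OF Bochner_Integration.integrable_add[OF ih ih']])
      (use le f(3) h0 in \<open>auto simp: abs_of_nonneg\<close>)
  then have "integral\<^sup>L lborel f \<le> (\<integral>s. h s + h (- s) \<partial>lborel)"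
    by (intro integral_mono Bochner_Integration.integrable_add ih ih' le)
  also have "\<dots> = 2 * (T - F 0)"
    using ih ih' inth inth' by simp
  finally show "integral\<^sup>L lborel f \<le> 2 * (T - F 0)" .
qed

lemma integrable_inverse_one_plus_square: "integrable lborel (\<lambda>s::real. inverse (1 + s\<^sup>2))"
proof (rule integrable_even_FTC)
  show "continuous_on UNIV (\<lambda>s::real. inverse (1 + s\<^sup>2))"
    by (intro continuous_intros) (auto simp: add_nonneg_eq_0_iff)
  show "(arctan \<longlongrightarrow> pi / 2) at_top"
    by (rule tendsto_arctan_at_top)
qed (auto intro!: derivative_eq_intros)

lemma integrable_exp_minus_abs:
  assumes "c > 0"
  shows "integrable lborel (\<lambda>s::real. exp (- (c * \<bar>s\<bar>)))"
    and "(\<integral>s. exp (- (c * \<bar>s\<bar>)) \<partial>lborel) \<le> 2 / c"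
proof -
  let ?f = "\<lambda>s::real. exp (- (c * \<bar>s\<bar>))" and ?F = "\<lambda>s::real. - exp (- (c * s)) / c"
  have 1: "continuous_on UNIV ?f" "\<And>s. ?f (- s) = ?f s" "\<And>s. ?f s \<ge> 0"
    by (auto intro!: continuous_intros)
  have 2: "DERIV ?F s :> ?f s" if "s \<ge> 0" for s
    using that assms by (auto intro!: derivative_eq_intros)
  have 3: "(?F \<longlongrightarrow> 0) at_top"
  proof -
    have "((\<lambda>s. exp (- (c * s))) \<longlongrightarrow> 0) at_top"
      by (rule filterlim_compose[OF exp_at_bot])
        (use assms in \<open>auto intro!: filterlim_uminus_at_top[THEN iffD1] filterlim_tendsto_pos_mult_at_top filterlim_ident\<close>)
    from tendsto_divide[OF tendsto_minus[OF this] tendsto_const[of c]] show ?thesis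
      using assms by simp
  qed
  show "integrable lborel ?f" by (rule integrable_even_FTC(1)[OF 1 2 3])
  show "integral\<^sup>L lborel ?f \<le> 2 / c" using integrable_even_FTC(2)[OF 1 2 3] by simp
qed

text \<open>An integrable majorant for \<open>(1 + norm x)^(-2n)\<close>, with \<open>n\<close> the
  dimension. The product form reduces integrability to that of \<open>1 / (1 + s^2)\<close> on the
  line.\<close>

definition decay_weight :: "'a::euclidean_space \<Rightarrow> real" where
  "decay_weight x = (\<Prod>b\<in>Basis. inverse (1 + (x \<bullet> b)\<^sup>2))"

lemma integrable_decay_weight: "decay_weight integrable_on (UNIV :: 'a::euclidean_space set)"
  unfolding decay_weight_def
  by (intro integrable_on_lborel lborel_prod_kernel(1) integrable_inverse_one_plus_square)

lemma integral_decay_weight_nonneg: "integral UNIV (decay_weight :: 'a::euclidean_space \<Rightarrow> real) \<ge> 0"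
  by (rule Henstock_Kurzweil_Integration.integral_nonneg[OF integrable_decay_weight])
    (auto simp: decay_weight_def intro!: prod_nonneg)

text \<open>Each factor \<open>1 + (x . b)^2\<close> is at most \<open>(1 + norm x)^2\<close>, and
  there is one factor per dimension. This is the origin of the exponent \<open>2 * DIM\<close> in
  all later estimates.\<close>

lemma le_decay_weight:
  fixes x :: "'a::euclidean_space"
  assumes "(1 + norm x) ^ (2 * DIM('a)) * r \<le> B" "r \<ge> 0"
  shows "r \<le> B * decay_weight x"
proof -
  have "(\<Prod>b\<in>(Basis::'a set). 1 + (x \<bullet> b)\<^sup>2) \<le> (\<Prod>b\<in>(Basis::'a set). (1 + norm x)\<^sup>2)"
  proof (intro prod_mono conjI)
    fix b :: 'a assume "b \<in> Basis"
    then have "(x \<bullet> b)\<^sup>2 \<le> (norm x)\<^sup>2"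
      by (metis Basis_le_norm abs_ge_zero power2_abs power_mono)
    then show "1 + (x \<bullet> b)\<^sup>2 \<le> (1 + norm x)\<^sup>2"
      using norm_ge_zero[of x] by (simp add: power2_sum del: norm_ge_zero)
  qed auto
  then have "r * (\<Prod>b\<in>(Basis::'a set). 1 + (x \<bullet> b)\<^sup>2) \<le> r * (1 + norm x) ^ (2 * DIM('a))"
    using assms(2) by (intro mult_left_mono) (auto simp: power_mult)
  with assms(1) have "r * (\<Prod>b\<in>(Basis::'a set). 1 + (x \<bullet> b)\<^sup>2) \<le> B"
    by (simp add: mult.commute)
  moreover have "(\<Prod>b\<in>(Basis::'a set). 1 + (x \<bullet> b)\<^sup>2) > 0"
    by (intro prod_pos) (auto intro: add_pos_nonneg)
  ultimately have "r \<le> B / (\<Prod>b\<in>(Basis::'a set). 1 + (x \<bullet> b)\<^sup>2)"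
    by (simp add: pos_le_divide_eq)
  then show ?thesis
    by (simp add: decay_weight_def divide_inverse prod_inversef[symmetric] o_def)
qed

lemma integrable_continuous_bound:
  fixes f :: "'a::euclidean_space \<Rightarrow> 'b::banach"
  assumes "continuous_on UNIV f" "g integrable_on UNIV" "\<And>x. norm (f x) \<le> g x"
  shows "f integrable_on UNIV" and "norm (integral UNIV f) \<le> integral UNIV g"
proof -
  show "f integrable_on UNIV"
    by (rule integrable_on_all_intervals_integrable_bound[where g = g])
      (use assms in \<open>auto intro!: integrable_continuous intro: continuous_on_subset\<close>)
  then show "norm (integral UNIV f) \<le> integral UNIV g"
    by (rule Henstock_Kurzweil_Integration.integral_norm_bound_integral) (use assms in auto)
qed

lemma integrable_decay:
  fixes f :: "'a::euclidean_space \<Rightarrow> 'b::banach"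
  assumes "continuous_on UNIV f" "\<And>x. (1 + norm x) ^ (2 * DIM('a)) * norm (f x) \<le> B"
  shows "f integrable_on UNIV" and "norm (integral UNIV f) \<le> B * integral UNIV (decay_weight :: 'a \<Rightarrow> real)"
proof -
  have 1: "(\<lambda>x::'a. B * decay_weight x) integrable_on UNIV"
    using integrable_on_mult_right[OF integrable_decay_weight] by blast
  have 2: "norm (f x) \<le> B * decay_weight x" for x
    using assms(2) by (intro le_decay_weight) auto
  show "f integrable_on UNIV"
    by (rule integrable_continuous_bound(1)[OF assms(1) 1 2])
  show "norm (integral UNIV f) \<le> B * integral UNIV (decay_weight :: 'a \<Rightarrow> real)"
    using integrable_continuous_bound(2)[OF assms(1) 1 2] by (simp add: Henstock_Kurzweil_Integration.integral_mult_right)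
qed

lemma has_integral_translate_UNIV:
  fixes f :: "'a::euclidean_space \<Rightarrow> 'b::banach"
  assumes "(f has_integral I) UNIV"
  shows "((\<lambda>x. f (x - a)) has_integral I) UNIV"
proof -
  have f: "f integrable_on cbox c d" for c d
    using assms unfolding has_integral_alt' by auto
  have shift: "((\<lambda>x. f (x - a)) has_integral integral (cbox (c - a) (d - a)) f) (cbox c d)" for c d
    using has_integral_shift_cbox_iff[of f "-a" "integral (cbox (c - a) (d - a)) f" c d] f
    by (simp add: o_def has_integral_integral)
  show ?thesis
    unfolding has_integral_alt'
  proof (intro conjI allI impI)
    show "(\<lambda>x. if x \<in> UNIV then f (x - a) else 0) integrable_on cbox c d" for c d
      using shift[of c d] by (auto simp: integrable_on_def)
  next
    fix e :: real assume "e > 0"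
    then obtain B where B: "B > 0" "\<And>c d. ball 0 B \<subseteq> cbox c d \<Longrightarrow> norm (integral (cbox c d) f - I) < e"
      using assms unfolding has_integral_alt' by auto
    \<comment> \<open>The radius grows by \<open>norm a\<close> so that the box shifted back by
      \<open>a\<close> still contains the ball of radius \<open>B\<close>.\<close>
    have "norm (integral (cbox c d) (\<lambda>x. f (x - a)) - I) < e" if sub: "ball 0 (B + norm a) \<subseteq> cbox c d" for c d
    proof -
      have "ball 0 B \<subseteq> cbox (c - a) (d - a)"
      proof
        fix x :: 'a assume "x \<in> ball 0 B"
        then have "x + a \<in> ball 0 (B + norm a)"
          using norm_triangle_ineq[of x a] by simp
        then have "x + a \<in> cbox c d" using sub by blast
        then show "x \<in> cbox (c - a) (d - a)"
          by (auto simp: mem_box inner_diff_left inner_add_left algebra_simps)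
      qed
      from B(2)[OF this] show ?thesis
        using integral_unique[OF shift[of c d]] by simp
    qed
    then show "\<exists>B>0. \<forall>c d. ball 0 B \<subseteq> cbox c d \<longrightarrow>
        norm (integral (cbox c d) (\<lambda>x. if x \<in> UNIV then f (x - a) else 0) - I) < e"
      using B(1) by (intro exI[of _ "B + norm a"]) (auto simp: add_pos_nonneg)
  qed
qed

section \<open>The Hilbert module: density, complex scalars and unitaries\<close>

locale schwartz_module = cstar cscale star
  for cscale :: "complex \<Rightarrow> 'c::{real_normed_algebra_1,banach} \<Rightarrow> 'c" and star :: "'c \<Rightarrow> 'c" +
  fixes inn :: "'e::banach \<Rightarrow> 'e \<Rightarrow> 'c"
    and ract :: "'e \<Rightarrow> 'c \<Rightarrow> 'e"
    and emb :: "(real^'n \<Rightarrow> 'c) \<Rightarrow> 'e"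
  assumes completion: "En_completion star inn ract emb"
begin

sublocale inn: bounded_bilinear inn
  using completion unfolding En_completion_def by blast

sublocale ract: bounded_bilinear ract
  using completion unfolding En_completion_def by blast

lemma ract_1: "ract e 1 = e"
  and norm_eq_inn: "norm e = sqrt (norm (inn e e))"
  and emb_add: "schwartz f \<Longrightarrow> schwartz g \<Longrightarrow> emb (\<lambda>x. f x + g x) = emb f + emb g"
  and emb_mult_right: "schwartz f \<Longrightarrow> emb (\<lambda>x. f x * c) = ract (emb f) c"
  and inn_emb: "schwartz f \<Longrightarrow> schwartz g \<Longrightarrow> inn (emb f) (emb g) = integral UNIV (\<lambda>x. star (f x) * g x)"
  and dense: "closure (emb ` {f. schwartz f}) = UNIV"
  using completion unfolding En_completion_def by (elim conjE; simp)+

lemma norm_sq_eq: "(norm e)\<^sup>2 = norm (inn e e)"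
  using norm_eq_inn[of e] by simp

lemma emb_scaleR: "schwartz f \<Longrightarrow> emb (\<lambda>x. r *\<^sub>R f x) = r *\<^sub>R emb f"
  using emb_mult_right[of f "r *\<^sub>R 1"] by (simp add: ract.scaleR_right ract_1)

lemma emb_minus: "schwartz f \<Longrightarrow> emb (\<lambda>x. - f x) = - emb f"
  using emb_scaleR[of f "-1"] by simp

lemma emb_diff: "schwartz f \<Longrightarrow> schwartz g \<Longrightarrow> emb (\<lambda>x. f x - g x) = emb f - emb g"
  using emb_add[of f "\<lambda>x. - g x"] by (simp add: emb_minus schwartz_minus)

lemma dense_induct:
  assumes "closed {e. P e}" "\<And>f. schwartz f \<Longrightarrow> P (emb f)"
  shows "P e"
proof -
  have "closure (emb ` {f. schwartz f}) \<subseteq> {e. P e}"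
    using assms by (intro closure_minimal) auto
  then show ?thesis using dense by auto
qed

lemma dense_induct2:
  assumes "\<And>e. closed {d. P d e}" "\<And>d. closed {e. P d e}"
    and "\<And>f g. schwartz f \<Longrightarrow> schwartz g \<Longrightarrow> P (emb f) (emb g)"
  shows "P d e"
  by (rule dense_induct[of "\<lambda>d. P d e"], rule assms(1), rule dense_induct, rule assms(2), rule assms(3))

text \<open>By continuity of \<open>inn\<close>, test vectors from a dense set suffice, and
  \<open>e\<close> itself can then be put in the first slot. This makes weak proofs of vector
  identities possible.\<close>

lemma eq_0_if_inn_eq_0:
  assumes "\<And>f. schwartz f \<Longrightarrow> inn (emb f) e = 0"
  shows "e = 0"
proof -
  have "inn d e = 0" for d
    by (rule dense_induct[of "\<lambda>d. inn d e = 0"])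
      (auto intro!: closed_Collect_eq continuous_intros inn.continuous_on assms)
  then show ?thesis
    using norm_sq_eq[of e] by simp
qed

lemma eq_if_inn_eq:
  assumes "\<And>f. schwartz f \<Longrightarrow> inn (emb f) d = inn (emb f) e"
  shows "d = e"
  using eq_0_if_inn_eq_0[of "d - e"] assms by (simp add: inn.diff_right)

lemma schwartz_pairing:
  fixes f g :: "real^'n \<Rightarrow> 'c"
  assumes "schwartz f" "schwartz g"
  shows "continuous_on UNIV (\<lambda>x. star (f x) * g x)"
    and "(\<lambda>x. star (f x) * g x) integrable_on UNIV"
proof -
  show cont: "continuous_on UNIV (\<lambda>x. star (f x) * g x)"
    by (intro continuous_on_mult schwartz_continuous assms
      bounded_linear.continuous_on[OF bounded_linear_star])
  obtain B where B: "B > 0" "\<And>x. (1 + norm x) ^ (2 * DIM(real^'n)) * norm (f x) \<le> B"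
    using schwartz_bound[OF assms(1)] by blast
  obtain C where C: "C > 0" "\<And>x. (1 + norm x) ^ 0 * norm (g x) \<le> C"
    using schwartz_bound[OF assms(2)] by blast
  show "(\<lambda>x. star (f x) * g x) integrable_on UNIV"
  proof (rule integrable_decay(1)[OF cont])
    fix x :: "real^'n"
    have "(1 + norm x) ^ (2 * DIM(real^'n)) * norm (star (f x) * g x) \<le>
        (1 + norm x) ^ (2 * DIM(real^'n)) * (norm (f x) * norm (g x))"
      using norm_mult_ineq[of "star (f x)" "g x"] by (intro mult_left_mono) auto
    also have "\<dots> = ((1 + norm x) ^ (2 * DIM(real^'n)) * norm (f x)) * norm (g x)"
      by simp
    also have "\<dots> \<le> B * C"
      using B(2)[of x] B(1) C(2)[of x] by (intro mult_mono) auto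
    finally show "(1 + norm x) ^ (2 * DIM(real^'n)) * norm (star (f x) * g x) \<le> B * C" .
  qed
qed

text \<open>One Schwartz seminorm controls the norm of \<open>E_n\<close>: of the two factors
  \<open>f\<close> in the inner product one takes the whole weight, the other is merely bounded.
  Through this estimate pointwise bounds yield convergence in \<open>E_n\<close>, both for the
  derivatives of the unitaries and for the final limit.\<close>

lemma norm_emb_le:
  assumes f: "schwartz f" and B: "\<And>x. (1 + norm x) ^ (2 * DIM(real^'n)) * norm (f x) \<le> B"
  shows "norm (emb f) \<le> sqrt (integral UNIV (decay_weight :: real^'n \<Rightarrow> real)) * B"
proof -
  have B0: "B \<ge> 0"
    using B[of 0] by (rule order_trans[rotated]) auto
  have "norm (inn (emb f) (emb f)) \<le> B\<^sup>2 * integral UNIV (decay_weight :: real^'n \<Rightarrow> real)"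
    unfolding inn_emb[OF f f]
  proof (rule integrable_decay(2)[OF schwartz_pairing(1)[OF f f]])
    fix x :: "real^'n"
    have "1 * norm (f x) \<le> (1 + norm x) ^ (2 * DIM(real^'n)) * norm (f x)"
      by (intro mult_right_mono one_le_power) auto
    then have *: "norm (f x) \<le> B" using B[of x] by linarith
    have "(1 + norm x) ^ (2 * DIM(real^'n)) * norm (star (f x) * f x) =
        ((1 + norm x) ^ (2 * DIM(real^'n)) * norm (f x)) * norm (f x)"
      by (simp add: norm_star_mult power2_eq_square)
    also have "\<dots> \<le> B * B"
      by (intro mult_mono B * B0) auto
    finally show "(1 + norm x) ^ (2 * DIM(real^'n)) * norm (star (f x) * f x) \<le> B\<^sup>2"
      by (simp add: power2_eq_square)
  qed
  then have "sqrt (norm (inn (emb f) (emb f))) \<le> sqrt (B\<^sup>2 * integral UNIV (decay_weight :: real^'n \<Rightarrow> real))"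
    by (rule real_sqrt_le_mono)
  then show ?thesis
    using B0 norm_eq_inn[of "emb f"] by (simp add: real_sqrt_mult mult.commute)
qed

text \<open>The type \<open>'e\<close> is only a real vector space. Complex scalars act on it
  through the right action of the central elements \<open>cscale z 1\<close>.\<close>

definition phase :: "complex \<Rightarrow> 'e \<Rightarrow> 'e" where
  "phase z e = ract e (cscale z 1)"

lemma phase_emb: "schwartz f \<Longrightarrow> phase z (emb f) = emb (\<lambda>x. cscale z (f x))"
  unfolding phase_def by (simp flip: emb_mult_right add: cscale_mult)

lemma bounded_linear_phase: "bounded_linear (phase z)"
  unfolding phase_def by (rule ract.bounded_linear_left)

sublocale phase: bounded_linear "phase z" for z
  by (rule bounded_linear_phase)

lemma integral_cscale_pairing:
  fixes f g :: "real^'n \<Rightarrow> 'c"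
  assumes "schwartz f" "schwartz g"
  shows "integral UNIV (\<lambda>x. cscale z (star (f x) * g x)) = cscale z (integral UNIV (\<lambda>x. star (f x) * g x))"
  using integral_linear[OF schwartz_pairing(2)[OF assms] cscale.bounded_linear_right] by (simp add: o_def)

lemma inn_phase_left: "inn (phase z d) e = cscale (cnj z) (inn d e)"
  by (rule dense_induct2[of "\<lambda>d e. inn (phase z d) e = cscale (cnj z) (inn d e)"];
      (intro closed_Collect_eq cscale.continuous_on inn.continuous_on phase.continuous_on continuous_intros)?)
    (simp add: phase_emb inn_emb schwartz_cscale cscale_mult integral_cscale_pairing)

lemma inn_phase_right: "inn d (phase z e) = cscale z (inn d e)"
  by (rule dense_induct2[of "\<lambda>d e. inn d (phase z e) = cscale z (inn d e)"];
      (intro closed_Collect_eq cscale.continuous_on inn.continuous_on phase.continuous_on continuous_intros)?)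
    (simp add: phase_emb inn_emb schwartz_cscale cscale_mult integral_cscale_pairing)

lemma norm_phase [simp]: "norm (phase z e) = cmod z * norm e"
proof -
  have "(norm (phase z e))\<^sup>2 = (cmod z * norm e)\<^sup>2"
    unfolding norm_sq_eq[of "phase z e"]
    by (simp add: inn_phase_left inn_phase_right norm_mult power_mult_distrib flip: norm_sq_eq) (simp add: power2_eq_square)
  then show ?thesis by (simp add: power2_eq_iff_nonneg)
qed

lemma phase_phase [simp]: "phase z (phase w e) = phase (z * w) e"
proof -
  have "inn d (phase z (phase w e)) = inn d (phase (z * w) e)" for d
    by (simp add: inn_phase_right)
  then show ?thesis by (intro eq_if_inn_eq)
qed

lemma phase_1 [simp]: "phase 1 e = e"
  by (simp add: phase_def ract_1)

text \<open>\<open>Uop\<close> is a definite description and says something only once existence and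
  uniqueness of the extension are known. An isometry on a dense set is uniformly continuous, hence
  extends; linearity and the norm survive because they are closed conditions.\<close>

lemma dense_extension:
  fixes T :: "(real^'n \<Rightarrow> 'c) \<Rightarrow> (real^'n \<Rightarrow> 'c)"
  assumes T: "\<And>f. schwartz f \<Longrightarrow> schwartz (T f)"
    and add: "\<And>f g. schwartz f \<Longrightarrow> schwartz g \<Longrightarrow> T (\<lambda>x. f x + g x) = (\<lambda>x. T f x + T g x)"
    and scaleR: "\<And>f r. schwartz f \<Longrightarrow> T (\<lambda>x. r *\<^sub>R f x) = (\<lambda>x. r *\<^sub>R T f x)"
    and norm: "\<And>f. schwartz f \<Longrightarrow> norm (emb (T f)) = norm (emb f)"
  shows "\<exists>!U. \<forall>f. schwartz f \<longrightarrow> blinfun_apply U (emb f) = emb (T f)"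
proof (rule ex_ex1I)
  have diff: "norm (emb (T f) - emb (T g)) = norm (emb f - emb g)" if f: "schwartz f" and g: "schwartz g" for f g
  proof -
    have "T (\<lambda>x. f x + (-1) *\<^sub>R g x) = (\<lambda>x. T f x + (-1) *\<^sub>R T g x)"
      using f g by (simp only: add scaleR schwartz_scaleR)
    then have "emb (T f) - emb (T g) = emb (T (\<lambda>x. f x - g x))"
      using f g by (simp add: emb_diff T)
    then show ?thesis
      using f g by (simp add: norm schwartz_diff emb_diff)
  qed
  \<comment> \<open>A vector may a priori come from several functions, so one of them is picked; by
    \<open>diff\<close> the result does not depend on the choice.\<close>
  define u where "u e = emb (T (SOME f. schwartz f \<and> emb f = e))" for e
  have u: "u (emb f) = emb (T f)" if f: "schwartz f" for f
  proof -
    let ?g = "SOME g. schwartz g \<and> emb g = emb f"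
    have "schwartz ?g \<and> emb ?g = emb f" by (rule someI[of _ f]) (use f in auto)
    then show ?thesis using diff[of ?g f] f by (simp add: u_def)
  qed
  let ?D = "emb ` {f. schwartz f}"
  have uc: "uniformly_continuous_on ?D u"
    unfolding uniformly_continuous_on_def
  proof (intro allI impI)
    fix r :: real assume "r > 0"
    have "dist (u y) (u x) < r" if xy: "x \<in> ?D" "y \<in> ?D" "dist y x < r" for x y
    proof -
      obtain f g where "x = emb f" "y = emb g" "schwartz f" "schwartz g" using xy by blast
      then show ?thesis using xy(3) by (simp add: u diff dist_norm)
    qed
    then show "\<exists>d>0. \<forall>x\<in>?D. \<forall>y\<in>?D. dist y x < d \<longrightarrow> dist (u y) (u x) < r"
      using \<open>r > 0\<close> by blast
  qed
  obtain v where v: "uniformly_continuous_on (closure ?D) v" "\<And>x. x \<in> ?D \<Longrightarrow> u x = v x"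
    by (rule uniformly_continuous_on_extension_on_closure[OF uc]) (rule that)
  have cv: "continuous_on UNIV v"
    using uniformly_continuous_imp_continuous[OF v(1)] by (simp add: dense)
  have cv': "continuous_on UNIV (\<lambda>x. v (h x))" if "continuous_on UNIV h" for h :: "'e \<Rightarrow> 'e"
    using continuous_on_compose2[OF cv that] by auto
  have vT: "v (emb f) = emb (T f)" if "schwartz f" for f
    using v(2)[of "emb f"] u[OF that] that by simp
  have nv: "norm (v e) = norm e" for e
    by (rule dense_induct[of "\<lambda>e. norm (v e) = norm e"])
      (auto intro!: closed_Collect_eq continuous_intros cv simp: vT norm)
  have av: "v (d + e) = v d + v e" for d e
  proof (rule dense_induct2[of "\<lambda>d e. v (d + e) = v d + v e"])
    show "closed {d. v (d + e) = v d + v e}" "closed {d. v (e + d) = v e + v d}" for e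
      by (intro closed_Collect_eq cv' continuous_intros)+
    fix f g :: "real^'n \<Rightarrow> 'c" assume f: "schwartz f" and g: "schwartz g"
    have "emb f + emb g = emb (\<lambda>x. f x + g x)"
      by (simp add: emb_add f g)
    then have "v (emb f + emb g) = emb (T (\<lambda>x. f x + g x))"
      by (simp add: vT f g schwartz_add)
    then show "v (emb f + emb g) = v (emb f) + v (emb g)"
      by (simp add: vT add T f g schwartz_add emb_add)
  qed
  have sv: "v (r *\<^sub>R e) = r *\<^sub>R v e" for r e
  proof (rule dense_induct[of "\<lambda>e. v (r *\<^sub>R e) = r *\<^sub>R v e"])
    show "closed {e. v (r *\<^sub>R e) = r *\<^sub>R v e}"
      by (intro closed_Collect_eq cv' continuous_intros)
    fix g :: "real^'n \<Rightarrow> 'c" assume g: "schwartz g"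
    have "r *\<^sub>R emb g = emb (\<lambda>x. r *\<^sub>R g x)"
      by (simp add: emb_scaleR g)
    then have "v (r *\<^sub>R emb g) = emb (T (\<lambda>x. r *\<^sub>R g x))"
      by (simp add: vT g schwartz_scaleR)
    then show "v (r *\<^sub>R emb g) = r *\<^sub>R v (emb g)"
      by (simp add: vT scaleR T g schwartz_scaleR emb_scaleR)
  qed
  have "bounded_linear v"
    by (rule bounded_linear_intro[of _ 1]) (auto simp: av sv nv)
  then show "\<exists>U. \<forall>f. schwartz f \<longrightarrow> blinfun_apply U (emb f) = emb (T f)"
    by (intro exI[of _ "Blinfun v"]) (simp add: bounded_linear_Blinfun_apply vT)
next
  fix U V assume UV: "\<forall>f. schwartz f \<longrightarrow> blinfun_apply U (emb f) = emb (T f)"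
    "\<forall>f. schwartz f \<longrightarrow> blinfun_apply V (emb f) = emb (T f)"
  show "U = V"
  proof (rule blinfun_eqI)
    fix e show "blinfun_apply U e = blinfun_apply V e"
      by (rule dense_induct[of "\<lambda>e. blinfun_apply U e = blinfun_apply V e"])
        (use UV in \<open>auto intro!: closed_Collect_eq continuous_intros\<close>)
  qed
qed

lemma inn_emb_Ushift:
  assumes f: "schwartz f" and g: "schwartz g"
  shows "inn (emb (Ushift cscale a b f)) (emb (Ushift cscale a b g)) = inn (emb f) (emb g)"
proof -
  have "((\<lambda>x. star (f (x - a)) * g (x - a)) has_integral integral UNIV (\<lambda>x. star (f x) * g x)) UNIV"
    by (rule has_integral_translate_UNIV[OF integrable_integral[OF schwartz_pairing(2)[OF f g]]])
  moreover have "star (Ushift cscale a b f x) * Ushift cscale a b g x = star (f (x - a)) * g (x - a)" for x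
    by (simp add: Ushift_def cscale_mult cis_cnj cis_mult)
  ultimately show ?thesis
    by (simp add: inn_emb f g schwartz_Ushift integral_unique)
qed

definition U :: "(real^'n) \<times> (real^'n) \<Rightarrow> 'e \<Rightarrow>\<^sub>L 'e" where
  "U p = Uop cscale emb (fst p) (snd p)"

lemma U_emb:
  assumes "schwartz f"
  shows "U p (emb f) = emb (Ushift cscale (fst p) (snd p) f)"
proof -
  have "norm (emb (Ushift cscale (fst p) (snd p) f)) = norm (emb f)" if "schwartz f" for f
    using that by (simp add: norm_eq_inn inn_emb_Ushift)
  then have "\<exists>!V. \<forall>f. schwartz f \<longrightarrow> blinfun_apply V (emb f) = emb (Ushift cscale (fst p) (snd p) f)"
    by (intro dense_extension schwartz_Ushift)
      (simp_all add: Ushift_def cscale.add_right cscale.scaleR_right)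
  from theI'[OF this] assms show ?thesis
    unfolding U_def Uop_def by blast
qed

lemma inn_U [simp]: "inn (U p d) (U p e) = inn d e"
  by (rule dense_induct2[of "\<lambda>d e. inn (U p d) (U p e) = inn d e"];
      (intro closed_Collect_eq inn.continuous_on blinfun.continuous_on continuous_intros)?)
    (simp add: U_emb inn_emb_Ushift)

lemma norm_U [simp]: "norm (U p e) = norm e"
  by (simp add: norm_eq_inn)

lemma U_phase: "U p (phase z e) = phase z (U p e)"
proof (rule dense_induct[of "\<lambda>e. U p (phase z e) = phase z (U p e)"])
  show "closed {e. U p (phase z e) = phase z (U p e)}"
    by (intro closed_Collect_eq phase.continuous_on blinfun.continuous_on continuous_intros)
qed (simp add: phase_emb U_emb schwartz_cscale schwartz_Ushift, simp add: Ushift_def mult.commute)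

text \<open>The representation is only projective: carrying the modulation of \<open>q\<close> past
  the translation of \<open>p\<close> replaces \<open>x\<close> by \<open>x - fst p\<close> in its
  phase.\<close>

lemma U_U: "U p (U q e) = phase (cis (- (fst p \<bullet> snd q))) (U (p + q) e)"
proof (rule dense_induct[of "\<lambda>e. U p (U q e) = phase (cis (- (fst p \<bullet> snd q))) (U (p + q) e)"])
  show "closed {e. U p (U q e) = phase (cis (- (fst p \<bullet> snd q))) (U (p + q) e)}"
    by (intro closed_Collect_eq phase.continuous_on blinfun.continuous_on continuous_intros)
qed (simp add: phase_emb U_emb schwartz_cscale schwartz_Ushift,
    simp add: Ushift_def cis_mult inner_diff_right inner_add_left inner_commute algebra_simps)

lemma U_0 [simp]: "U 0 e = e"
  by (rule dense_induct[of "\<lambda>e. U 0 e = e"])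
    (auto intro!: closed_Collect_eq continuous_intros simp: U_emb Ushift_def)

lemma Uinv_inverse:
  shows "Uinv cscale emb (fst p) (snd p) (U p e) = e" and "U p (Uinv cscale emb (fst p) (snd p) e) = e"
proof -
  \<comment> \<open>\<open>U (- p)\<close> inverts \<open>U p\<close> only up to the cocycle value
    \<open>cis (fst p . snd p)\<close>, which has to be divided out.\<close>
  define V where "V = Blinfun (\<lambda>e. phase (cis (- (fst p \<bullet> snd p))) (U (- p) e))"
  have V: "V e = phase (cis (- (fst p \<bullet> snd p))) (U (- p) e)" for e
    unfolding V_def
    by (subst bounded_linear_Blinfun_apply)
      (auto intro: bounded_linear_compose[OF bounded_linear_phase blinfun.bounded_linear_right])
  have 1: "V o\<^sub>L U p = id_blinfun" "U p o\<^sub>L V = id_blinfun"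
    by (auto intro!: blinfun_eqI simp: V U_phase U_U cis_mult)
  have "\<exists>!V. V o\<^sub>L U p = id_blinfun \<and> U p o\<^sub>L V = id_blinfun"
  proof (rule ex1I[of _ V])
    fix W assume W: "W o\<^sub>L U p = id_blinfun \<and> U p o\<^sub>L W = id_blinfun"
    have "W e = V e" for e
      using 1 W by (metis blinfun_apply_blinfun_compose blinfun_apply_id_blinfun id_apply)
    then show "W = V" by (rule blinfun_eqI)
  qed (use 1 in auto)
  from theI'[OF this]
  have "Uinv cscale emb (fst p) (snd p) o\<^sub>L U p = id_blinfun \<and> U p o\<^sub>L Uinv cscale emb (fst p) (snd p) = id_blinfun"
    unfolding Uinv_def U_def .
  then show "Uinv cscale emb (fst p) (snd p) (U p e) = e" "U p (Uinv cscale emb (fst p) (snd p) e) = e"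
    by (metis blinfun_apply_blinfun_compose blinfun_apply_id_blinfun id_apply)+
qed

end

section \<open>Generators of the Heisenberg representation\<close>

text \<open>The mean value estimate is used twice. The constant 3 is not sharp: \<open>2 M\<close>
  bounds the variation of \<open>u''\<close>, and a further \<open>M\<close> its value at 0.\<close>

lemma taylor_remainder_bound:
  fixes u :: "real \<Rightarrow> 'a::real_normed_vector"
  assumes u: "\<And>s. (u has_vector_derivative u' s) (at s)" "\<And>s. (u' has_vector_derivative u'' s) (at s)"
    and M: "\<And>s. \<bar>s\<bar> \<le> \<bar>t\<bar> \<Longrightarrow> norm (u'' s) \<le> M"
  shows "norm (u t - u 0 - t *\<^sub>R u' 0) \<le> 3 * M * t\<^sup>2"
proof -
  have seg: "\<bar>s\<bar> \<le> \<bar>r\<bar>" if "s \<in> closed_segment 0 r" for s r :: real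
    using that by (auto simp: closed_segment_eq_real_ivl split: if_splits)
  have "norm (u' s - u' 0) \<le> 3 * M * \<bar>t\<bar>" if s: "\<bar>s\<bar> \<le> \<bar>t\<bar>" for s
  proof -
    have "norm (u' s - u' 0 - (s - 0) *\<^sub>R u'' 0) \<le> norm (s - 0) * (M + M)"
    proof (rule vector_differentiable_bound_linearization)
      fix r assume "r \<in> closed_segment 0 s"
      then have "\<bar>r\<bar> \<le> \<bar>t\<bar>" using seg[of r s] s by linarith
      then show "norm (u'' r - u'' 0) \<le> M + M"
        using M[of r] M[of 0] norm_triangle_ineq4[of "u'' r" "u'' 0"] by auto
    qed (auto intro!: has_vector_derivative_at_within u)
    then have "norm (u' s - u' 0) \<le> \<bar>s\<bar> * (M + M) + norm (s *\<^sub>R u'' 0)"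
      using norm_triangle_sub[of "u' s - u' 0" "s *\<^sub>R u'' 0"] by simp
    also have "\<dots> \<le> \<bar>s\<bar> * (M + M) + \<bar>s\<bar> * M"
      using M[of 0] by (intro add_left_mono) (simp add: mult_left_mono)
    also have "\<dots> = \<bar>s\<bar> * (3 * M)"
      by (simp add: algebra_simps)
    also have "\<dots> \<le> \<bar>t\<bar> * (3 * M)"
    proof (rule mult_right_mono[OF s])
      show "0 \<le> 3 * M" using M[of 0] norm_ge_zero[of "u'' 0"] by (simp del: norm_ge_zero)
    qed
    finally show ?thesis by (simp add: mult.commute)
  qed
  then have "norm (u t - u 0 - (t - 0) *\<^sub>R u' 0) \<le> norm (t - 0) * (3 * M * \<bar>t\<bar>)"
    by (intro vector_differentiable_bound_linearization[where S = "closed_segment 0 t"])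
      (auto intro!: has_vector_derivative_at_within u seg)
  then show ?thesis
    by (simp add: power2_eq_square mult.commute mult.left_commute)
qed

lemma has_vector_derivative_quadratic:
  fixes u :: "real \<Rightarrow> 'a::real_normed_vector"
  assumes "\<And>t. \<bar>t\<bar> \<le> 1 \<Longrightarrow> norm (u t - u 0 - t *\<^sub>R D) \<le> B * t\<^sup>2"
  shows "(u has_vector_derivative D) (at 0)"
  unfolding has_vector_derivative_def
proof (rule has_derivativeI_sandwich[of 1 _ _ _ _ "\<lambda>t. B * \<bar>t\<bar>"])
  show "bounded_linear (\<lambda>t. t *\<^sub>R D)" by (rule bounded_linear_scaleR_left)
  fix t :: real assume "t \<noteq> 0" "dist t 0 < 1"
  then have "norm (u t - u 0 - t *\<^sub>R D) / \<bar>t\<bar> \<le> B * t\<^sup>2 / \<bar>t\<bar>"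
    using assms[of t] by (intro divide_right_mono) auto
  also have "\<dots> = B * \<bar>t\<bar>"
    using \<open>t \<noteq> 0\<close> by (simp add: power2_eq_square abs_if)
  finally show "norm (u t - u 0 - (t - 0) *\<^sub>R D) / norm (t - 0) \<le> B * \<bar>t\<bar>" by simp
next
  have "((\<lambda>t. B * \<bar>t\<bar>) \<longlongrightarrow> B * \<bar>0\<bar>) (at 0)" by (intro tendsto_intros)
  then show "((\<lambda>t. B * \<bar>t\<bar>) \<longlongrightarrow> 0) (at 0)" by simp
qed simp

lemma Basis_pair_cases:
  assumes "v \<in> (Basis :: ('a::euclidean_space \<times> 'b::euclidean_space) set)"
  obtains b where "v = (b, 0)" "b \<in> Basis" | b where "v = (0, b)" "b \<in> Basis"
  using assms unfolding Basis_prod_def by auto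

context cstar
begin

text \<open>The infinitesimal generator of \<open>t \<mapsto> U\<^bsub>ta,tb,0\<^esub>\<close> on functions, for \<open>v = (a, b)\<close>.\<close>

definition gen :: "(real^'n) \<times> (real^'n) \<Rightarrow> (real^'n \<Rightarrow> 'c) \<Rightarrow> real^'n \<Rightarrow> 'c" where
  "gen v f = (\<lambda>x. cscale (\<i> * of_real (snd v \<bullet> x)) (f x) - dir_deriv f (fst v) x)"

lemma dir_deriv_0 [simp]: "dir_deriv f 0 = (\<lambda>x. 0)"
  by (rule ext) (simp add: dir_deriv_def)

lemma gen_transl: "gen (b, 0) f = (\<lambda>x. - dir_deriv f b x)"
  by (simp add: gen_def cscale.zero_left)

lemma gen_coord: "gen (0, b) f = (\<lambda>x. cscale (\<i> * of_real (b \<bullet> x)) (f x))"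
  by (simp add: gen_def)

lemma schwartz_gen:
  fixes f :: "real^'n \<Rightarrow> 'c"
  assumes "schwartz f" "v \<in> Basis"
  shows "schwartz (gen v f)"
  using assms(2)
  by (cases rule: Basis_pair_cases)
    (simp_all add: gen_transl gen_coord schwartz_minus schwartz_dir_deriv schwartz_coord_mult assms(1))

lemma Ushift_has_vector_derivative:
  fixes f :: "real^'n \<Rightarrow> 'c"
  assumes f: "schwartz f" and v: "v \<in> Basis"
  shows "((\<lambda>t. Ushift cscale (t *\<^sub>R fst v) (t *\<^sub>R snd v) f x) has_vector_derivative
    Ushift cscale (s *\<^sub>R fst v) (s *\<^sub>R snd v) (gen v f) x) (at s)"
  using v
proof (cases rule: Basis_pair_cases)
  case (1 b)
  have "((\<lambda>t. f (x + t *\<^sub>R b)) \<circ> uminus has_vector_derivative (- 1) *\<^sub>R dir_deriv f b (x + (- s) *\<^sub>R b)) (at s)"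
    by (intro vector_diff_chain_at schwartz_has_vector_derivative f 1) (auto intro!: derivative_eq_intros)
  then show ?thesis
    by (simp add: 1 Ushift_def gen_transl o_def)
next
  case (2 b)
  have "((\<lambda>t. cis (t * (b \<bullet> x))) has_vector_derivative (b \<bullet> x) *\<^sub>R (\<i> * cis (s * (b \<bullet> x)))) (at s)"
    unfolding has_vector_derivative_def by (auto intro!: derivative_eq_intros ext)
  from bounded_linear.has_vector_derivative[OF cscale.bounded_linear_left this]
  have "((\<lambda>t. cscale (cis (t * (b \<bullet> x))) (f x)) has_vector_derivative
      cscale ((b \<bullet> x) *\<^sub>R (\<i> * cis (s * (b \<bullet> x)))) (f x)) (at s)" .
  moreover have "(b \<bullet> x) *\<^sub>R (\<i> * cis (s * (b \<bullet> x))) = cis (s * (b \<bullet> x)) * (\<i> * of_real (b \<bullet> x))"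
    by (simp add: scaleR_conv_of_real)
  ultimately show ?thesis
    by (simp add: 2 Ushift_def gen_coord)
qed

text \<open>Along the orbit of \<open>f\<close> the second derivative is the orbit of
  \<open>gen v (gen v f)\<close>, so a Taylor estimate holds at each point. For \<open>t\<close> of
  modulus at most 1 the translation changes the weight by a factor of at most 2, whence
  \<open>2 ^ k\<close> and a bound uniform in \<open>x\<close>.\<close>

lemma Ushift_quadratic_remainder:
  fixes f :: "real^'n \<Rightarrow> 'c"
  assumes f: "schwartz f" and v: "v \<in> Basis"
  obtains B where "\<And>t x. \<bar>t\<bar> \<le> 1 \<Longrightarrow>
    (1 + norm x) ^ k * norm (Ushift cscale (t *\<^sub>R fst v) (t *\<^sub>R snd v) f x - f x - t *\<^sub>R gen v f x) \<le> B * t\<^sup>2"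
proof -
  let ?V = "\<lambda>t. Ushift cscale (t *\<^sub>R fst v) (t *\<^sub>R snd v)"
  define g where "g = gen v (gen v f)"
  have g: "schwartz g" unfolding g_def by (intro schwartz_gen f v)
  obtain B where B: "B > 0" "\<And>x. (1 + norm x) ^ k * norm (g x) \<le> B"
    using schwartz_bound[OF g] by blast
  have a: "norm (fst v) \<le> 1"
    using v by (cases rule: Basis_pair_cases) auto
  have "(1 + norm x) ^ k * norm (?V t f x - f x - t *\<^sub>R gen v f x)
      \<le> (3 * 2 ^ k * B) * t\<^sup>2" if t: "\<bar>t\<bar> \<le> 1" for t x
  proof -
    have "norm (?V s g x) \<le> 2 ^ k * B / (1 + norm x) ^ k" if s: "\<bar>s\<bar> \<le> \<bar>t\<bar>" for s
    proof -
      let ?y = "x - s *\<^sub>R fst v"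
      have "norm (s *\<^sub>R fst v) \<le> 1"
        using s t a mult_mono[of "\<bar>s\<bar>" 1 "norm (fst v)" 1] by simp
      then have "norm x \<le> norm ?y + 1"
        using norm_triangle_sub[of x "s *\<^sub>R fst v"] by linarith
      then have "1 + norm x \<le> 2 + norm ?y" by linarith
      also have "\<dots> \<le> 2 * (1 + norm ?y)" by simp
      finally have "1 + norm x \<le> 2 * (1 + norm ?y)" .
      then have "(1 + norm x) ^ k \<le> (2 * (1 + norm ?y)) ^ k"
        by (intro power_mono) auto
      then have "(1 + norm x) ^ k * norm (g ?y) \<le> (2 * (1 + norm ?y)) ^ k * norm (g ?y)"
        by (intro mult_right_mono) auto
      also have "\<dots> \<le> 2 ^ k * B"
        unfolding power_mult_distrib mult.assoc by (intro mult_left_mono B) auto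
      finally have "(1 + norm x) ^ k * norm (g ?y) \<le> 2 ^ k * B" .
      then have "norm (g ?y) \<le> 2 ^ k * B / (1 + norm x) ^ k"
        by (subst pos_le_divide_eq) (auto simp: mult.commute add_pos_nonneg)
      then show ?thesis by (simp add: Ushift_def)
    qed
    then have "norm (?V t f x - ?V 0 f x
        - t *\<^sub>R ?V 0 (gen v f) x) \<le> 3 * (2 ^ k * B / (1 + norm x) ^ k) * t\<^sup>2"
      unfolding g_def
      by (intro taylor_remainder_bound[where u = "\<lambda>t. ?V t f x"
          and u' = "\<lambda>t. ?V t (gen v f) x"
          and u'' = "\<lambda>t. ?V t (gen v (gen v f)) x"]
          Ushift_has_vector_derivative schwartz_gen f v) auto
    then have "norm (?V t f x - f x - t *\<^sub>R gen v f x) \<le> 3 * (2 ^ k * B / (1 + norm x) ^ k) * t\<^sup>2"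
      by (simp add: Ushift_def)
    then have "(1 + norm x) ^ k * norm (?V t f x - f x - t *\<^sub>R gen v f x) \<le>
        (1 + norm x) ^ k * (3 * (2 ^ k * B / (1 + norm x) ^ k) * t\<^sup>2)"
      by (intro mult_left_mono) auto
    also have "\<dots> = (3 * 2 ^ k * B) * t\<^sup>2"
      by (simp add: add_nonneg_eq_0_iff)
    finally show ?thesis .
  qed
  then show ?thesis by (rule that)
qed

end

section \<open>Generators on the module, their common domain and their commutators\<close>

context schwartz_module
begin

lemma U_emb_has_vector_derivative:
  assumes f: "schwartz f" and v: "v \<in> Basis"
  shows "((\<lambda>t. U (t *\<^sub>R v) (emb f)) has_vector_derivative emb (gen v f)) (at 0)"
proof -
  obtain B where B: "\<And>t x. \<bar>t\<bar> \<le> 1 \<Longrightarrow> (1 + norm x) ^ (2 * DIM(real^'n)) *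
      norm (Ushift cscale (t *\<^sub>R fst v) (t *\<^sub>R snd v) f x - f x - t *\<^sub>R gen v f x) \<le> B * t\<^sup>2"
    using Ushift_quadratic_remainder[OF f v, of "2 * DIM(real^'n)"] by metis
  let ?C = "sqrt (integral UNIV (decay_weight :: real^'n \<Rightarrow> real))"
  show ?thesis
  proof (rule has_vector_derivative_quadratic[where B = "?C * B"])
    fix t :: real assume t: "\<bar>t\<bar> \<le> 1"
    let ?r = "\<lambda>x. Ushift cscale (t *\<^sub>R fst v) (t *\<^sub>R snd v) f x - f x - t *\<^sub>R gen v f x"
    have "U (t *\<^sub>R v) (emb f) - U (0 *\<^sub>R v) (emb f) - t *\<^sub>R emb (gen v f) = emb ?r"
      by (simp add: U_emb emb_diff emb_scaleR schwartz_diff schwartz_scaleR schwartz_Ushift schwartz_gen f v)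
    moreover have "norm (emb ?r) \<le> ?C * (B * t\<^sup>2)"
      by (intro norm_emb_le B t schwartz_diff schwartz_scaleR schwartz_Ushift schwartz_gen f v)
    ultimately show "norm (U (t *\<^sub>R v) (emb f) - U (0 *\<^sub>R v) (emb f) - t *\<^sub>R emb (gen v f)) \<le> ?C * B * t\<^sup>2"
      by (simp add: mult.assoc)
  qed
qed

definition X :: "(real^'n) \<times> (real^'n) \<Rightarrow> 'e \<Rightarrow> 'e" where
  "X v e = vector_derivative (\<lambda>t. U (t *\<^sub>R v) e) (at 0)"

primrec Xw :: "((real^'n) \<times> (real^'n)) list \<Rightarrow> 'e \<Rightarrow> 'e" where
  "Xw [] e = e"
| "Xw (v # vs) e = X v (Xw vs e)"

text \<open>The generators are unbounded, and \<open>X v e\<close> carries meaning only where the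
  orbit of \<open>e\<close> is differentiable. Smooth vectors form their common invariant
  domain.\<close>

definition smooth_vec :: "'e \<Rightarrow> bool" where
  "smooth_vec e \<longleftrightarrow> (\<forall>vs. set vs \<subseteq> Basis \<longrightarrow>
     (\<forall>v\<in>Basis. (\<lambda>t. U (t *\<^sub>R v) (Xw vs e)) differentiable (at 0)))"

lemma Xw_append: "Xw (vs @ ws) e = Xw vs (Xw ws e)"
  by (induction vs) auto

lemma X_eqI: "((\<lambda>t. U (t *\<^sub>R v) e) has_vector_derivative d) (at 0) \<Longrightarrow> X v e = d"
  unfolding X_def by (rule vector_derivative_at)

lemma smooth_vec_coinduct:
  assumes "P e"
    and deriv: "\<And>e v. P e \<Longrightarrow> v \<in> Basis \<Longrightarrow> \<exists>d. P d \<and> ((\<lambda>t. U (t *\<^sub>R v) e) has_vector_derivative d) (at 0)"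
  shows "smooth_vec e"
proof -
  have *: "P (X v e) \<and> (\<lambda>t. U (t *\<^sub>R v) e) differentiable (at 0)" if Pe: "P e" and v: "v \<in> Basis" for v e
  proof -
    obtain d where d: "P d" "((\<lambda>t. U (t *\<^sub>R v) e) has_vector_derivative d) (at 0)"
      using deriv[OF Pe v] by auto
    then show ?thesis
      using X_eqI[OF d(2)] differentiableI_vector[OF d(2)] by simp
  qed
  have "P (Xw vs e)" if "set vs \<subseteq> Basis" for vs
    using that by (induction vs) (auto simp: \<open>P e\<close> *)
  then show ?thesis
    unfolding smooth_vec_def using * by simp
qed

lemma X_has_vector_derivative:
  assumes "smooth_vec e" "v \<in> Basis"
  shows "((\<lambda>t. U (t *\<^sub>R v) e) has_vector_derivative X v e) (at 0)"
proof -
  have "(\<lambda>t. U (t *\<^sub>R v) (Xw [] e)) differentiable (at 0)"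
    using assms unfolding smooth_vec_def by (metis empty_subsetI list.set(1))
  then show ?thesis
    unfolding X_def by (simp add: vector_derivative_works[symmetric])
qed

lemma smooth_vec_X:
  assumes "smooth_vec e" "v \<in> Basis"
  shows "smooth_vec (X v e)"
proof -
  have "Xw vs (X v e) = Xw (vs @ [v]) e" for vs
    by (simp add: Xw_append)
  then show ?thesis
    using assms unfolding smooth_vec_def by simp
qed

lemma smooth_vec_Xw: "smooth_vec e \<Longrightarrow> set vs \<subseteq> Basis \<Longrightarrow> smooth_vec (Xw vs e)"
  by (induction vs) (auto simp: smooth_vec_X)

lemma smooth_vec_emb:
  assumes "schwartz f"
  shows "smooth_vec (emb f)"
proof (rule smooth_vec_coinduct[where P = "\<lambda>e. \<exists>f. schwartz f \<and> e = emb f"])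
  show "\<exists>g. schwartz g \<and> emb f = emb g" using assms by blast
  show "\<exists>d. (\<exists>f. schwartz f \<and> d = emb f) \<and> ((\<lambda>t. U (t *\<^sub>R v) e) has_vector_derivative d) (at 0)"
    if "\<exists>f. schwartz f \<and> e = emb f" "v \<in> Basis" for e :: 'e and v :: "(real^'n) \<times> (real^'n)"
    using that U_emb_has_vector_derivative schwartz_gen by blast
qed

lemma X_emb: "schwartz f \<Longrightarrow> v \<in> Basis \<Longrightarrow> X v (emb f) = emb (gen v f)"
  by (rule X_eqI[OF U_emb_has_vector_derivative])

lemma smooth_vec_commuting:
  assumes e: "smooth_vec e" and T: "bounded_linear T" "\<And>p e. U p (T e) = T (U p e)"
  shows "smooth_vec (T e)"
proof (rule smooth_vec_coinduct[where P = "\<lambda>d. \<exists>e. smooth_vec e \<and> d = T e"])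
  show "\<exists>d. smooth_vec d \<and> T e = T d" using e by blast
  fix d :: 'e and v :: "(real^'n) \<times> (real^'n)" assume "\<exists>e. smooth_vec e \<and> d = T e" and v: "v \<in> Basis"
  then obtain e where e: "smooth_vec e" "d = T e" by blast
  show "\<exists>d'. (\<exists>e. smooth_vec e \<and> d' = T e) \<and> ((\<lambda>t. U (t *\<^sub>R v) d) has_vector_derivative d') (at 0)"
    unfolding e(2) T(2)
    using bounded_linear.has_vector_derivative[OF T(1) X_has_vector_derivative[OF e(1) v]]
      smooth_vec_X[OF e(1) v] by blast
qed

lemma X_commuting:
  assumes "smooth_vec e" "v \<in> Basis" "bounded_linear T" "\<And>p e. U p (T e) = T (U p e)"
  shows "X v (T e) = T (X v e)"
  by (rule X_eqI, unfold assms(4),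
      rule bounded_linear.has_vector_derivative[OF assms(3) X_has_vector_derivative[OF assms(1,2)]])

lemma X_phase: "smooth_vec e \<Longrightarrow> v \<in> Basis \<Longrightarrow> X v (phase z e) = phase z (X v e)"
  by (rule X_commuting) (auto simp: U_phase bounded_linear_phase)

lemma smooth_vec_phase: "smooth_vec e \<Longrightarrow> smooth_vec (phase z e)"
  by (rule smooth_vec_commuting) (auto simp: U_phase bounded_linear_phase)

lemma X_scaleR: "smooth_vec e \<Longrightarrow> v \<in> Basis \<Longrightarrow> X v (r *\<^sub>R e) = r *\<^sub>R X v e"
  by (rule X_commuting) (auto simp: blinfun.scaleR_right bounded_linear_scaleR_right)

lemma smooth_vec_scaleR: "smooth_vec e \<Longrightarrow> smooth_vec (r *\<^sub>R e)"
  by (rule smooth_vec_commuting) (auto simp: blinfun.scaleR_right bounded_linear_scaleR_right)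

lemma X_add:
  assumes "smooth_vec d" "smooth_vec e" "v \<in> Basis"
  shows "X v (d + e) = X v d + X v e"
  by (rule X_eqI, unfold blinfun.add_right)
    (intro has_vector_derivative_add X_has_vector_derivative assms)

lemma smooth_vec_add:
  assumes "smooth_vec d" "smooth_vec e"
  shows "smooth_vec (d + e)"
proof (rule smooth_vec_coinduct[where P = "\<lambda>w. \<exists>d e. smooth_vec d \<and> smooth_vec e \<and> w = d + e"])
  show "\<exists>d' e'. smooth_vec d' \<and> smooth_vec e' \<and> d + e = d' + e'" using assms by blast
  fix w :: 'e and v :: "(real^'n) \<times> (real^'n)" assume "\<exists>d e. smooth_vec d \<and> smooth_vec e \<and> w = d + e" and v: "v \<in> Basis"
  then obtain d e where de: "smooth_vec d" "smooth_vec e" "w = d + e" by blast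
  show "\<exists>w'. (\<exists>d e. smooth_vec d \<and> smooth_vec e \<and> w' = d + e) \<and>
      ((\<lambda>t. U (t *\<^sub>R v) w) has_vector_derivative w') (at 0)"
    unfolding de(3) blinfun.add_right
    using has_vector_derivative_add[OF X_has_vector_derivative[OF de(1) v] X_has_vector_derivative[OF de(2) v]]
      smooth_vec_X[OF de(1) v] smooth_vec_X[OF de(2) v] by blast
qed

lemma smooth_vec_diff: "smooth_vec d \<Longrightarrow> smooth_vec e \<Longrightarrow> smooth_vec (d - e)"
  using smooth_vec_add[of d "(-1) *\<^sub>R e"] smooth_vec_scaleR[of e "-1"] by simp

lemma X_diff: "smooth_vec d \<Longrightarrow> smooth_vec e \<Longrightarrow> v \<in> Basis \<Longrightarrow> X v (d - e) = X v d - X v e"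
  using X_add[of d "(-1) *\<^sub>R e" v] smooth_vec_scaleR[of e "-1"] X_scaleR[of e v "-1"] by simp

lemma X_0 [simp]: "X v 0 = 0"
  by (rule X_eqI) (simp add: blinfun.zero_right)

lemma smooth_vec_0: "smooth_vec 0"
  by (rule smooth_vec_coinduct[where P = "\<lambda>e. e = 0"]) (auto simp: blinfun.zero_right)

lemma smooth_vec_sum: "(\<And>i. i \<in> I \<Longrightarrow> smooth_vec (h i)) \<Longrightarrow> smooth_vec (sum h I)"
  by (induction I rule: infinite_finite_induct) (auto simp: smooth_vec_0 smooth_vec_add)

lemma X_sum: "(\<And>i. i \<in> I \<Longrightarrow> smooth_vec (h i)) \<Longrightarrow> v \<in> Basis \<Longrightarrow> X v (sum h I) = (\<Sum>i\<in>I. X v (h i))"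
  by (induction I rule: infinite_finite_induct) (auto simp: X_add smooth_vec_sum)

lemma Xw_diff:
  "smooth_vec d \<Longrightarrow> smooth_vec e \<Longrightarrow> set vs \<subseteq> Basis \<Longrightarrow> Xw vs (d - e) = Xw vs d - Xw vs e"
  by (induction vs) (auto simp: X_diff smooth_vec_Xw)

text \<open>Unitarity makes the inner product constant along the orbits; its derivative at 0 shows
  that the generators are skew-adjoint.\<close>

lemma inn_X:
  assumes "smooth_vec d" "smooth_vec e" "v \<in> Basis"
  shows "inn (X v d) e = - inn d (X v e)"
proof -
  have "((\<lambda>t. inn (U (t *\<^sub>R v) d) (U (t *\<^sub>R v) e)) has_vector_derivative
      inn (U (0 *\<^sub>R v) d) (X v e) + inn (X v d) (U (0 *\<^sub>R v) e)) (at 0)"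
    by (intro inn.has_vector_derivative X_has_vector_derivative assms)
  then have "((\<lambda>t::real. inn d e) has_vector_derivative inn d (X v e) + inn (X v d) e) (at 0)"
    by simp
  from vector_derivative_unique_at[OF this has_vector_derivative_const]
  show ?thesis by (simp add: add_eq_0_iff)
qed

text \<open>\<open>e - t X e\<close> agrees with the isometric image \<open>U\<^bsub>-tv\<^esub> e\<close> up to \<open>o(t)\<close>.\<close>

lemma norm_le_resolvent:
  assumes "smooth_vec e" "v \<in> Basis"
  shows "norm e \<le> norm (e - X v e)"
proof (rule field_le_epsilon)
  fix r :: real assume r: "r > 0"
  have "((\<lambda>t. U (t *\<^sub>R v) e) has_derivative (\<lambda>t. t *\<^sub>R X v e)) (at 0)"
    using X_has_vector_derivative[OF assms] by (simp add: has_vector_derivative_def)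
  then obtain d where d: "d > 0" "\<And>t. norm (t - 0) < d \<Longrightarrow>
      norm (U (t *\<^sub>R v) e - U (0 *\<^sub>R v) e - (t - 0) *\<^sub>R X v e) \<le> r * norm (t - 0)"
    using r unfolding has_derivative_at_alt by blast
  define t where "t = min (d / 2) 1"
  have t: "t > 0" "t \<le> 1" "t < d" using d(1) by (auto simp: t_def min_def)
  have "norm (U ((- t) *\<^sub>R v) e - (e - t *\<^sub>R X v e)) \<le> r * t"
    using d(2)[of "- t"] t by (simp add: algebra_simps)
  then have "norm e \<le> norm (e - t *\<^sub>R X v e) + r * t"
    using norm_triangle_sub[of "U ((- t) *\<^sub>R v) e" "e - t *\<^sub>R X v e"] by simp
  \<comment> \<open>For \<open>t <= 1\<close> this is a convex combination. The share
    \<open>(1 - t) * norm e\<close> moves to the left side and a factor \<open>t\<close> cancels, so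
    the estimate for a small step becomes one for the step 1.\<close>
  also have "e - t *\<^sub>R X v e = (1 - t) *\<^sub>R e + t *\<^sub>R (e - X v e)"
    by (simp add: algebra_simps)
  also have "norm \<dots> \<le> (1 - t) * norm e + t * norm (e - X v e)"
    using t norm_triangle_ineq[of "(1 - t) *\<^sub>R e" "t *\<^sub>R (e - X v e)"] by simp
  finally have "t * norm e \<le> t * (norm (e - X v e) + r)"
    by (simp add: algebra_simps)
  then show "norm e \<le> norm (e - X v e) + r"
    using t by simp
qed

text \<open>The standard symplectic form, up to sign: the exponent of the phase by which two of the
  unitaries fail to commute.\<close>

definition symp :: "(real^'n) \<times> (real^'n) \<Rightarrow> (real^'n) \<times> (real^'n) \<Rightarrow> real" where
  "symp v w = fst w \<bullet> snd v - fst v \<bullet> snd w"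

text \<open>This crude bound is where the factor 2 in \<open>comm_const\<close> comes from.\<close>

lemma abs_symp_le:
  assumes "v \<in> Basis" "w \<in> Basis"
  shows "\<bar>symp v w\<bar> \<le> 2"
proof -
  have n: "norm (fst u) \<le> 1 \<and> norm (snd u) \<le> 1" if "u \<in> Basis" for u :: "(real^'n) \<times> (real^'n)"
    using that by (cases rule: Basis_pair_cases) auto
  have "\<bar>fst u \<bullet> snd u'\<bar> \<le> 1" if "u \<in> Basis" "u' \<in> Basis" for u u' :: "(real^'n) \<times> (real^'n)"
    using Cauchy_Schwarz_ineq2[of "fst u" "snd u'"] n[OF that(1)] n[OF that(2)]
      mult_mono[of "norm (fst u)" 1 "norm (snd u')" 1] by simp
  from this[OF assms] this[OF assms(2,1)] show ?thesis
    unfolding symp_def by linarith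
qed

lemma U_commute: "U p (U q e) = phase (cis (symp p q)) (U q (U p e))"
  by (simp add: U_U symp_def cis_mult add.commute)

text \<open>For general vectors a phase would remain. It is trivial here because a basis vector is a
  pure translation or a pure modulation.\<close>

lemma U_minus_right:
  assumes "v \<in> Basis"
  shows "U (s *\<^sub>R v) (U ((- s) *\<^sub>R v) e) = e"
proof -
  have "fst v \<bullet> snd v = 0" using assms by (cases rule: Basis_pair_cases) auto
  then show ?thesis by (simp add: U_U)
qed

text \<open>The canonical commutation relation, obtained by differentiating the two-parameter
  identity \<open>U_commute\<close> first in \<open>t\<close> and then in \<open>s\<close>. Pairing
  with a Schwartz vector moves one unitary to the left slot, so that each derivative falls on the
  orbit of a vector already known to be smooth.\<close>

lemma X_commutator:
  assumes e: "smooth_vec e" and v: "v \<in> Basis" and w: "w \<in> Basis"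
  shows "X v (X w e) = X w (X v e) + phase (\<i> * of_real (symp v w)) e"
proof (rule eq_if_inn_eq)
  fix f :: "real^'n \<Rightarrow> 'c" assume "schwartz f"
  then have d: "smooth_vec (emb f)" by (rule smooth_vec_emb)
  let ?d = "emb f" and ?c = "symp v w"
  have neg: "((\<lambda>t. U ((- t) *\<^sub>R u) ?d) has_vector_derivative (- X u ?d)) (at 0)" if "u \<in> Basis" for u
  proof -
    have "((\<lambda>t. U (t *\<^sub>R u) ?d) \<circ> uminus has_vector_derivative (-1) *\<^sub>R X u ?d) (at 0)"
      using X_has_vector_derivative[OF d that]
      by (intro vector_diff_chain_at) (auto intro!: derivative_eq_intros)
    then show ?thesis by (simp add: o_def)
  qed
  have star: "inn (U ((- s) *\<^sub>R v) ?d) (U (t *\<^sub>R w) e) =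
      cscale (cis (s * t * ?c)) (inn (U ((- t) *\<^sub>R w) ?d) (U (s *\<^sub>R v) e))" for s t
  proof -
    have "inn (U ((- s) *\<^sub>R v) ?d) (U (t *\<^sub>R w) e) = inn ?d (U (s *\<^sub>R v) (U (t *\<^sub>R w) e))"
      using inn_U[of "s *\<^sub>R v" "U ((- s) *\<^sub>R v) ?d" "U (t *\<^sub>R w) e"] by (simp only: U_minus_right[OF v])
    also have "\<dots> = cscale (cis (symp (s *\<^sub>R v) (t *\<^sub>R w))) (inn ?d (U (t *\<^sub>R w) (U (s *\<^sub>R v) e)))"
      by (subst U_commute) (simp only: inn_phase_right)
    also have "inn ?d (U (t *\<^sub>R w) (U (s *\<^sub>R v) e)) = inn (U ((- t) *\<^sub>R w) ?d) (U (s *\<^sub>R v) e)"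
      using inn_U[of "t *\<^sub>R w" "U ((- t) *\<^sub>R w) ?d" "U (s *\<^sub>R v) e"] by (simp only: U_minus_right[OF w])
    also have "symp (s *\<^sub>R v) (t *\<^sub>R w) = s * t * ?c"
      by (simp add: symp_def algebra_simps)
    finally show ?thesis .
  qed
  \<comment> \<open>The derivative of the identity \<open>star\<close> at \<open>t = 0\<close>, with
    \<open>s\<close> still free.\<close>
  have step: "inn (U ((- s) *\<^sub>R v) ?d) (X w e) =
      cscale (\<i> * of_real (s * ?c)) (inn ?d (U (s *\<^sub>R v) e)) - inn (X w ?d) (U (s *\<^sub>R v) e)" for s
  proof -
    have 1: "((\<lambda>t. inn (U ((- s) *\<^sub>R v) ?d) (U (t *\<^sub>R w) e)) has_vector_derivative
        inn (U ((- s) *\<^sub>R v) ?d) (X w e)) (at 0)"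
      by (rule bounded_linear.has_vector_derivative[OF inn.bounded_linear_right X_has_vector_derivative[OF e w]])
    have "((\<lambda>t. cis (s * t * ?c)) has_vector_derivative (s * ?c) *\<^sub>R (\<i> * cis (s * 0 * ?c))) (at 0)"
      unfolding has_vector_derivative_def by (auto intro!: derivative_eq_intros ext)
    from cscale.has_vector_derivative[OF this
        bounded_linear.has_vector_derivative[OF inn.bounded_linear_left neg[OF w]]]
    have "((\<lambda>t. inn (U ((- s) *\<^sub>R v) ?d) (U (t *\<^sub>R w) e)) has_vector_derivative
        cscale (cis (s * 0 * ?c)) (inn (- X w ?d) (U (s *\<^sub>R v) e)) +
        cscale ((s * ?c) *\<^sub>R (\<i> * cis (s * 0 * ?c))) (inn (U ((- 0) *\<^sub>R w) ?d) (U (s *\<^sub>R v) e))) (at 0)"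
      unfolding star .
    from vector_derivative_unique_at[OF 1 this] show ?thesis
      by (simp add: inn.minus_left scaleR_conv_of_real mult_ac)
  qed
  have 1: "((\<lambda>s. inn (U ((- s) *\<^sub>R v) ?d) (X w e)) has_vector_derivative inn (- X v ?d) (X w e)) (at 0)"
    by (rule bounded_linear.has_vector_derivative[OF inn.bounded_linear_left neg[OF v]])
  have "((\<lambda>s. \<i> * of_real (s * ?c)) has_vector_derivative \<i> * of_real ?c) (at 0)"
    by (auto intro!: derivative_eq_intros)
  from cscale.has_vector_derivative[OF this
      bounded_linear.has_vector_derivative[OF inn.bounded_linear_right X_has_vector_derivative[OF e v]]]
  have "((\<lambda>s. cscale (\<i> * of_real (s * ?c)) (inn ?d (U (s *\<^sub>R v) e))) has_vector_derivative
      cscale (\<i> * of_real ?c) (inn ?d e)) (at 0)"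
    by (simp add: cscale.zero_left)
  from has_vector_derivative_diff[OF this
      bounded_linear.has_vector_derivative[OF inn.bounded_linear_right[of "X w ?d"] X_has_vector_derivative[OF e v]]]
  have "((\<lambda>s. inn (U ((- s) *\<^sub>R v) ?d) (X w e)) has_vector_derivative
      cscale (\<i> * of_real ?c) (inn ?d e) - inn (X w ?d) (X v e)) (at 0)"
    unfolding step .
  from vector_derivative_unique_at[OF 1 this]
  have "- inn (X v ?d) (X w e) = cscale (\<i> * of_real ?c) (inn ?d e) - inn (X w ?d) (X v e)"
    by (simp add: inn.minus_left)
  then show "inn ?d (X v (X w e)) = inn ?d (X w (X v e) + phase (\<i> * of_real ?c) e)"
    using inn_X[OF d smooth_vec_X[OF e w] v] inn_X[OF d smooth_vec_X[OF e v] w]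
    by (simp add: inn.add_right inn_phase_right algebra_simps)
qed

end

section \<open>Smooth vectors\<close>

definition del_nth :: "nat \<Rightarrow> 'a list \<Rightarrow> 'a list" where
  "del_nth j xs = take j xs @ drop (Suc j) xs"

lemma del_nth_Cons [simp]: "del_nth 0 (x # xs) = xs" "del_nth (Suc j) (x # xs) = x # del_nth j xs"
  by (auto simp: del_nth_def)

lemma mset_del_nth:
  assumes "j < length xs"
  shows "mset xs = add_mset (xs ! j) (mset (del_nth j xs))"
proof -
  have "xs = take j xs @ xs ! j # drop (Suc j) xs"
    using assms by (rule id_take_nth_drop)
  then have "mset xs = mset (take j xs @ xs ! j # drop (Suc j) xs)"
    by simp
  then show ?thesis by (simp add: del_nth_def)
qed

lemma length_del_nth: "j < length xs \<Longrightarrow> length (del_nth j xs) = length xs - 1"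
  by (auto simp: del_nth_def)

lemma set_del_nth: "set (del_nth j xs) \<subseteq> set xs"
  using set_take_subset set_drop_subset by (fastforce simp: del_nth_def)

text \<open>The growth of the constants when generators are commuted past a word of length \<open>l\<close>.\<close>

primrec comm_const :: "nat \<Rightarrow> real" where
  "comm_const 0 = 1"
| "comm_const (Suc l) = 1 + 2 * (real l + 1) * comm_const l"

lemma comm_const_ge_1: "comm_const l \<ge> 1"
  by (induction l) auto

lemma comm_const_mono: "l \<le> m \<Longrightarrow> comm_const l \<le> comm_const m"
proof (induction m rule: dec_induct)
  case (step m)
  have "1 * comm_const m \<le> (2 * (real m + 1)) * comm_const m"
    using comm_const_ge_1[of m] by (intro mult_right_mono) auto
  with step show ?case by simp
qed simp

context schwartz_module
begin

text \<open>Each letter that \<open>X v\<close> crosses leaves a scalar commutator and disappears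
  from the word. Scalars commute with everything, so no nested commutators arise.\<close>

lemma X_Xw:
  assumes e: "smooth_vec e" and v: "v \<in> Basis"
  shows "set vs \<subseteq> Basis \<Longrightarrow> X v (Xw vs e) = Xw vs (X v e) +
    (\<Sum>j<length vs. phase (\<i> * of_real (symp v (vs ! j))) (Xw (del_nth j vs) e))"
proof (induction vs)
  case (Cons w vs)
  then have w: "w \<in> Basis" and vs: "set vs \<subseteq> Basis" by auto
  let ?S = "\<lambda>j. phase (\<i> * of_real (symp v (vs ! j))) (Xw (del_nth j vs) e)"
  have del: "smooth_vec (Xw (del_nth j vs) e)" for j
    using set_del_nth[of j vs] vs by (intro smooth_vec_Xw e) auto
  have "X v (Xw (w # vs) e) = X w (X v (Xw vs e)) + phase (\<i> * of_real (symp v w)) (Xw vs e)"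
    using X_commutator[OF smooth_vec_Xw[OF e vs] v w] by simp
  also have "X w (X v (Xw vs e)) = X w (Xw vs (X v e) + (\<Sum>j<length vs. ?S j))"
    using Cons.IH[OF vs] by simp
  also have "\<dots> = X w (Xw vs (X v e)) + (\<Sum>j<length vs. X w (?S j))"
    using X_add[OF smooth_vec_Xw[OF smooth_vec_X[OF e v] vs] smooth_vec_sum w, of "{..<length vs}" ?S]
      X_sum[of "{..<length vs}" ?S w] w smooth_vec_phase[OF del] by simp
  also have "(\<Sum>j<length vs. X w (?S j)) = (\<Sum>j<length vs. phase (\<i> * of_real (symp v (vs ! j))) (X w (Xw (del_nth j vs) e)))"
    by (intro sum.cong refl X_phase del w)
  finally show ?case
    by (simp add: sum.lessThan_Suc_shift algebra_simps del: sum.lessThan_Suc)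
qed simp

lemma norm_commutator_sum_le:
  assumes "v \<in> Basis" "set vs \<subseteq> Basis" "\<And>j. j < length vs \<Longrightarrow> norm (h j) \<le> M"
  shows "norm (\<Sum>j<length vs. phase (\<i> * of_real (symp v (vs ! j))) (h j)) \<le> 2 * real (length vs) * M"
proof -
  have "norm (phase (\<i> * of_real (symp v (vs ! j))) (h j)) \<le> 2 * M" if j: "j < length vs" for j
  proof -
    have "\<bar>symp v (vs ! j)\<bar> \<le> 2" using assms(1,2) j by (intro abs_symp_le) auto
    then show ?thesis
      using assms(3)[OF j] by (auto simp: norm_mult intro!: mult_mono)
  qed
  then have "norm (\<Sum>j<length vs. phase (\<i> * of_real (symp v (vs ! j))) (h j)) \<le> (\<Sum>j<length vs. 2 * M)"
    by (intro sum_norm_le) auto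
  then show ?thesis by (simp add: mult_ac)
qed

text \<open>Moving \<open>1 - X i\<close> through a word yields the word applied to
  \<open>e - X i e\<close>, up to words with one letter deleted; \<open>norm_le_resolvent\<close>
  then removes \<open>1 - X i\<close>. The resulting recursion for the constants is that of
  \<open>comm_const\<close>. Words are bounded by a multiset because letters get deleted and
  reordered.\<close>

lemma resolvent_word_bound:
  assumes e: "smooth_vec e" and i: "i \<in> Basis" and \<alpha>: "set_mset \<alpha> \<subseteq> Basis"
    and hyp: "\<And>ws. mset ws \<subseteq># \<alpha> \<Longrightarrow> norm (Xw ws (e - X i e)) \<le> \<delta>"
  shows "mset vs \<subseteq># \<alpha> \<Longrightarrow> norm (Xw vs e - X i (Xw vs e)) \<le> comm_const (length vs) * \<delta> \<and>
    norm (Xw vs e) \<le> comm_const (length vs) * \<delta>"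
proof (induction "length vs" arbitrary: vs)
  case 0
  then show ?case
    using hyp[of "[]"] norm_le_resolvent[OF e i] by simp
next
  case (Suc l)
  have vs: "set vs \<subseteq> Basis"
    using set_mset_mono[OF Suc.prems] \<alpha> by simp
  let ?S = "\<Sum>j<length vs. phase (\<i> * of_real (symp i (vs ! j))) (Xw (del_nth j vs) e)"
  have "Xw vs e - X i (Xw vs e) = Xw vs (e - X i e) - ?S"
    by (simp add: X_Xw[OF e i vs] Xw_diff[OF e smooth_vec_X[OF e i] vs])
  then have "norm (Xw vs e - X i (Xw vs e)) \<le> norm (Xw vs (e - X i e)) + norm ?S"
    using norm_triangle_ineq4 by simp
  also have "norm (Xw vs (e - X i e)) \<le> \<delta>"
    by (rule hyp[OF Suc.prems])
  also have "norm ?S \<le> 2 * real (length vs) * (comm_const l * \<delta>)"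
  proof (rule norm_commutator_sum_le[OF i vs])
    fix j assume j: "j < length vs"
    have "mset (del_nth j vs) \<subseteq># \<alpha>"
      using Suc.prems mset_del_nth[OF j] by (metis mset_subset_eq_insertD subset_mset.less_imp_le)
    moreover have "l = length (del_nth j vs)" using length_del_nth[OF j] Suc.hyps(2) by simp
    ultimately show "norm (Xw (del_nth j vs) e) \<le> comm_const l * \<delta>"
      using Suc.hyps(1) by metis
  qed
  finally have "norm (Xw vs e - X i (Xw vs e)) \<le> comm_const (length vs) * \<delta>"
    unfolding Suc.hyps(2)[symmetric] by (simp add: algebra_simps)
  moreover have "norm (Xw vs e) \<le> norm (Xw vs e - X i (Xw vs e))"
    by (intro norm_le_resolvent smooth_vec_Xw e vs i)
  ultimately show ?case by linarith
qed

text \<open>The resolvent gains one letter: control of \<open>e - X i e\<close> over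
  \<open>\<alpha>\<close> controls \<open>e\<close> on words with one more \<open>i\<close>. That
  \<open>i\<close> is pulled to the front, and \<open>X i w = w - (w - X i w)\<close> has two parts
  covered by the previous bound. They account for the summand 2 of the constant, the commutators for
  \<open>2 * size \<alpha>\<close>.\<close>

lemma resolvent_gain:
  assumes e: "smooth_vec e" and i: "i \<in> Basis" and \<alpha>: "set_mset \<alpha> \<subseteq> Basis"
    and hyp: "\<And>ws. mset ws \<subseteq># \<alpha> \<Longrightarrow> norm (Xw ws (e - X i e)) \<le> \<delta>"
    and sub: "mset vs \<subseteq># add_mset i \<alpha>"
  shows "norm (Xw vs e) \<le> (2 + 2 * real (size \<alpha>)) * comm_const (size \<alpha>) * \<delta>"
proof -
  let ?K = "comm_const (size \<alpha>)"
  have \<delta>: "\<delta> \<ge> 0" using hyp[of "[]"] norm_ge_zero by (metis empty_le mset.simps(1) order_trans)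
  note K = comm_const_ge_1[of "size \<alpha>"]
  have word: "norm (Xw ws e - X i (Xw ws e)) \<le> ?K * \<delta>" "norm (Xw ws e) \<le> ?K * \<delta>" if ws: "mset ws \<subseteq># \<alpha>" for ws
  proof -
    have "length ws \<le> size \<alpha>" using size_mset_mono[OF ws] by simp
    then have "comm_const (length ws) * \<delta> \<le> ?K * \<delta>"
      using \<delta> by (intro mult_right_mono comm_const_mono)
    then show "norm (Xw ws e - X i (Xw ws e)) \<le> ?K * \<delta>" "norm (Xw ws e) \<le> ?K * \<delta>"
      using resolvent_word_bound[OF e i \<alpha> hyp ws] by auto
  qed
  show ?thesis
  proof (cases "i \<in> set vs")
    case False
    have "mset vs \<subseteq># \<alpha>"
    proof (rule mset_subset_eqI)
      fix x
      show "count (mset vs) x \<le> count \<alpha> x"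
      proof (cases "x = i")
        case True
        then have c0: "count (mset vs) x = 0" using False by (simp flip: not_in_iff)
        show ?thesis unfolding c0 by (rule le0)
      qed (use mset_subset_eq_count[OF sub, of x] in auto)
    qed
    then have "norm (Xw vs e) \<le> ?K * \<delta>" by (rule word)
    also have "\<dots> \<le> (2 + 2 * real (size \<alpha>)) * (?K * \<delta>)"
      using mult_right_mono[of 1 "2 + 2 * real (size \<alpha>)" "?K * \<delta>"] K \<delta> by simp
    finally show ?thesis by (simp add: mult.assoc)
  next
    case True
    then obtain us ws where vs: "vs = us @ i # ws" by (metis split_list)
    have sub': "mset (us @ ws) \<subseteq># \<alpha>" using sub by (simp add: vs)
    have "set (us @ ws) \<subseteq> Basis"
      using order_trans[OF set_mset_mono[OF sub'] \<alpha>] by (simp only: set_mset_mset)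
    then have us: "set us \<subseteq> Basis" and ws: "set ws \<subseteq> Basis" by auto
    let ?S = "\<Sum>j<length us. phase (\<i> * of_real (symp i (us ! j))) (Xw (del_nth j us) (Xw ws e))"
    have "Xw vs e = X i (Xw (us @ ws) e) - ?S"
      using X_Xw[OF smooth_vec_Xw[OF e ws] i us] by (simp add: vs Xw_append)
    also have "\<dots> = Xw (us @ ws) e - (Xw (us @ ws) e - X i (Xw (us @ ws) e)) - ?S" by simp
    finally have "norm (Xw vs e) \<le> norm (Xw (us @ ws) e) + norm (Xw (us @ ws) e - X i (Xw (us @ ws) e)) + norm ?S"
      using norm_triangle_ineq4[of "Xw (us @ ws) e - (Xw (us @ ws) e - X i (Xw (us @ ws) e))" ?S]
        norm_triangle_ineq4[of "Xw (us @ ws) e" "Xw (us @ ws) e - X i (Xw (us @ ws) e)"] by simp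
    also have "norm ?S \<le> 2 * real (length us) * (?K * \<delta>)"
    proof (rule norm_commutator_sum_le[OF i us])
      fix j assume j: "j < length us"
      have "mset (us @ ws) = add_mset (us ! j) (mset (del_nth j us @ ws))"
        using mset_del_nth[OF j] by simp
      then have "mset (del_nth j us @ ws) \<subseteq># \<alpha>"
        using sub' by (metis mset_subset_eq_insertD subset_mset.less_imp_le)
      from word(2)[OF this] show "norm (Xw (del_nth j us) (Xw ws e)) \<le> ?K * \<delta>"
        by (simp add: Xw_append)
    qed
    also have "2 * real (length us) * (?K * \<delta>) \<le> 2 * real (size \<alpha>) * (?K * \<delta>)"
    proof -
      have "length us \<le> size \<alpha>" using size_mset_mono[OF sub'] by simp
      then show ?thesis using K \<delta> by (intro mult_right_mono mult_nonneg_nonneg) auto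
    qed
    finally show ?thesis
      using word[OF sub'] by (simp add: algebra_simps)
  qed
qed

section \<open>Approximation of smooth vectors by Schwartz functions\<close>

lemma resolvent_solvable:
  assumes i: "i \<in> Basis" and F: "schwartz F"
  shows "\<exists>f. schwartz f \<and> emb f - X i (emb f) = emb F"
  using i
proof (cases rule: Basis_pair_cases)
  case (1 b)
  \<comment> \<open>Since \<open>gen (b, 0)\<close> is minus the derivative, \<open>1 - X i\<close>
    is \<open>1 + d/db\<close> here and \<open>transl_res\<close> inverts it. In the other case it
    is multiplication by \<open>1 - i (b . x)\<close>.\<close>
  let ?f = "transl_res b F"
  have f: "schwartz ?f" by (rule schwartz_transl_res[OF F 1(2)])
  have "emb ?f - X i (emb ?f) = emb (\<lambda>x. ?f x - gen i ?f x)"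
    by (simp add: X_emb emb_diff schwartz_gen f i)
  also have "(\<lambda>x. ?f x - gen i ?f x) = F"
    by (simp add: 1 gen_transl transl_res_eq[OF F 1(2)])
  finally show ?thesis using f by blast
next
  case (2 b)
  let ?f = "\<lambda>x. cscale (inverse (1 - \<i> * of_real (b \<bullet> x))) (F x)"
  have f: "schwartz ?f" by (rule schwartz_coord_resolvent[OF F])
  have "emb ?f - X i (emb ?f) = emb (\<lambda>x. ?f x - gen i ?f x)"
    by (simp only: X_emb emb_diff schwartz_gen f i)
  also have "(\<lambda>x. ?f x - gen i ?f x) = F"
  proof
    fix x
    have nz: "1 - \<i> * complex_of_real (b \<bullet> x) \<noteq> 0" by (auto simp: complex_eq_iff)
    have "?f x - gen i ?f x = cscale (inverse (1 - \<i> * of_real (b \<bullet> x)) - \<i> * of_real (b \<bullet> x) * inverse (1 - \<i> * of_real (b \<bullet> x))) (F x)"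
      by (simp add: 2 gen_coord cscale.diff_left)
    also have "inverse (1 - \<i> * of_real (b \<bullet> x)) - \<i> * of_real (b \<bullet> x) * inverse (1 - \<i> * of_real (b \<bullet> x)) =
        (1 - \<i> * of_real (b \<bullet> x)) * inverse (1 - \<i> * complex_of_real (b \<bullet> x))"
      by (simp only: left_diff_distrib mult_1_left)
    also have "\<dots> = 1" using nz by (rule right_inverse)
    finally show "?f x - gen i ?f x = F x" by simp
  qed
  finally show ?thesis using f by blast
qed

text \<open>Each letter \<open>i\<close> is traded for a resolvent: approximate
  \<open>h - X i h\<close> over the smaller multiset by some \<open>F\<close>, and solve
  \<open>f - X i f = F\<close> among Schwartz functions. Then \<open>resolvent_gain\<close>, applied
  to \<open>emb f - h\<close>, brings the letter back. Plain density in \<open>E_n\<close> is the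
  case of the empty multiset.\<close>

lemma smooth_vec_approx:
  "set_mset \<alpha> \<subseteq> Basis \<Longrightarrow> smooth_vec h \<Longrightarrow> \<epsilon> > 0 \<Longrightarrow>
    \<exists>f. schwartz f \<and> (\<forall>vs. mset vs \<subseteq># \<alpha> \<longrightarrow> norm (Xw vs (emb f - h)) < \<epsilon>)"
proof (induction \<alpha> arbitrary: h \<epsilon>)
  case empty
  have "h \<in> closure (emb ` {f. schwartz f})" by (simp add: dense)
  then obtain f where "schwartz f" "dist (emb f) h < \<epsilon>"
    using empty.prems(3) unfolding closure_approachable by blast
  then show ?case by (auto simp: dist_norm)
next
  case (add i \<alpha>)
  then have i: "i \<in> Basis" and \<alpha>: "set_mset \<alpha> \<subseteq> Basis" by auto
  define C where "C = (2 + 2 * real (size \<alpha>)) * comm_const (size \<alpha>)"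
  have C: "C > 0"
    unfolding C_def using comm_const_ge_1[of "size \<alpha>"] by (intro mult_pos_pos) auto
  \<comment> \<open>Half of what \<open>C\<close> allows, to turn the weak inequality into a strict
    one.\<close>
  define \<delta> where "\<delta> = \<epsilon> / (2 * C)"
  have \<delta>: "\<delta> > 0" "C * \<delta> < \<epsilon>" using C add.prems(3) by (auto simp: \<delta>_def)
  let ?h = "h - X i h"
  have h': "smooth_vec ?h" by (intro smooth_vec_diff smooth_vec_X add.prems(2) i)
  obtain F where F: "schwartz F" "\<And>vs. mset vs \<subseteq># \<alpha> \<Longrightarrow> norm (Xw vs (emb F - ?h)) < \<delta>"
    using add.IH[OF \<alpha> h' \<delta>(1)] by auto
  obtain f where f: "schwartz f" "emb f - X i (emb f) = emb F"
    using resolvent_solvable[OF i F(1)] by auto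
  let ?e = "emb f - h"
  have e: "smooth_vec ?e" by (intro smooth_vec_diff smooth_vec_emb f add.prems(2))
  have eq: "?e - X i ?e = emb F - ?h"
    using f(2) by (simp add: X_diff[OF smooth_vec_emb[OF f(1)] add.prems(2) i] algebra_simps)
  have "norm (Xw ws (?e - X i ?e)) \<le> \<delta>" if "mset ws \<subseteq># \<alpha>" for ws
    unfolding eq using F(2)[OF that] by (rule less_imp_le)
  from resolvent_gain[OF e i \<alpha> this, folded C_def]
  have "norm (Xw vs ?e) < \<epsilon>" if "mset vs \<subseteq># add_mset i \<alpha>" for vs
    using that \<delta>(2) by fastforce
  then show ?case using f(1) by blast
qed

lemma smooth_vec_approx_seq:
  assumes h: "smooth_vec h"
  obtains f where "\<And>k. schwartz (f k)"
    "\<And>vs. set vs \<subseteq> Basis \<Longrightarrow> (\<lambda>k. Xw vs (emb (f k) - h)) \<longlonglongrightarrow> 0"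
proof -
  \<comment> \<open>Every basis vector occurs \<open>k\<close> times, so all words of length at most
    \<open>k\<close> fit in and each fixed word is eventually covered.\<close>
  define \<alpha> where "\<alpha> k = repeat_mset k (mset_set (Basis :: ((real^'n) \<times> (real^'n)) set))" for k
  have "\<exists>f. schwartz f \<and> (\<forall>vs. mset vs \<subseteq># \<alpha> k \<longrightarrow> norm (Xw vs (emb f - h)) < inverse (real (Suc k)))" for k
  proof (rule smooth_vec_approx[OF _ h])
    show "set_mset (\<alpha> k) \<subseteq> Basis"
    proof
      fix x assume "x \<in># \<alpha> k"
      then have "count (\<alpha> k) x > 0" by simp
      then show "x \<in> Basis" by (cases "x \<in> Basis") (auto simp: \<alpha>_def simp del: count_greater_zero_iff)
    qed
  qed auto
  then obtain f where f: "\<And>k. schwartz (f k)"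
    "\<And>k vs. mset vs \<subseteq># \<alpha> k \<Longrightarrow> norm (Xw vs (emb (f k) - h)) < inverse (real (Suc k))"
    by metis
  have "(\<lambda>k. Xw vs (emb (f k) - h)) \<longlonglongrightarrow> 0" if vs: "set vs \<subseteq> Basis" for vs
  proof (rule Lim_null_comparison[OF _ LIMSEQ_inverse_real_of_nat])
    have "mset vs \<subseteq># \<alpha> k" if k: "length vs \<le> k" for k
    proof (rule mset_subset_eqI)
      fix b
      show "count (mset vs) b \<le> count (\<alpha> k) b"
      proof (cases "b \<in> Basis")
        case True
        have "count (mset vs) b \<le> length vs"
          by (metis count_le_size size_mset)
        with k True show ?thesis by (simp add: \<alpha>_def)
      next
        case False
        then have "b \<notin> set vs" using vs by blast
        then have c0: "count (mset vs) b = 0" by (simp flip: not_in_iff)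
        show ?thesis unfolding c0 by (rule le0)
      qed
    qed
    then have "\<forall>k\<ge>length vs. norm (Xw vs (emb (f k) - h)) \<le> inverse (real (Suc k))"
      using f(2) less_imp_le by blast
    then show "\<forall>\<^sub>F k in sequentially. norm (Xw vs (emb (f k) - h)) \<le> inverse (real (Suc k))"
      unfolding eventually_sequentially by blast
  qed
  with f(1) show ?thesis by (rule that)
qed

section \<open>Conjugation orbits of an operator\<close>

definition conj_op :: "(real^'n) \<times> (real^'n) \<Rightarrow> ('e \<Rightarrow>\<^sub>L 'e) \<Rightarrow> ('e \<Rightarrow>\<^sub>L 'e)" where
  "conj_op p B = U p o\<^sub>L B o\<^sub>L Uinv cscale emb (fst p) (snd p)"

lemma conj_op_U: "conj_op p B (U p e) = U p (B e)"
  by (simp add: conj_op_def Uinv_inverse)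

lemma U_surj: obtains d where "e = U p d"
  using Uinv_inverse(2) by metis

lemma conj_op_eqI:
  fixes B C :: "'e \<Rightarrow>\<^sub>L 'e"
  assumes "\<And>e. B (U p e) = C (U p e)"
  shows "B = C"
  by (rule blinfun_eqI) (metis U_surj assms)

lemma conj_op_0 [simp]: "conj_op 0 B = B"
  by (rule conj_op_eqI[of _ 0]) (simp only: conj_op_U, simp)

definition phase_linear :: "('e \<Rightarrow>\<^sub>L 'e) \<Rightarrow> bool" where
  "phase_linear B \<longleftrightarrow> (\<forall>z e. B (phase z e) = phase z (B e))"

lemma phase_linear_conj_op:
  assumes "phase_linear B"
  shows "phase_linear (conj_op p B)"
  unfolding phase_linear_def
proof (intro allI)
  fix z e
  obtain d where d: "e = U p d" by (rule U_surj)
  have "conj_op p B (phase z e) = conj_op p B (U p (phase z d))" by (simp add: d U_phase)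
  also have "\<dots> = U p (B (phase z d))" by (rule conj_op_U)
  also have "\<dots> = phase z (conj_op p B e)"
    using assms by (simp add: d conj_op_U phase_linear_def U_phase)
  finally show "conj_op p B (phase z e) = phase z (conj_op p B e)" .
qed

text \<open>The phases in \<open>U p (U q e)\<close> cancel against those of the inverse only after
  passing through \<open>B\<close>. On complex-linear operators conjugation is thus a genuine group
  action although \<open>U\<close> is projective.\<close>

lemma conj_op_add:
  assumes "phase_linear B"
  shows "conj_op (p + q) B = conj_op p (conj_op q B)"
proof (rule blinfun_eqI)
  fix e
  obtain d where d: "e = U p d" by (rule U_surj)
  obtain d' where d': "d = U q d'" by (rule U_surj)
  have "conj_op p (conj_op q B) e = U p (U q (B d'))"
    by (simp add: d d' conj_op_U)
  also have "\<dots> = conj_op (p + q) B e"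
    using phase_linear_conj_op[OF assms] by (simp add: d d' U_U conj_op_U phase_linear_def)
  finally show "conj_op (p + q) B e = conj_op p (conj_op q B) e" ..
qed

lemma bounded_linear_conj_op: "bounded_linear (conj_op p)"
  unfolding conj_op_def
  by (intro bounded_linear_compose[OF bounded_bilinear.bounded_linear_left[OF bounded_bilinear_blinfun_compose]]
    bounded_bilinear.bounded_linear_right[OF bounded_bilinear_blinfun_compose])

text \<open>Moving \<open>A\<close> to the other slot lets \<open>inn\<close> pull the phase out, so
  the defect of complex linearity is orthogonal to itself.\<close>

lemma phase_linear_if_adjointable:
  assumes "adjointable inn (blinfun_apply A)"
  shows "phase_linear A"
  unfolding phase_linear_def
proof (intro allI)
  fix z e
  obtain B where B: "\<And>x y. inn (A x) y = inn x (B y)"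
    using assms unfolding adjointable_def by auto
  let ?d = "A (phase z e) - phase z (A e)"
  have "inn (A (phase z e)) ?d = inn (phase z (A e)) ?d"
    by (simp add: B inn_phase_left)
  then have "inn ?d ?d = 0" by (simp add: inn.diff_left)
  then have "?d = 0" using norm_sq_eq[of ?d] by simp
  then show "A (phase z e) = phase z (A e)" by simp
qed

text \<open>By the action law, a directional derivative at \<open>p\<close> is the conjugate by
  \<open>p\<close> of the derivative at 0. Every iterated partial of an orbit is therefore again the
  orbit of one operator, and complex linearity passes to the derivative.\<close>

lemma iter_pd_conj_op:
  assumes A: "phase_linear A" and sm: "smooth (\<lambda>p. conj_op p A)"
  shows "set vs \<subseteq> Basis \<Longrightarrow> \<exists>B. phase_linear B \<and> iter_pd vs (\<lambda>p. conj_op p A) = (\<lambda>p. conj_op p B)"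
proof (induction vs)
  case Nil
  then show ?case using A by auto
next
  case (Cons v vs)
  then obtain B where B: "phase_linear B" "iter_pd vs (\<lambda>p. conj_op p A) = (\<lambda>p. conj_op p B)" by auto
  have v: "v \<in> Basis" and vs: "set vs \<subseteq> Basis" using Cons.prems by auto
  have "(\<lambda>t. iter_pd vs (\<lambda>p. conj_op p A) (0 + t *\<^sub>R v)) differentiable (at 0)"
    using sm v vs unfolding smooth_def by blast
  then have "(\<lambda>t. conj_op (t *\<^sub>R v) B) differentiable (at 0)" by (simp add: B(2))
  then obtain D where D: "((\<lambda>t. conj_op (t *\<^sub>R v) B) has_vector_derivative D) (at 0)"
    using vector_derivative_works by blast
  have "dir_deriv (\<lambda>p. conj_op p B) v p = conj_op p D" for p
  proof -
    have "((\<lambda>t. conj_op (p + t *\<^sub>R v) B) has_vector_derivative conj_op p D) (at 0)"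
      unfolding conj_op_add[OF B(1)]
      by (rule bounded_linear.has_vector_derivative[OF bounded_linear_conj_op D])
    then show ?thesis unfolding dir_deriv_def by (rule vector_derivative_at)
  qed
  then have "iter_pd (v # vs) (\<lambda>p. conj_op p A) = (\<lambda>p. conj_op p D)"
    by (simp add: B(2) fun_eq_iff)
  moreover have "phase_linear D"
    unfolding phase_linear_def
  proof (intro allI)
    fix z e
    have D': "((\<lambda>t. conj_op (t *\<^sub>R v) B e) has_vector_derivative D e) (at 0)" for e
      by (rule bounded_linear.has_vector_derivative[OF blinfun.bounded_linear_left D])
    have "((\<lambda>t. conj_op (t *\<^sub>R v) B (phase z e)) has_vector_derivative phase z (D e)) (at 0)"
      using bounded_linear.has_vector_derivative[OF bounded_linear_phase D'[of e]]
        phase_linear_conj_op[OF B(1)] by (simp add: phase_linear_def)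
    from vector_derivative_unique_at[OF D' this] show "D (phase z e) = phase z (D e)" .
  qed
  ultimately show ?case by blast
qed

text \<open>Moving \<open>A (emb f)\<close> by a unitary amounts to applying the conjugated operator
  to the moved \<open>emb f\<close>. The product rule then differentiates either the operator or
  \<open>f\<close>, so that one never leaves finite sums of elements of \<open>S\<close>.\<close>

lemma smooth_vec_heisenberg_smooth:
  assumes A: "phase_linear A" and sm: "smooth (\<lambda>p. conj_op p A)" and f: "schwartz f"
  shows "smooth_vec (A (emb f))"
proof -
  let ?G = "\<lambda>vs. iter_pd vs (\<lambda>p. conj_op p A)"
  define S where "S = {?G vs 0 (emb f) | vs f. set vs \<subseteq> Basis \<and> schwartz f}"
  have S: "\<exists>d1\<in>S. \<exists>d2\<in>S. ((\<lambda>t. U (t *\<^sub>R v) e) has_vector_derivative d1 + d2) (at 0)"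
    if e: "e \<in> S" and v: "v \<in> Basis" for e v
  proof -
    obtain vs f where vs: "set vs \<subseteq> Basis" and f: "schwartz f" and e: "e = ?G vs 0 (emb f)"
      using e unfolding S_def by blast
    obtain B where B: "?G vs = (\<lambda>p. conj_op p B)" using iter_pd_conj_op[OF A sm vs] by blast
    have "(\<lambda>t. ?G vs (0 + t *\<^sub>R v)) differentiable (at 0)"
      using sm v vs unfolding smooth_def by blast
    then have D: "((\<lambda>t. ?G vs (t *\<^sub>R v)) has_vector_derivative ?G (v # vs) 0) (at 0)"
      by (simp add: dir_deriv_def vector_derivative_works[symmetric])
    have "((\<lambda>t. ?G vs (t *\<^sub>R v) (U (t *\<^sub>R v) (emb f))) has_vector_derivative
        ?G vs (0 *\<^sub>R v) (emb (gen v f)) + ?G (v # vs) 0 (U (0 *\<^sub>R v) (emb f))) (at 0)"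
      by (rule bounded_bilinear.has_vector_derivative[OF bounded_bilinear_blinfun_apply D
          U_emb_has_vector_derivative[OF f v]])
    moreover have "?G vs (t *\<^sub>R v) (U (t *\<^sub>R v) (emb f)) = U (t *\<^sub>R v) e" for t
      by (simp add: e B conj_op_U)
    ultimately have "((\<lambda>t. U (t *\<^sub>R v) e) has_vector_derivative ?G vs 0 (emb (gen v f)) + ?G (v # vs) 0 (emb f)) (at 0)"
      by (simp del: iter_pd.simps)
    moreover have "?G vs 0 (emb (gen v f)) \<in> S" "?G (v # vs) 0 (emb f) \<in> S"
      unfolding S_def using vs v f schwartz_gen[OF f v]
      by (force simp del: iter_pd.simps)+
    ultimately show ?thesis by blast
  qed
  \<comment> \<open>One derivative of an element of \<open>S\<close> is a sum of two, so the
    invariant family for the coinduction consists of finite sums; lists admit repetitions.\<close>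
  have "smooth_vec e" if "\<exists>es. set es \<subseteq> S \<and> e = sum_list es" for e
  proof (rule smooth_vec_coinduct[where P = "\<lambda>e. \<exists>es. set es \<subseteq> S \<and> e = sum_list es", OF that])
    fix e :: 'e and v :: "(real^'n) \<times> (real^'n)"
    assume "\<exists>es. set es \<subseteq> S \<and> e = sum_list es" and v: "v \<in> Basis"
    then obtain es where es: "set es \<subseteq> S" "e = sum_list es" by blast
    have "\<exists>ds. set ds \<subseteq> S \<and> ((\<lambda>t. U (t *\<^sub>R v) (sum_list es)) has_vector_derivative sum_list ds) (at 0)"
      using es(1)
    proof (induction es)
      case Nil
      then show ?case by (auto simp: blinfun.zero_right intro!: exI[of _ "[]"])
    next
      case (Cons e es)
      then obtain ds where ds: "set ds \<subseteq> S" "((\<lambda>t. U (t *\<^sub>R v) (sum_list es)) has_vector_derivative sum_list ds) (at 0)"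
        by auto
      obtain d1 d2 where d: "d1 \<in> S" "d2 \<in> S" "((\<lambda>t. U (t *\<^sub>R v) e) has_vector_derivative d1 + d2) (at 0)"
        using S[OF _ v, of e] Cons.prems by auto
      show ?case
        using has_vector_derivative_add[OF d(3) ds(2)] ds(1) d(1,2)
        by (intro exI[of _ "d1 # d2 # ds"]) (simp add: blinfun.add_right add.assoc)
    qed
    then show "\<exists>d. (\<exists>es. set es \<subseteq> S \<and> d = sum_list es) \<and> ((\<lambda>t. U (t *\<^sub>R v) e) has_vector_derivative d) (at 0)"
      unfolding es(2) by blast
  qed
  moreover have "A (emb f) \<in> S"
    unfolding S_def using f by (auto intro!: exI[of _ "[]"] exI[of _ f])
  ultimately show ?thesis
    by (metis empty_subsetI insert_subset list.set(1) list.simps(15) sum_list.Cons sum_list.Nil add.right_neutral)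
qed

end

section \<open>Approximation of the Dirac distribution\<close>

definition logistic :: "real \<Rightarrow> real \<Rightarrow> real" where
  "logistic m s = inverse (1 + exp (- (m * s)))"

lemma logistic_bounds: "0 < logistic m s" "logistic m s < 1"
  by (auto simp: logistic_def add_pos_pos inverse_less_1_iff)

lemma DERIV_logistic: "(logistic m has_real_derivative m * logistic m s * (1 - logistic m s)) (at s)"
proof -
  have pos: "1 + exp (- (m * s)) > 0" by (simp add: add_pos_pos)
  have "(logistic m has_real_derivative - (exp (- (m * s)) * (- m) * inverse ((1 + exp (- (m * s)))\<^sup>2))) (at s)"
    unfolding logistic_def[abs_def] using pos
    by (auto intro!: derivative_eq_intros simp: power2_eq_square)
  also have "- (exp (- (m * s)) * (- m) * inverse ((1 + exp (- (m * s)))\<^sup>2)) = m * logistic m s * (1 - logistic m s)"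
    using pos by (simp add: logistic_def field_simps power2_eq_square)
  finally show ?thesis .
qed

text \<open>With \<open>l\<close> the logistic function, \<open>l' = m l (1 - l)\<close>. Hence
  differentiation preserves the form \<open>e^(-s) Q(l)\<close> and acts on polynomials as
  \<open>kernel_deriv\<close>. The choice \<open>Q = [:0, 1:]\<close> is the smoothed fundamental
  solution.\<close>

definition logistic_kernel :: "real \<Rightarrow> real poly \<Rightarrow> real \<Rightarrow> real" where
  "logistic_kernel m Q s = exp (- s) * poly Q (logistic m s)"

definition kernel_deriv :: "real \<Rightarrow> real poly \<Rightarrow> real poly" where
  "kernel_deriv m Q = [:0, m, -m:] * pderiv Q - Q"

lemma DERIV_logistic_kernel:
  "(logistic_kernel m Q has_real_derivative logistic_kernel m (kernel_deriv m Q) s) (at s)"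
proof -
  have "((\<lambda>s. poly Q (logistic m s)) has_real_derivative
      poly (pderiv Q) (logistic m s) * (m * logistic m s * (1 - logistic m s))) (at s)"
    by (rule DERIV_chain2[OF poly_DERIV DERIV_logistic])
  then have "(logistic_kernel m Q has_real_derivative exp (- s) * (- 1) * poly Q (logistic m s) +
      poly (pderiv Q) (logistic m s) * (m * logistic m s * (1 - logistic m s)) * exp (- s)) (at s)"
    unfolding logistic_kernel_def[abs_def]
    by (intro DERIV_mult) (auto intro!: derivative_eq_intros)
  also have "exp (- s) * (- 1) * poly Q (logistic m s) +
      poly (pderiv Q) (logistic m s) * (m * logistic m s * (1 - logistic m s)) * exp (- s) =
      logistic_kernel m (kernel_deriv m Q) s"
    by (simp add: logistic_kernel_def kernel_deriv_def algebra_simps)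
  finally show ?thesis .
qed

text \<open>For negative \<open>s\<close> the logistic function is at most \<open>e^(m s)\<close>,
  which against \<open>e^(-s)\<close> leaves \<open>e^((m - 1) s)\<close>; the condition
  \<open>m >= 2\<close> makes this at most \<open>e^s\<close>.\<close>

lemma exp_logistic_le:
  assumes "m \<ge> 2"
  shows "exp (- s) * logistic m s \<le> exp (- \<bar>s\<bar>)"
proof (cases "s \<ge> 0")
  case True
  then show ?thesis using logistic_bounds[of m s] by (simp add: mult_left_le)
next
  case False
  have "logistic m s \<le> inverse (exp (- (m * s)))"
    unfolding logistic_def by (intro le_imp_inverse_le) auto
  then have "exp (- s) * logistic m s \<le> exp (- s) * exp (m * s)"
    by (intro mult_left_mono) (auto simp: exp_minus)
  also have "\<dots> = exp ((m - 2) * s + s)"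
    by (simp add: algebra_simps flip: exp_add)
  also have "\<dots> \<le> exp s"
    using False assms by (auto intro: mult_nonneg_nonpos)
  finally show ?thesis using False by simp
qed

text \<open>A polynomial without constant term splits off one factor \<open>logistic m s\<close>,
  which tames \<open>e^(-s)\<close> at minus infinity. The cofactor is bounded because the logistic
  function takes its values in the unit interval.\<close>

lemma logistic_kernel_decay:
  assumes "m \<ge> 2" "poly Q 0 = 0"
  shows "\<exists>B. \<forall>s. (1 + \<bar>s\<bar>) ^ k * \<bar>logistic_kernel m Q s\<bar> \<le> B"
proof -
  obtain R where R: "Q = [:0, 1:] * R"
    using assms(2) by (auto simp: poly_eq_0_iff_dvd elim: dvdE)
  have "compact (poly R ` {0..1})"
    by (intro compact_continuous_image continuous_intros) auto
  then have "bounded (poly R ` {0..1})" by (rule compact_imp_bounded)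
  then obtain C where "\<forall>z\<in>poly R ` {0..1}. norm z \<le> C"
    unfolding bounded_iff by blast
  then have C: "\<bar>poly R y\<bar> \<le> C" if "y \<in> {0..1}" for y
    using that by simp
  have "(1 + \<bar>s\<bar>) ^ k * \<bar>logistic_kernel m Q s\<bar> \<le> fact k * exp 1 * C" for s
  proof -
    have l: "logistic m s \<in> {0..1}" using logistic_bounds[of m s] by auto
    have "\<bar>logistic_kernel m Q s\<bar> = (exp (- s) * logistic m s) * \<bar>poly R (logistic m s)\<bar>"
      using logistic_bounds[of m s] by (simp add: logistic_kernel_def R abs_mult)
    also have "\<dots> \<le> exp (- \<bar>s\<bar>) * C"
      using C[OF l] exp_logistic_le[OF assms(1), of s] by (intro mult_mono) auto
    finally have 1: "\<bar>logistic_kernel m Q s\<bar> \<le> exp (- \<bar>s\<bar>) * C" .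
    have 2: "(1 + \<bar>s\<bar>) ^ k \<le> fact k * exp (1 + \<bar>s\<bar>)"
      by (intro power_le_fact_mult_exp) auto
    have "(1 + \<bar>s\<bar>) ^ k * \<bar>logistic_kernel m Q s\<bar> \<le> (fact k * exp (1 + \<bar>s\<bar>)) * (exp (- \<bar>s\<bar>) * C)"
      by (intro mult_mono 1 2) auto
    also have "\<dots> = fact k * (exp (1 + \<bar>s\<bar>) * exp (- \<bar>s\<bar>)) * C" by simp
    also have "exp (1 + \<bar>s\<bar>) * exp (- \<bar>s\<bar>) = exp 1" by (simp flip: exp_add)
    finally show ?thesis .
  qed
  then show ?thesis by blast
qed

definition prod_kernel :: "real \<Rightarrow> (real^'n \<Rightarrow> real poly) \<Rightarrow> real^'n \<Rightarrow> real" where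
  "prod_kernel m P x = (\<Prod>b\<in>Basis. logistic_kernel m (P b) (x \<bullet> b))"

lemma poly_kernel_deriv_0: "poly Q 0 = 0 \<Longrightarrow> poly ((kernel_deriv m ^^ i) Q) 0 = 0"
  by (induction i) (auto simp: kernel_deriv_def)

lemma schwartz_prod_logistic:
  fixes P :: "real^'n \<Rightarrow> real poly" and c :: "'c::real_normed_vector"
  assumes "m \<ge> 2" "\<And>b. poly (P b) 0 = 0"
  shows "schwartz (\<lambda>x. prod_kernel m P x *\<^sub>R c)"
    and "v \<in> Basis \<Longrightarrow> dir_deriv (\<lambda>x. prod_kernel m P x *\<^sub>R c) v =
      (\<lambda>x. prod_kernel m (P(v := kernel_deriv m (P v))) x *\<^sub>R c)"
proof -
  define q where "q b i = logistic_kernel m ((kernel_deriv m ^^ i) (P b))" for b i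
  have q: "(q b i has_real_derivative q b (Suc i) s) (at s)" for b i s
    using DERIV_logistic_kernel[of m "(kernel_deriv m ^^ i) (P b)" s] by (simp add: q_def)
  have bdd: "\<exists>B. \<forall>s. (1 + \<bar>s\<bar>) ^ k * \<bar>q b i s\<bar> \<le> B" for b i k
    unfolding q_def by (intro logistic_kernel_decay poly_kernel_deriv_0 assms)
  have P: "prod_kernel m P x = (\<Prod>b\<in>Basis. q b ((\<lambda>_. 0) b) (x \<bullet> b))" for x
    by (simp add: prod_kernel_def q_def)
  show "schwartz (\<lambda>x. prod_kernel m P x *\<^sub>R c)"
    unfolding P by (rule schwartz_prod_kernel[of q, OF q bdd])
  assume v: "v \<in> Basis"
  have P': "prod_kernel m (P(v := kernel_deriv m (P v))) x =
      (\<Prod>b\<in>Basis. q b (((\<lambda>_. 0)(v := Suc ((\<lambda>_. 0) v))) b) (x \<bullet> b))" for x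
    unfolding prod_kernel_def by (intro prod.cong) (auto simp: q_def)
  show "dir_deriv (\<lambda>x. prod_kernel m P x *\<^sub>R c) v =
      (\<lambda>x. prod_kernel m (P(v := kernel_deriv m (P v))) x *\<^sub>R c)"
    unfolding P P' by (rule dir_deriv_prod_kernel[of q, OF q v])
qed

lemma prod_kernel_add:
  assumes "v \<in> Basis"
  shows "prod_kernel m P x + prod_kernel m (P(v := R)) x = prod_kernel m (P(v := P v + R)) x"
proof -
  have "(\<Prod>b\<in>Basis - {v}. logistic_kernel m ((P(v := S)) b) (x \<bullet> b)) =
      (\<Prod>b\<in>Basis - {v}. logistic_kernel m (P b) (x \<bullet> b))" for S
    by (intro prod.cong) auto
  then show ?thesis
    using assms unfolding prod_kernel_def
    by (simp add: prod.remove[of Basis v] logistic_kernel_def algebra_simps)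
qed

text \<open>This is \<open>1 + d/ds\<close> applied to \<open>e^(-s) * logistic m s\<close>: the
  derivative of the exponential cancels, and what remains is \<open>e^(-s)\<close> times the
  derivative of the smoothed step, concentrating at 0 as \<open>m\<close> grows.\<close>

definition dirac_kernel :: "real \<Rightarrow> real \<Rightarrow> real" where
  "dirac_kernel m = logistic_kernel m [:0, m, -m:]"

lemma dirac_kernel_eq: "dirac_kernel m s = m * exp (- s) * (logistic m s * (1 - logistic m s))"
  by (simp add: dirac_kernel_def logistic_kernel_def algebra_simps)

lemma logistic_mult_eq: "logistic m s * (1 - logistic m s) = exp (- (m * s)) / (1 + exp (- (m * s)))\<^sup>2"
proof -
  have "1 + exp (- (m * s)) > 0" by (simp add: add_pos_pos)
  then show ?thesis by (simp add: logistic_def field_simps power2_eq_square)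
qed

lemma dirac_kernel_nonneg: "m \<ge> 0 \<Longrightarrow> dirac_kernel m s \<ge> 0"
  using logistic_bounds[of m s] by (simp add: dirac_kernel_eq)

text \<open>\<open>E / (1 + E)^2\<close> is invariant under inversion of \<open>E\<close>, hence
  bounded by both \<open>E\<close> and its inverse, the smaller of which is
  \<open>e^(-m |s|)\<close>. The factor \<open>e^(-s)\<close> costs one unit of the rate.\<close>

lemma dirac_kernel_le:
  assumes "m \<ge> 0"
  shows "dirac_kernel m s \<le> m * exp (- ((m - 1) * \<bar>s\<bar>))"
proof -
  define E where "E = exp (- (m * s))"
  have E: "E > 0" by (simp add: E_def)
  have "E / (1 + E)\<^sup>2 \<le> E"
    using E by (simp add: divide_le_eq mult_left_le_one_le one_le_power)
  moreover have "E / (1 + E)\<^sup>2 \<le> inverse E"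
  proof -
    have "E / (1 + E)\<^sup>2 \<le> E / E\<^sup>2"
      using E by (intro divide_left_mono) (auto intro!: power_mono)
    then show ?thesis using E by (simp add: power2_eq_square field_simps)
  qed
  ultimately have "E / (1 + E)\<^sup>2 \<le> min E (inverse E)" by simp
  also have "min E (inverse E) \<le> exp (- (m * \<bar>s\<bar>))"
    by (auto simp: E_def abs_if exp_minus)
  finally have 1: "logistic m s * (1 - logistic m s) \<le> exp (- (m * \<bar>s\<bar>))"
    by (simp add: logistic_mult_eq E_def)
  have 2: "exp (- s) \<le> exp \<bar>s\<bar>" by simp
  have "exp (- s) * (logistic m s * (1 - logistic m s)) \<le> exp \<bar>s\<bar> * exp (- (m * \<bar>s\<bar>))"
    using logistic_bounds[of m s] by (intro mult_mono 1 2) auto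
  also have "\<dots> = exp (- ((m - 1) * \<bar>s\<bar>))"
    by (simp add: algebra_simps flip: exp_add)
  finally show ?thesis
    using mult_left_mono[OF _ assms] by (simp add: dirac_kernel_eq mult.assoc)
qed

lemma continuous_dirac_kernel: "continuous_on UNIV (dirac_kernel m)"
  unfolding dirac_kernel_def
  using DERIV_isCont[OF DERIV_logistic_kernel] by (simp add: continuous_on_eq_continuous_at)

lemma measurable_dirac_kernel [measurable]: "dirac_kernel m \<in> borel_measurable borel"
  by (rule borel_measurable_continuous_onI[OF continuous_dirac_kernel])

text \<open>Bounds uniform in \<open>m\<close> take the place of the exact mass: the lower one will
  be divided by, the upper one handles the remaining factors of a product.\<close>

lemma dirac_kernel_mass:
  assumes m: "m \<ge> 2"
  shows "integrable lborel (dirac_kernel m)"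
    and "integral\<^sup>L lborel (dirac_kernel m) \<le> 4"
    and "integral\<^sup>L lborel (dirac_kernel m) \<ge> 1 / (1 + exp 1)\<^sup>2"
proof -
  let ?g = "\<lambda>s. m * exp (- ((m - 1) * \<bar>s\<bar>))"
  have g: "integrable lborel ?g"
    using m by (intro integrable_mult_right integrable_exp_minus_abs) auto
  show i: "integrable lborel (dirac_kernel m)"
    using m by (intro Bochner_Integration.integrable_bound[OF g])
      (auto simp: dirac_kernel_nonneg dirac_kernel_le abs_mult)
  have "integral\<^sup>L lborel (dirac_kernel m) \<le> integral\<^sup>L lborel ?g"
    using m by (intro integral_mono i g dirac_kernel_le) auto
  also have "\<dots> \<le> m * (2 / (m - 1))"
    using m mult_left_mono[OF integrable_exp_minus_abs(2)[of "m - 1"], of m] by simp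
  also have "\<dots> \<le> 4" using m by (simp add: field_simps)
  finally show "integral\<^sup>L lborel (dirac_kernel m) \<le> 4" .
  let ?c = "1 / (1 + exp 1)\<^sup>2 :: real"
  \<comment> \<open>On this interval of length \<open>1/m\<close> the quantity \<open>E\<close> lies
    between 1 and \<open>exp 1\<close>, so the kernel is at least \<open>m * ?c\<close> and
    contributes \<open>?c\<close> to the mass.\<close>
  have low: "indicator {- (1/m)..0} s * (m * ?c) \<le> dirac_kernel m s" for s
  proof (cases "s \<in> {- (1/m)..0}")
    case True
    then have s: "s \<le> 0" "m * s \<ge> -1" using m by (auto simp: field_simps)
    define E where "E = exp (- (m * s))"
    have E: "1 \<le> E" "E \<le> exp 1" using s m by (auto simp: E_def mult_nonneg_nonpos)
    have "?c \<le> E / (1 + E)\<^sup>2"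
      using E by (intro frac_le power_mono) (auto intro!: zero_less_power)
    then have c: "?c \<le> logistic m s * (1 - logistic m s)" by (simp add: logistic_mult_eq E_def)
    have "1 * ?c \<le> exp (- s) * (logistic m s * (1 - logistic m s))"
      using s by (intro mult_mono c) auto
    then have "m * ?c \<le> m * (exp (- s) * (logistic m s * (1 - logistic m s)))"
      using m by (intro mult_left_mono) auto
    then show ?thesis using True by (simp add: dirac_kernel_eq mult.assoc)
  qed (use m in \<open>auto simp: dirac_kernel_nonneg\<close>)
  have "?c = (\<integral>s. indicator {- (1/m)..0} s * (m * ?c) \<partial>lborel)"
    using m by simp
  also have "\<dots> \<le> integral\<^sup>L lborel (dirac_kernel m)"
    by (intro integral_mono i low integrable_mult_left integrable_real_indicator) (auto simp: emeasure_lborel_Icc_eq)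
  finally show "integral\<^sup>L lborel (dirac_kernel m) \<ge> ?c" .
qed

text \<open>Part of the decay is spent on \<open>m |s| <= 2 e^(m |s| / 2)\<close>. The remaining
  rate \<open>m / 2 - 1\<close> gives a moment of order \<open>1 / m\<close>, and its positivity is
  the condition \<open>m > 2\<close>.\<close>

lemma dirac_kernel_first_moment:
  assumes m: "m > 2"
  shows "integrable lborel (\<lambda>s. \<bar>s\<bar> * dirac_kernel m s)"
    and "(\<integral>s. \<bar>s\<bar> * dirac_kernel m s \<partial>lborel) \<le> 8 / (m - 2)"
proof -
  let ?g = "\<lambda>s. 2 * exp (- ((m / 2 - 1) * \<bar>s\<bar>))"
  have g: "integrable lborel ?g"
    using m by (intro integrable_mult_right integrable_exp_minus_abs) auto
  have le: "\<bar>s\<bar> * dirac_kernel m s \<le> ?g s" for s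
  proof -
    have "m / 2 * \<bar>s\<bar> \<le> exp (m / 2 * \<bar>s\<bar>)"
      using exp_ge_add_one_self[of "m / 2 * \<bar>s\<bar>"] by linarith
    then have 1: "m * \<bar>s\<bar> \<le> 2 * exp (m / 2 * \<bar>s\<bar>)" by simp
    have "\<bar>s\<bar> * dirac_kernel m s \<le> \<bar>s\<bar> * (m * exp (- ((m - 1) * \<bar>s\<bar>)))"
      using m by (intro mult_left_mono dirac_kernel_le) auto
    also have "\<dots> = (m * \<bar>s\<bar>) * exp (- ((m - 1) * \<bar>s\<bar>))" by simp
    also have "\<dots> \<le> (2 * exp (m / 2 * \<bar>s\<bar>)) * exp (- ((m - 1) * \<bar>s\<bar>))"
      by (intro mult_right_mono 1) auto
    also have "\<dots> = 2 * (exp (m / 2 * \<bar>s\<bar>) * exp (- ((m - 1) * \<bar>s\<bar>)))" by simp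
    also have "exp (m / 2 * \<bar>s\<bar>) * exp (- ((m - 1) * \<bar>s\<bar>)) = exp (- ((m / 2 - 1) * \<bar>s\<bar>))"
      unfolding exp_add[symmetric] by (simp add: algebra_simps)
    finally show ?thesis .
  qed
  show i: "integrable lborel (\<lambda>s. \<bar>s\<bar> * dirac_kernel m s)"
    using m le by (intro Bochner_Integration.integrable_bound[OF g]) (auto simp: abs_mult dirac_kernel_nonneg)
  have "(\<integral>s. \<bar>s\<bar> * dirac_kernel m s \<partial>lborel) \<le> integral\<^sup>L lborel ?g"
    by (intro integral_mono i g le)
  also have "\<dots> \<le> 2 * (2 / (m / 2 - 1))"
    using m integrable_exp_minus_abs(2)[of "m / 2 - 1"] by simp
  also have "\<dots> = 8 / (m - 2)" using m by (simp add: field_simps)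
  finally show "(\<integral>s. \<bar>s\<bar> * dirac_kernel m s \<partial>lborel) \<le> 8 / (m - 2)" .
qed

definition dirac_prod :: "real \<Rightarrow> 'a::euclidean_space \<Rightarrow> real" where
  "dirac_prod m x = (\<Prod>b\<in>Basis. dirac_kernel m (x \<bullet> b))"

lemma dirac_prod_nonneg: "m \<ge> 0 \<Longrightarrow> dirac_prod m x \<ge> 0"
  unfolding dirac_prod_def by (intro prod_nonneg dirac_kernel_nonneg)

lemma has_integral_dirac_prod:
  assumes "m \<ge> 2"
  shows "((dirac_prod m :: 'a::euclidean_space \<Rightarrow> real) has_integral (integral\<^sup>L lborel (dirac_kernel m)) ^ DIM('a)) UNIV"
proof -
  have "integrable lborel (dirac_prod m :: 'a \<Rightarrow> real)"
    unfolding dirac_prod_def[abs_def] by (intro lborel_prod_kernel dirac_kernel_mass assms)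
  moreover have "integral\<^sup>L lborel (dirac_prod m :: 'a \<Rightarrow> real) = (integral\<^sup>L lborel (dirac_kernel m)) ^ DIM('a)"
    unfolding dirac_prod_def[abs_def]
    using lborel_prod_kernel(2)[of "\<lambda>_::'a. dirac_kernel m"] dirac_kernel_mass(1)[OF assms] by simp
  ultimately show ?thesis
    using has_integral_integral_lborel by metis
qed

lemma dirac_prod_first_moment:
  fixes c :: "'a::euclidean_space"
  assumes m: "m > 2" and c: "c \<in> Basis"
  shows "(\<lambda>x. \<bar>x \<bullet> c\<bar> * dirac_prod m x) integrable_on UNIV"
    and "integral UNIV (\<lambda>x. \<bar>x \<bullet> c\<bar> * dirac_prod m x) \<le> 4 ^ DIM('a) * (8 / (m - 2))"
proof -
  \<comment> \<open>The factor in direction \<open>c\<close> carries the moment; each of the others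
    has mass at most 4.\<close>
  define g where "g b s = (if b = c then \<bar>s\<bar> * dirac_kernel m s else dirac_kernel m s)" for b :: 'a and s :: real
  have gi: "integrable lborel (g b)" for b
    using dirac_kernel_mass(1)[of m] dirac_kernel_first_moment(1)[of m] m by (cases "b = c") (auto simp: g_def[abs_def])
  have eq: "\<bar>x \<bullet> c\<bar> * dirac_prod m x = (\<Prod>b\<in>Basis. g b (x \<bullet> b))" for x :: 'a
  proof -
    have "(\<Prod>b\<in>Basis - {c}. g b (x \<bullet> b)) = (\<Prod>b\<in>Basis - {c}. dirac_kernel m (x \<bullet> b))"
      by (intro prod.cong) (auto simp: g_def)
    then show ?thesis
      using c by (simp add: dirac_prod_def prod.remove[of Basis c] g_def)
  qed
  have i: "integrable lborel (\<lambda>x::'a. \<Prod>b\<in>Basis. g b (x \<bullet> b))"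
    by (intro lborel_prod_kernel gi)
  show "(\<lambda>x. \<bar>x \<bullet> c\<bar> * dirac_prod m x) integrable_on UNIV"
    unfolding eq by (rule integrable_on_lborel[OF i])
  have "integral UNIV (\<lambda>x. \<bar>x \<bullet> c\<bar> * dirac_prod m x) = (\<Prod>b\<in>(Basis :: 'a set). integral\<^sup>L lborel (g b))"
    unfolding eq integral_lborel[OF i] by (rule lborel_prod_kernel(2)[OF gi])
  also have "\<dots> = integral\<^sup>L lborel (g c) * (\<Prod>b\<in>Basis - {c}. integral\<^sup>L lborel (g b))"
    using c by (simp add: prod.remove[of Basis c])
  also have "\<dots> \<le> (8 / (m - 2)) * 4 ^ DIM('a)"
  proof (rule mult_mono)
    show "integral\<^sup>L lborel (g c) \<le> 8 / (m - 2)"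
      using dirac_kernel_first_moment(2)[OF m] by (simp add: g_def[abs_def])
    have "(\<Prod>b\<in>Basis - {c}. integral\<^sup>L lborel (g b)) \<le> (\<Prod>b\<in>Basis - {c}. 4)"
    proof (intro prod_mono conjI)
      fix b assume "b \<in> Basis - {c}"
      then have gb: "g b = dirac_kernel m" by (auto simp: g_def[abs_def])
      show "0 \<le> integral\<^sup>L lborel (g b)" "integral\<^sup>L lborel (g b) \<le> 4"
        unfolding gb using m dirac_kernel_mass(2)[of m]
        by (auto intro!: Bochner_Integration.integral_nonneg dirac_kernel_nonneg)
    qed
    also have "\<dots> \<le> 4 ^ DIM('a)"
      using c by (simp add: power_increasing)
    finally show "(\<Prod>b\<in>Basis - {c}. integral\<^sup>L lborel (g b)) \<le> 4 ^ DIM('a)" .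
    show "0 \<le> (\<Prod>b\<in>Basis - {c}. integral\<^sup>L lborel (g b))"
      using m by (intro prod_nonneg Bochner_Integration.integral_nonneg) (auto simp: g_def dirac_kernel_nonneg)
  qed (use m in auto)
  finally show "integral UNIV (\<lambda>x. \<bar>x \<bullet> c\<bar> * dirac_prod m x) \<le> 4 ^ DIM('a) * (8 / (m - 2))"
    by (simp add: mult.commute)
qed

section \<open>The Sobolev inequality\<close>

lemma Basis_pairI: "b \<in> Basis \<Longrightarrow> (b, 0) \<in> Basis" "b \<in> Basis \<Longrightarrow> (0, b) \<in> Basis"
  by (auto simp: Basis_prod_def)

text \<open>Near 0 continuity gives \<open>\<epsilon>\<close>; from distance \<open>d\<close> on,
  the crude bound \<open>2 B\<close> is at most \<open>(2 B / d) * norm x\<close>. Linear growth is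
  what first moments of a kernel can integrate.\<close>

lemma schwartz_deviation_bound:
  fixes f :: "real^'n \<Rightarrow> 'c::real_normed_vector"
  assumes f: "schwartz f" and "\<epsilon> > 0"
  obtains M where "M \<ge> 0" "\<And>x. norm (f x - f 0) \<le> \<epsilon> + M * (\<Sum>b\<in>Basis. \<bar>x \<bullet> b\<bar>)"
proof -
  obtain B where B: "B > 0" "\<And>x. (1 + norm x) ^ 0 * norm (f x) \<le> B"
    using schwartz_bound[OF f] by blast
  have "isCont f 0" using schwartz_continuous[OF f] by (simp add: continuous_on_eq_continuous_at)
  then obtain d where d: "d > 0" "\<And>x. dist x 0 < d \<Longrightarrow> dist (f x) (f 0) < \<epsilon>"
    using \<open>\<epsilon> > 0\<close> unfolding continuous_at_eps_delta by blast
  have "norm (f x - f 0) \<le> \<epsilon> + (2 * B / d) * (\<Sum>b\<in>Basis. \<bar>x \<bullet> b\<bar>)" for x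
  proof (cases "norm x < d")
    case True
    then have "norm (f x - f 0) < \<epsilon>" using d(2)[of x] by (simp add: dist_norm)
    moreover have "(2 * B / d) * (\<Sum>b\<in>Basis. \<bar>x \<bullet> b\<bar>) \<ge> 0"
      using B d by (intro mult_nonneg_nonneg sum_nonneg) auto
    ultimately show ?thesis by linarith
  next
    case False
    have "norm (f x - f 0) \<le> norm (f x) + norm (f 0)" by (rule norm_triangle_ineq4)
    also have "\<dots> \<le> 2 * B" using B(2)[of x] B(2)[of 0] by simp
    also have "2 * B = (2 * B / d) * d" using d by simp
    also have "\<dots> \<le> (2 * B / d) * (\<Sum>b\<in>Basis. \<bar>x \<bullet> b\<bar>)"
      using False norm_le_l1[of x] B d by (intro mult_left_mono) auto
    finally show ?thesis using \<open>\<epsilon> > 0\<close> by linarith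
  qed
  then show ?thesis
    using that[of "2 * B / d"] B d by simp
qed

context schwartz_module
begin

text \<open>The operator \<open>\<Prod>\<^sub>b (1 + X\<^bsub>(b,0)\<^esub>) = \<Prod>\<^sub>b (1 - \<partial>\<^sub>b)\<close> along a list of directions.\<close>

primrec one_plus_X :: "(real^'n) list \<Rightarrow> 'e \<Rightarrow> 'e" where
  "one_plus_X [] e = e"
| "one_plus_X (b # bs) e = one_plus_X bs e + X (b, 0) (one_plus_X bs e)"

lemma smooth_vec_one_plus_X:
  "smooth_vec e \<Longrightarrow> set bs \<subseteq> Basis \<Longrightarrow> smooth_vec (one_plus_X bs e)"
  by (induction bs) (auto intro!: smooth_vec_add smooth_vec_X Basis_pairI)

text \<open>Integration by parts in abstract form: by skew-adjointness \<open>1 + X (b, 0)\<close>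
  passes to the left slot as \<open>1 - X (b, 0)\<close>, which is \<open>1 + d/db\<close> on the
  kernel. As the directions are distinct, each factor is changed only once.\<close>

lemma inn_prod_kernel_one_plus_X:
  assumes m: "m \<ge> 2" and e: "smooth_vec e"
  shows "(\<And>b. poly (P b) 0 = 0) \<Longrightarrow> distinct bs \<Longrightarrow> set bs \<subseteq> Basis \<Longrightarrow>
    inn (emb (\<lambda>x. prod_kernel m P x *\<^sub>R 1)) (one_plus_X bs e) =
    inn (emb (\<lambda>x. prod_kernel m (\<lambda>b. if b \<in> set bs then P b + kernel_deriv m (P b) else P b) x *\<^sub>R 1)) e"
proof (induction bs arbitrary: P)
  case (Cons b bs)
  let ?D = "kernel_deriv m"
  let ?K = "\<lambda>x. prod_kernel m P x *\<^sub>R (1::'c)"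
  let ?P = "P(b := P b + ?D (P b))"
  have b: "b \<in> Basis" and bs: "set bs \<subseteq> Basis" "distinct bs" "b \<notin> set bs" using Cons.prems by auto
  have K: "schwartz ?K" by (rule schwartz_prod_logistic(1)[OF m Cons.prems(1)])
  have s: "smooth_vec (one_plus_X bs e)" by (rule smooth_vec_one_plus_X[OF e bs(1)])
  have X: "X (b, 0) (emb ?K) = - emb (dir_deriv ?K b)"
    by (simp add: X_emb K Basis_pairI b gen_transl emb_minus schwartz_dir_deriv)
  have sum: "emb ?K + emb (dir_deriv ?K b) = emb (\<lambda>x. prod_kernel m ?P x *\<^sub>R 1)"
  proof -
    have "emb ?K + emb (dir_deriv ?K b) = emb (\<lambda>x. ?K x + dir_deriv ?K b x)"
      by (simp add: emb_add K schwartz_dir_deriv b)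
    also have "(\<lambda>x. ?K x + dir_deriv ?K b x) = (\<lambda>x. prod_kernel m ?P x *\<^sub>R 1)"
      unfolding schwartz_prod_logistic(2)[OF m Cons.prems(1) b]
      by (simp only: prod_kernel_add[OF b] flip: scaleR_left_distrib)
    finally show ?thesis .
  qed
  have "inn (emb ?K) (one_plus_X (b # bs) e) = inn (emb ?K) (one_plus_X bs e) - inn (X (b, 0) (emb ?K)) (one_plus_X bs e)"
    using inn_X[OF smooth_vec_emb[OF K] s Basis_pairI(1)[OF b]] by (simp add: inn.add_right)
  also have "\<dots> = inn (emb (\<lambda>x. prod_kernel m ?P x *\<^sub>R 1)) (one_plus_X bs e)"
    by (simp add: X inn.add_left inn.minus_left flip: sum)
  also have "\<dots> = inn (emb (\<lambda>x. prod_kernel m (\<lambda>c. if c \<in> set bs then ?P c + ?D (?P c) else ?P c) x *\<^sub>R 1)) e"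
    by (rule Cons.IH) (use Cons.prems bs in \<open>auto simp: kernel_deriv_def\<close>)
  also have "(\<lambda>c. if c \<in> set bs then ?P c + ?D (?P c) else ?P c) =
      (\<lambda>c. if c \<in> set (b # bs) then P c + ?D (P c) else P c)"
    using bs by auto
  finally show ?case .
qed simp

lemma star_scaleR_1 [simp]: "star (r *\<^sub>R 1) = r *\<^sub>R 1"
  using bounded_linear.linear[OF bounded_linear_star] by (simp add: linear_cmul)

text \<open>What matters is that the bound is uniform in \<open>m\<close>. The squared kernel lies
  below the product of \<open>e^(-2 |x . b|)\<close>, and 2 is the rate at which
  \<open>integrable_exp_minus_abs\<close> bounds the integral by 1.\<close>

lemma norm_emb_prod_kernel_le:
  assumes m: "m \<ge> 2"
  shows "norm (emb (\<lambda>x::real^'n. prod_kernel m (\<lambda>_. [:0, 1:]) x *\<^sub>R 1)) \<le> 1"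
proof -
  let ?k = "\<lambda>x::real^'n. prod_kernel m (\<lambda>_. [:0, 1:]) x"
  let ?K = "\<lambda>x. ?k x *\<^sub>R (1::'c)"
  let ?G = "\<lambda>x::real^'n. \<Prod>b\<in>Basis. exp (- (2 * \<bar>x \<bullet> b\<bar>))"
  have K: "schwartz ?K" by (rule schwartz_prod_logistic(1)[OF m]) simp
  have le: "norm (star (?K x) * ?K x) \<le> ?G x" for x
  proof -
    have "norm (star (?K x) * ?K x) = \<bar>?k x\<bar> * \<bar>?k x\<bar>" by simp
    also have "\<dots> = (\<Prod>b\<in>Basis. \<bar>logistic_kernel m [:0, 1:] (x \<bullet> b)\<bar> * \<bar>logistic_kernel m [:0, 1:] (x \<bullet> b)\<bar>)"
      by (simp only: prod_kernel_def abs_prod prod.distrib)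
    also have "\<dots> \<le> (\<Prod>b\<in>Basis. exp (- \<bar>x \<bullet> b\<bar>) * exp (- \<bar>x \<bullet> b\<bar>))"
    proof (intro prod_mono conjI mult_mono)
      fix b
      have "\<bar>logistic_kernel m [:0, 1:] (x \<bullet> b)\<bar> = exp (- (x \<bullet> b)) * logistic m (x \<bullet> b)"
        using logistic_bounds[of m "x \<bullet> b"] by (simp add: logistic_kernel_def abs_mult)
      then show "\<bar>logistic_kernel m [:0, 1:] (x \<bullet> b)\<bar> \<le> exp (- \<bar>x \<bullet> b\<bar>)" "\<bar>logistic_kernel m [:0, 1:] (x \<bullet> b)\<bar> \<le> exp (- \<bar>x \<bullet> b\<bar>)"
        using exp_logistic_le[OF m, of "x \<bullet> b"] by auto
    qed auto
    also have "\<dots> = ?G x" by (simp flip: exp_add)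
    finally show ?thesis .
  qed
  have G: "integrable lborel ?G" "integral\<^sup>L lborel ?G \<le> 1"
  proof -
    have i: "integrable lborel (\<lambda>s::real. exp (- (2 * \<bar>s\<bar>)))" by (rule integrable_exp_minus_abs) simp
    show "integrable lborel ?G" by (rule lborel_prod_kernel(1)[OF i])
    have "integral\<^sup>L lborel ?G = (\<Prod>b\<in>(Basis::(real^'n) set). (\<integral>s. exp (- (2 * \<bar>s\<bar>)) \<partial>lborel))"
      by (rule lborel_prod_kernel(2)[OF i])
    also have "\<dots> \<le> 1"
      using integrable_exp_minus_abs(2)[of 2] by (intro prod_le_1) (auto intro!: Bochner_Integration.integral_nonneg)
    finally show "integral\<^sup>L lborel ?G \<le> 1" .
  qed
  have "norm (integral UNIV (\<lambda>x. star (?K x) * ?K x)) \<le> integral UNIV ?G"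
    by (rule integrable_continuous_bound(2)[OF schwartz_pairing(1)[OF K K] integrable_on_lborel[OF G(1)] le])
  then have "norm (inn (emb ?K) (emb ?K)) \<le> 1"
    using G(2) by (simp only: inn_emb[OF K K] integral_lborel[OF G(1)])
  then show ?thesis
    using norm_eq_inn[of "emb ?K"] by simp
qed

lemma dirac_prod_pairing:
  assumes m: "m \<ge> 2" and f: "schwartz f" and bs: "distinct bs" "set bs = Basis"
  shows "inn (emb (\<lambda>x. prod_kernel m (\<lambda>_. [:0, 1:]) x *\<^sub>R 1)) (one_plus_X bs (emb f)) =
      integral UNIV (\<lambda>x. dirac_prod m x *\<^sub>R f x)"
    and "(\<lambda>x. dirac_prod m x *\<^sub>R f x) integrable_on UNIV"
    and "continuous_on UNIV (\<lambda>x. dirac_prod m x *\<^sub>R f x)"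
proof -
  let ?P = "\<lambda>b::real^'n. if b \<in> set bs then [:0, 1:] + kernel_deriv m [:0, 1:] else [:0, 1:]"
  have k: "prod_kernel m ?P x = dirac_prod m x" for x :: "real^'n"
    unfolding prod_kernel_def dirac_prod_def dirac_kernel_def using bs(2)
    by (intro prod.cong) (auto simp: kernel_deriv_def pderiv_pCons)
  have "schwartz (\<lambda>x. prod_kernel m ?P x *\<^sub>R (1::'c))"
    by (rule schwartz_prod_logistic(1)[OF m]) (auto simp: kernel_deriv_def)
  then have K: "schwartz (\<lambda>x::real^'n. dirac_prod m x *\<^sub>R (1::'c))" by (simp only: k)
  have "inn (emb (\<lambda>x. prod_kernel m (\<lambda>_. [:0, 1:]) x *\<^sub>R 1)) (one_plus_X bs (emb f)) =
      inn (emb (\<lambda>x. prod_kernel m ?P x *\<^sub>R 1)) (emb f)"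
    by (rule inn_prod_kernel_one_plus_X[OF m smooth_vec_emb[OF f]]) (use bs in auto)
  then show "inn (emb (\<lambda>x. prod_kernel m (\<lambda>_. [:0, 1:]) x *\<^sub>R 1)) (one_plus_X bs (emb f)) =
      integral UNIV (\<lambda>x. dirac_prod m x *\<^sub>R f x)"
    unfolding k by (simp add: inn_emb K f)
  show "(\<lambda>x. dirac_prod m x *\<^sub>R f x) integrable_on UNIV"
    "continuous_on UNIV (\<lambda>x. dirac_prod m x *\<^sub>R f x)"
    using schwartz_pairing[OF K f] by simp_all
qed

text \<open>The pairing with the kernel is at most \<open>K\<close> times the norm on the right for
  every \<open>m > 2\<close>, and it differs from \<open>c * f 0\<close> by at most
  \<open>\<epsilon> * c\<close> plus first moments that vanish as \<open>m\<close> grows. Letting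
  \<open>m\<close> tend to infinity and then \<open>\<epsilon>\<close> to 0 leaves the constant
  \<open>K / \<kappa>\<close>.\<close>

lemma sobolev_at_0:
  assumes bs: "distinct bs" "set bs = (Basis :: (real^'n) set)"
  shows "\<exists>C\<ge>0. \<forall>f. schwartz f \<longrightarrow> norm (f 0) \<le> C * norm (one_plus_X bs (emb f))"
proof -
  let ?n = "DIM(real^'n)"
  obtain K where K: "K \<ge> 0" "\<And>d e. norm (inn d e) \<le> norm d * norm e * K"
    using inn.nonneg_bounded by blast
  \<comment> \<open>A lower bound for the mass of the product kernel that does not depend on
    \<open>m\<close>.\<close>
  define \<kappa> :: real where "\<kappa> = (1 / (1 + exp 1)\<^sup>2) ^ ?n"
  have \<kappa>: "\<kappa> > 0" unfolding \<kappa>_def by (intro zero_less_power divide_pos_pos) (auto simp: add_pos_pos)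
  have "norm (f 0) \<le> (K / \<kappa>) * norm (one_plus_X bs (emb f))" if f: "schwartz f" for f
  proof (rule field_le_epsilon)
    fix \<epsilon> :: real assume \<epsilon>: "\<epsilon> > 0"
    let ?R = "K * norm (one_plus_X bs (emb f))"
    obtain M where M: "M \<ge> 0" "\<And>x. norm (f x - f 0) \<le> \<epsilon> + M * (\<Sum>b\<in>Basis. \<bar>x \<bullet> b\<bar>)"
      using schwartz_deviation_bound[OF f \<epsilon>] by blast
    \<comment> \<open>Collects the moments: slope \<open>M\<close>, and one moment per coordinate,
      each at most \<open>4 ^ ?n * (8 / (m - 2))\<close>.\<close>
    define L where "L = M * (real ?n * 4 ^ ?n)"
    have L: "L \<ge> 0" using M(1) by (simp add: L_def)
    have main: "\<kappa> * (norm (f 0) - \<epsilon>) \<le> ?R + L * (8 / (m - 2))" if m: "m > 2" for m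
    proof -
      have m2: "m \<ge> 2" using m by simp
      define c where "c = (integral\<^sup>L lborel (dirac_kernel m)) ^ ?n"
      have c: "((dirac_prod m :: real^'n \<Rightarrow> real) has_integral c) UNIV"
        unfolding c_def by (rule has_integral_dirac_prod[OF m2])
      have c\<kappa>: "c \<ge> \<kappa>"
        unfolding c_def \<kappa>_def by (intro power_mono dirac_kernel_mass(3)[OF m2]) auto
      let ?I = "integral UNIV (\<lambda>x. dirac_prod m x *\<^sub>R f x)"
      have I: "norm ?I \<le> ?R"
      proof -
        have "norm ?I \<le> norm (emb (\<lambda>x::real^'n. prod_kernel m (\<lambda>_. [:0, 1:]) x *\<^sub>R 1)) * norm (one_plus_X bs (emb f)) * K"
          using K(2) by (simp flip: dirac_prod_pairing(1)[OF m2 f bs])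
        also have "\<dots> \<le> 1 * norm (one_plus_X bs (emb f)) * K"
          using norm_emb_prod_kernel_le[OF m2] K(1) by (intro mult_right_mono) auto
        finally show ?thesis by (simp add: mult.commute)
      qed
      have c0: "((\<lambda>x::real^'n. dirac_prod m x *\<^sub>R f 0) has_integral c *\<^sub>R f 0) UNIV"
        using has_integral_linear[OF c bounded_linear_scaleR_left[of "f 0"]] by (simp add: o_def)
      have diff: "((\<lambda>x. dirac_prod m x *\<^sub>R f x - dirac_prod m x *\<^sub>R f 0) has_integral (?I - c *\<^sub>R f 0)) UNIV"
        by (intro has_integral_diff integrable_integral dirac_prod_pairing(2)[OF m2 f bs] c0)
      have "((\<lambda>x::real^'n. \<epsilon> * dirac_prod m x + M * (\<Sum>b\<in>Basis. \<bar>x \<bullet> b\<bar> * dirac_prod m x)) has_integral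
          (\<epsilon> * c + M * (\<Sum>b\<in>(Basis::(real^'n) set). integral UNIV (\<lambda>x. \<bar>x \<bullet> b\<bar> * dirac_prod m x)))) UNIV"
        by (intro has_integral_add has_integral_mult_right c has_integral_sum integrable_integral dirac_prod_first_moment m) auto
      moreover have "norm (dirac_prod m x *\<^sub>R f x - dirac_prod m x *\<^sub>R f 0) \<le>
          \<epsilon> * dirac_prod m x + M * (\<Sum>b\<in>Basis. \<bar>x \<bullet> b\<bar> * dirac_prod m x)" for x
      proof -
        have "norm (dirac_prod m x *\<^sub>R f x - dirac_prod m x *\<^sub>R f 0) = dirac_prod m x * norm (f x - f 0)"
          using dirac_prod_nonneg[of m x] m by (simp flip: scaleR_diff_right)
        also have "\<dots> \<le> dirac_prod m x * (\<epsilon> + M * (\<Sum>b\<in>Basis. \<bar>x \<bullet> b\<bar>))"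
          using dirac_prod_nonneg[of m x] m M(2) by (intro mult_left_mono) auto
        also have "\<dots> = \<epsilon> * dirac_prod m x + M * (\<Sum>b\<in>Basis. \<bar>x \<bullet> b\<bar> * dirac_prod m x)"
          by (simp add: algebra_simps sum_distrib_left)
        finally show ?thesis .
      qed
      ultimately have "norm (?I - c *\<^sub>R f 0) \<le>
          \<epsilon> * c + M * (\<Sum>b\<in>(Basis::(real^'n) set). integral UNIV (\<lambda>x. \<bar>x \<bullet> b\<bar> * dirac_prod m x))"
        using Henstock_Kurzweil_Integration.integral_norm_bound_integral[of
            "\<lambda>x. dirac_prod m x *\<^sub>R f x - dirac_prod m x *\<^sub>R f 0" UNIV
            "\<lambda>x. \<epsilon> * dirac_prod m x + M * (\<Sum>b\<in>Basis. \<bar>x \<bullet> b\<bar> * dirac_prod m x)"] diff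
        by (simp only: integral_unique has_integral_integrable)
      also have "\<dots> \<le> \<epsilon> * c + M * (\<Sum>b\<in>(Basis::(real^'n) set). 4 ^ ?n * (8 / (m - 2)))"
        using M(1) by (intro add_left_mono mult_left_mono sum_mono dirac_prod_first_moment m) auto
      also have "\<dots> = \<epsilon> * c + L * (8 / (m - 2))"
        by (simp add: L_def)
      finally have 1: "norm (?I - c *\<^sub>R f 0) \<le> \<epsilon> * c + L * (8 / (m - 2))" .
      have "norm (c *\<^sub>R f 0) \<le> norm ?I + norm (?I - c *\<^sub>R f 0)"
        by (metis norm_triangle_sub norm_minus_commute)
      moreover have "norm (c *\<^sub>R f 0) = c * norm (f 0)" using c\<kappa> \<kappa> by simp
      ultimately have "c * norm (f 0) \<le> norm ?I + norm (?I - c *\<^sub>R f 0)" by (simp only:)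
      then have "c * norm (f 0) - \<epsilon> * c \<le> ?R + L * (8 / (m - 2))" using 1 I by linarith
      then have 2: "c * (norm (f 0) - \<epsilon>) \<le> ?R + L * (8 / (m - 2))"
        by (simp only: right_diff_distrib mult.commute[of \<epsilon>])
      \<comment> \<open>The mass \<open>c\<close> may be lowered to \<open>\<kappa>\<close> only in
        front of a nonnegative factor; in the other case the left side is at most 0.\<close>
      show ?thesis
      proof (cases "norm (f 0) \<ge> \<epsilon>")
        case True
        then have "\<kappa> * (norm (f 0) - \<epsilon>) \<le> c * (norm (f 0) - \<epsilon>)"
          using c\<kappa> by (intro mult_right_mono) auto
        with 2 show ?thesis by linarith
      next
        case False
        then have "\<kappa> * (norm (f 0) - \<epsilon>) \<le> 0"
          using \<kappa> by (intro mult_nonneg_nonpos) auto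
        also have "0 \<le> ?R + L * (8 / (m - 2))"
          using K(1) L m by (intro add_nonneg_nonneg mult_nonneg_nonneg) auto
        finally show ?thesis .
      qed
    qed
    have "\<kappa> * (norm (f 0) - \<epsilon>) \<le> ?R"
    proof (rule field_le_epsilon)
      fix \<eta> :: real assume \<eta>: "\<eta> > 0"
      \<comment> \<open>Chosen to make \<open>8 / (m - 2)\<close> equal to
        \<open>\<eta> / (L + 1)\<close>; the added 1 covers \<open>L = 0\<close>.\<close>
      define m where "m = 2 + 8 * (L + 1) / \<eta>"
      have m: "m > 2" using \<eta> L by (simp add: m_def add_nonneg_pos)
      define l where "l = L + 1"
      have l: "l > 0" using L by (simp add: l_def)
      have "8 / (m - 2) = \<eta> / (L + 1)"
        unfolding m_def l_def[symmetric] using \<eta> l by (simp add: field_simps)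
      then have "L * (8 / (m - 2)) = \<eta> * (L / (L + 1))" by simp
      also have "\<dots> \<le> \<eta> * 1" using \<eta> L by (intro mult_left_mono) (auto simp: divide_le_eq)
      finally show "\<kappa> * (norm (f 0) - \<epsilon>) \<le> ?R + \<eta>" using main[OF m] by simp
    qed
    then have "norm (f 0) - \<epsilon> \<le> ?R / \<kappa>" using \<kappa> by (simp add: pos_le_divide_eq mult.commute)
    then show "norm (f 0) \<le> (K / \<kappa>) * norm (one_plus_X bs (emb f)) + \<epsilon>" by simp
  qed
  then show ?thesis
    using K(1) \<kappa> by (intro exI[of _ "K / \<kappa>"]) auto
qed

text \<open>The symplectic form vanishes on pairs of pure translations, so these commute. This
  carries the estimate from the origin to every point.\<close>

lemma one_plus_X_transl:
  assumes "smooth_vec e"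
  shows "set bs \<subseteq> Basis \<Longrightarrow> one_plus_X bs (U (a, 0) e) = U (a, 0) (one_plus_X bs e)"
proof (induction bs)
  case (Cons b bs)
  then have s: "smooth_vec (one_plus_X bs e)" by (intro smooth_vec_one_plus_X assms) auto
  have "U (t *\<^sub>R (b, 0)) (U (a, 0) d) = U (a, 0) (U (t *\<^sub>R (b, 0)) d)" for t d
    using U_commute[of "t *\<^sub>R (b, 0)" "(a, 0)" d] by (simp add: symp_def)
  then have "X (b, 0) (U (a, 0) (one_plus_X bs e)) = U (a, 0) (X (b, 0) (one_plus_X bs e))"
    using bounded_linear.has_vector_derivative[OF blinfun.bounded_linear_right
        X_has_vector_derivative[OF s, of "(b, 0)"], of "U (a, 0)"] Cons.prems
    by (intro X_eqI) (auto simp: Basis_pairI)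
  then show ?case using Cons by (simp add: blinfun.add_right)
qed simp

lemma sobolev:
  assumes bs: "distinct bs" "set bs = (Basis :: (real^'n) set)"
  obtains C where "C \<ge> 0" "\<And>f x. schwartz f \<Longrightarrow> norm (f x) \<le> C * norm (one_plus_X bs (emb f))"
proof -
  obtain C where C: "C \<ge> 0" "\<And>f. schwartz f \<Longrightarrow> norm (f 0) \<le> C * norm (one_plus_X bs (emb f))"
    using sobolev_at_0[OF bs] by blast
  have "norm (f x) \<le> C * norm (one_plus_X bs (emb f))" if f: "schwartz f" for f x
  proof -
    have "norm (Ushift cscale (- x) 0 f 0) \<le> C * norm (one_plus_X bs (emb (Ushift cscale (- x) 0 f)))"
      by (rule C(2)[OF schwartz_Ushift[OF f]])
    also have "emb (Ushift cscale (- x) 0 f) = U (- x, 0) (emb f)"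
      by (simp add: U_emb f)
    also have "one_plus_X bs (U (- x, 0) (emb f)) = U (- x, 0) (one_plus_X bs (emb f))"
      using bs by (intro one_plus_X_transl smooth_vec_emb f) auto
    finally show ?thesis by (simp add: Ushift_def)
  qed
  with C(1) show ?thesis by (rule that)
qed

end

section \<open>Smooth vectors are Schwartz functions\<close>

lemma iter_pd_diff:
  assumes f: "schwartz f" and g: "schwartz g"
  shows "set vs \<subseteq> Basis \<Longrightarrow> iter_pd vs (\<lambda>x. f x - g x) = (\<lambda>x. iter_pd vs f x - iter_pd vs g x)"
proof (induction vs)
  case (Cons v vs)
  then have v: "v \<in> Basis" and vs: "set vs \<subseteq> Basis" by auto
  have "dir_deriv (\<lambda>x. iter_pd vs f x - iter_pd vs g x) v x = dir_deriv (iter_pd vs f) v x - dir_deriv (iter_pd vs g) v x" for x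
    unfolding dir_deriv_def[of "\<lambda>x. iter_pd vs f x - iter_pd vs g x"]
    by (intro vector_derivative_at has_vector_derivative_diff schwartz_has_vector_derivative_0
        schwartz_iter_pd f g v vs)
  then have "dir_deriv (\<lambda>x. iter_pd vs f x - iter_pd vs g x) v =
      (\<lambda>x. dir_deriv (iter_pd vs f) v x - dir_deriv (iter_pd vs g) v x)" by (rule ext)
  then show ?case using Cons.IH[OF vs] by simp
qed simp

lemma schwartz_zero: "schwartz (\<lambda>x::real^'n. 0::'c::real_normed_vector)"
  by (rule schwartz_coinduct[where Q = "\<lambda>_. True" and T = "\<lambda>_ _. 0"]) auto

lemma schwartz_sum:
  "finite I \<Longrightarrow> (\<And>i. i \<in> I \<Longrightarrow> schwartz (f i)) \<Longrightarrow> schwartz (\<lambda>x. \<Sum>i\<in>I. f i x)"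
  by (induction I rule: finite_induct) (auto simp: schwartz_zero schwartz_add)

text \<open>The weight \<open>1 + x . x\<close> replaces \<open>1 + norm x\<close> because
  multiplication by it is a polynomial in the generators \<open>X (0, b)\<close>.\<close>

lemma weight_le: "(1 + norm x) ^ k \<le> 2 ^ k * (1 + x \<bullet> x) ^ k"
  for x :: "'a::real_inner"
proof -
  have "norm x \<le> 1 + (norm x)\<^sup>2"
  proof (cases "norm x \<le> 1")
    case False
    then show ?thesis using mult_left_mono[of 1 "norm x" "norm x"] by (simp add: power2_eq_square)
  qed (simp add: add_increasing2)
  then have "1 + norm x \<le> 2 + x \<bullet> x"
    unfolding power2_norm_eq_inner by linarith
  also have "\<dots> \<le> 2 * (1 + x \<bullet> x)" by simp
  finally have "1 + norm x \<le> 2 * (1 + x \<bullet> x)" .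
  then have "(1 + norm x) ^ k \<le> (2 * (1 + x \<bullet> x)) ^ k"
    by (intro power_mono) auto
  then show ?thesis unfolding power_mult_distrib .
qed

text \<open>Completeness of the Schwartz space. Lists of directions serve as codes:
  \<open>G vs\<close> is the limit of the derivatives along \<open>vs\<close>, and uniform
  convergence of the next derivatives allows limit and derivative to be exchanged on each
  line.\<close>

lemma schwartz_limit:
  fixes f :: "nat \<Rightarrow> real^'n \<Rightarrow> 'c::banach"
  assumes f: "\<And>k. schwartz (f k)"
    and Cauchy: "\<And>vs k \<epsilon>. set vs \<subseteq> Basis \<Longrightarrow> \<epsilon> > 0 \<Longrightarrow>
      \<exists>N. \<forall>m\<ge>N. \<forall>n\<ge>N. \<forall>x. (1 + norm x) ^ k * norm (iter_pd vs (f m) x - iter_pd vs (f n) x) \<le> \<epsilon>"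
  obtains g where "schwartz g"
    "\<And>k \<epsilon>. \<epsilon> > 0 \<Longrightarrow> \<exists>N. \<forall>n\<ge>N. \<forall>x. (1 + norm x) ^ k * norm (f n x - g x) \<le> \<epsilon>"
proof -
  define G where "G vs x = lim (\<lambda>n. iter_pd vs (f n) x)" for vs x
  have conv: "(\<lambda>n. iter_pd vs (f n) x) \<longlonglongrightarrow> G vs x" if vs: "set vs \<subseteq> Basis" for vs x
  proof -
    have "Cauchy (\<lambda>n. iter_pd vs (f n) x)"
    proof (rule metric_CauchyI)
      fix e :: real assume "e > 0"
      then obtain N where N: "\<forall>m\<ge>N. \<forall>n\<ge>N. \<forall>x. (1 + norm x) ^ 0 * norm (iter_pd vs (f m) x - iter_pd vs (f n) x) \<le> e / 2"
        using Cauchy[OF vs, of "e / 2" 0] by auto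
      have "dist (iter_pd vs (f m) x) (iter_pd vs (f n) x) < e" if "m \<ge> N" "n \<ge> N" for m n
      proof -
        have "norm (iter_pd vs (f m) x - iter_pd vs (f n) x) \<le> e / 2"
          using N that by simp
        then show ?thesis using \<open>e > 0\<close> by (simp add: dist_norm)
      qed
      then show "\<exists>M. \<forall>m\<ge>M. \<forall>n\<ge>M. dist (iter_pd vs (f m) x) (iter_pd vs (f n) x) < e"
        by blast
    qed
    then show ?thesis
      unfolding G_def using Cauchy_convergent_iff convergent_LIMSEQ_iff by blast
  qed
  have unif: "\<exists>N. \<forall>n\<ge>N. \<forall>x. (1 + norm x) ^ k * norm (iter_pd vs (f n) x - G vs x) \<le> \<epsilon>"
    if vs: "set vs \<subseteq> Basis" and \<epsilon>: "\<epsilon> > 0" for vs k \<epsilon>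
  proof -
    obtain N where N: "\<And>m n x. m \<ge> N \<Longrightarrow> n \<ge> N \<Longrightarrow>
        (1 + norm x) ^ k * norm (iter_pd vs (f n) x - iter_pd vs (f m) x) \<le> \<epsilon>"
      using Cauchy[OF vs \<epsilon>] by blast
    have "(1 + norm x) ^ k * norm (iter_pd vs (f n) x - G vs x) \<le> \<epsilon>" if n: "n \<ge> N" for n x
    proof (rule tendsto_upperbound)
      show "(\<lambda>m. (1 + norm x) ^ k * norm (iter_pd vs (f n) x - iter_pd vs (f m) x)) \<longlonglongrightarrow>
          (1 + norm x) ^ k * norm (iter_pd vs (f n) x - G vs x)"
        by (intro tendsto_intros conv vs)
      show "\<forall>\<^sub>F m in sequentially. (1 + norm x) ^ k * norm (iter_pd vs (f n) x - iter_pd vs (f m) x) \<le> \<epsilon>"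
        using N n eventually_sequentially by blast
    qed simp
    then show ?thesis by blast
  qed
  have "schwartz (G [])"
  proof (rule schwartz_coinduct[where Q = "\<lambda>vs. set vs \<subseteq> Basis"])
    fix vs :: "(real^'n) list" assume vs: "set vs \<subseteq> Basis"
    have "uniform_limit UNIV (\<lambda>n. iter_pd vs (f n)) (G vs) sequentially"
    proof (rule uniform_limitI)
      fix e :: real assume "e > 0"
      then obtain N where N: "\<And>n x. n \<ge> N \<Longrightarrow> (1 + norm x) ^ 0 * norm (iter_pd vs (f n) x - G vs x) \<le> e / 2"
        using unif[OF vs, of "e / 2" 0] by auto
      have "dist (iter_pd vs (f n) x) (G vs x) < e" if "n \<ge> N" for n x
        using N[OF that, of x] \<open>e > 0\<close> by (simp add: dist_norm)
      then show "\<forall>\<^sub>F n in sequentially. \<forall>x\<in>UNIV. dist (iter_pd vs (f n) x) (G vs x) < e"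
        unfolding eventually_sequentially by blast
    qed
    then show "continuous_on UNIV (G vs)"
      by (rule uniform_limit_theorem[rotated])
        (auto intro!: always_eventually schwartz_continuous schwartz_iter_pd f vs)
  next
    fix vs :: "(real^'n) list" and b :: "real^'n" assume vs: "set vs \<subseteq> Basis" and b: "b \<in> Basis"
    have bvs: "set (b # vs) \<subseteq> Basis" using vs b by simp
    have "((\<lambda>t. G vs (x + t *\<^sub>R b)) has_vector_derivative G (b # vs) x) (at 0)" for x
    proof -
      let ?u = "\<lambda>n t. iter_pd vs (f n) (x + t *\<^sub>R b)"
      have "\<exists>v. \<forall>t\<in>UNIV. (\<lambda>n. ?u n t) \<longlonglongrightarrow> v t \<and> (v has_derivative (\<lambda>h. h *\<^sub>R G (b # vs) (x + t *\<^sub>R b))) (at t within UNIV)"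
      proof (rule has_derivative_sequence)
        show "(?u n has_derivative (\<lambda>h. h *\<^sub>R iter_pd (b # vs) (f n) (x + t *\<^sub>R b))) (at t within UNIV)" for n t
          using schwartz_has_vector_derivative[OF schwartz_iter_pd[OF f vs] b, of n x t]
          by (simp add: has_vector_derivative_def)
        show "\<forall>\<^sub>F n in sequentially. \<forall>t\<in>UNIV. \<forall>h. norm (h *\<^sub>R iter_pd (b # vs) (f n) (x + t *\<^sub>R b) -
            h *\<^sub>R G (b # vs) (x + t *\<^sub>R b)) \<le> e * norm h" if e: "e > 0" for e
        proof -
          obtain N where N: "\<And>n x. n \<ge> N \<Longrightarrow> (1 + norm x) ^ 0 * norm (iter_pd (b # vs) (f n) x - G (b # vs) x) \<le> e"
            using unif[OF bvs e, of 0] by blast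
          have "norm (h *\<^sub>R iter_pd (b # vs) (f n) y - h *\<^sub>R G (b # vs) y) \<le> e * norm h" if "n \<ge> N" for n h y
          proof -
            have "norm (h *\<^sub>R iter_pd (b # vs) (f n) y - h *\<^sub>R G (b # vs) y) =
                \<bar>h\<bar> * norm (iter_pd (b # vs) (f n) y - G (b # vs) y)"
              by (simp only: norm_scaleR flip: scaleR_diff_right)
            also have "\<dots> \<le> \<bar>h\<bar> * e"
              using N[OF that, of y] by (intro mult_left_mono) (simp_all del: iter_pd.simps)
            finally show ?thesis by (simp add: mult.commute)
          qed
          then show ?thesis unfolding eventually_sequentially by blast
        qed
        show "(\<lambda>n. ?u n 0) \<longlonglongrightarrow> G vs (x + 0 *\<^sub>R b)" by (rule conv[OF vs])
      qed auto
      then obtain v where v: "\<And>t. (\<lambda>n. ?u n t) \<longlonglongrightarrow> v t"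
        "\<And>t. (v has_derivative (\<lambda>h. h *\<^sub>R G (b # vs) (x + t *\<^sub>R b))) (at t)" by auto
      have "v t = G vs (x + t *\<^sub>R b)" for t
        using LIMSEQ_unique[OF v(1) conv[OF vs]] by simp
      then have "v = (\<lambda>t. G vs (x + t *\<^sub>R b))" by (rule ext)
      then show ?thesis using v(2)[of 0] by (simp add: has_vector_derivative_def)
    qed
    then show "\<exists>vs'. set vs' \<subseteq> Basis \<and>
        (\<forall>x. ((\<lambda>t. G vs (x + t *\<^sub>R b)) has_vector_derivative G vs' x) (at 0))"
      using bvs by blast
  next
    fix vs :: "(real^'n) list" and k assume vs: "set vs \<subseteq> Basis"
    obtain N where N: "\<And>n x. n \<ge> N \<Longrightarrow> (1 + norm x) ^ k * norm (iter_pd vs (f n) x - G vs x) \<le> 1"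
      using unif[OF vs, of 1 k] by auto
    obtain B where B: "\<And>x. (1 + norm x) ^ k * norm (iter_pd vs (f N) x) \<le> B"
      using schwartz_bound[OF schwartz_iter_pd[OF f vs]] by blast
    have "(1 + norm x) ^ k * norm (G vs x) \<le> B + 1" for x
    proof -
      have "norm (G vs x) \<le> norm (iter_pd vs (f N) x) + norm (iter_pd vs (f N) x - G vs x)"
        by (metis norm_triangle_sub norm_minus_commute)
      then have "(1 + norm x) ^ k * norm (G vs x) \<le>
          (1 + norm x) ^ k * (norm (iter_pd vs (f N) x) + norm (iter_pd vs (f N) x - G vs x))"
        by (intro mult_left_mono) auto
      also have "\<dots> \<le> B + 1"
        unfolding distrib_left by (intro add_mono B N) simp
      finally show ?thesis .
    qed
    then show "\<exists>B. \<forall>x. (1 + norm x) ^ k * norm (G vs x) \<le> B" by blast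
  qed simp
  moreover have "\<exists>N. \<forall>n\<ge>N. \<forall>x. (1 + norm x) ^ k * norm (f n x - G [] x) \<le> \<epsilon>" if "\<epsilon> > 0" for k \<epsilon>
    using unif[of "[]", OF _ that] by simp
  ultimately show ?thesis by (rule that)
qed

section \<open>Families tending to 0 under every word of generators\<close>

context schwartz_module
begin

lemma emb_zero: "emb (\<lambda>x. 0) = 0"
  using emb_scaleR[OF schwartz_zero, of 0] by simp

lemma emb_sum:
  "finite I \<Longrightarrow> (\<And>i. i \<in> I \<Longrightarrow> schwartz (f i)) \<Longrightarrow> emb (\<lambda>x. \<Sum>i\<in>I. f i x) = (\<Sum>i\<in>I. emb (f i))"
  by (induction I rule: finite_induct) (auto simp: emb_zero emb_add schwartz_sum)

text \<open>The filter is left general to admit both the sequence of approximation errors and,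
  indexed by pairs, the differences of its members.\<close>

definition null_fam :: "'i filter \<Rightarrow> ('i \<Rightarrow> 'e) \<Rightarrow> bool" where
  "null_fam F e \<longleftrightarrow> (\<forall>i. smooth_vec (e i)) \<and>
     (\<forall>vs. set vs \<subseteq> Basis \<longrightarrow> ((\<lambda>i. Xw vs (e i)) \<longlongrightarrow> 0) F)"

lemma null_fam_X:
  assumes "null_fam F e" "v \<in> Basis"
  shows "null_fam F (\<lambda>i. X v (e i))"
proof -
  have "Xw vs (X v d) = Xw (vs @ [v]) d" for vs d by (simp add: Xw_append)
  then show ?thesis
    using assms unfolding null_fam_def by (simp add: smooth_vec_X)
qed

lemma null_fam_diff:
  assumes "null_fam F d" "null_fam F e"
  shows "null_fam F (\<lambda>i. d i - e i)"
  unfolding null_fam_def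
proof (intro conjI allI impI)
  have s: "smooth_vec (d i)" "smooth_vec (e i)" for i
    using assms unfolding null_fam_def by auto
  show "smooth_vec (d i - e i)" for i by (rule smooth_vec_diff[OF s])
  fix vs :: "((real^'n) \<times> (real^'n)) list" assume vs: "set vs \<subseteq> Basis"
  then have "((\<lambda>i. Xw vs (d i)) \<longlongrightarrow> 0) F" "((\<lambda>i. Xw vs (e i)) \<longlongrightarrow> 0) F"
    using assms unfolding null_fam_def by auto
  from tendsto_diff[OF this] show "((\<lambda>i. Xw vs (d i - e i)) \<longlongrightarrow> 0) F"
    by (simp add: Xw_diff[OF s vs])
qed

lemma null_fam_0: "null_fam F (\<lambda>i. 0)"
proof -
  have "Xw vs 0 = 0" for vs by (induction vs) auto
  then show ?thesis unfolding null_fam_def by (simp add: smooth_vec_0)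
qed

lemma null_fam_minus: "null_fam F e \<Longrightarrow> null_fam F (\<lambda>i. - e i)"
  using null_fam_diff[OF null_fam_0, of F e] by simp

lemma null_fam_add: "null_fam F d \<Longrightarrow> null_fam F e \<Longrightarrow> null_fam F (\<lambda>i. d i + e i)"
  using null_fam_diff[OF _ null_fam_minus, of F d e] by simp

lemma null_fam_sum: "finite J \<Longrightarrow> (\<And>j. j \<in> J \<Longrightarrow> null_fam F (e j)) \<Longrightarrow> null_fam F (\<lambda>i. \<Sum>j\<in>J. e j i)"
  by (induction J rule: finite_induct) (auto simp: null_fam_0 null_fam_add)

lemma null_fam_one_plus_X:
  "null_fam F e \<Longrightarrow> set bs \<subseteq> Basis \<Longrightarrow> null_fam F (\<lambda>i. one_plus_X bs (e i))"
  by (induction bs) (auto intro!: null_fam_add null_fam_X Basis_pairI)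

text \<open>Null families are stable under the generators, so \<open>one_plus_X\<close> may be
  applied to them; the Sobolev inequality then converts smallness in \<open>E_n\<close> into uniform
  smallness.\<close>

lemma null_fam_uniform:
  assumes \<phi>: "\<And>i. schwartz (\<phi> i)" and null: "null_fam F (\<lambda>i. emb (\<phi> i))" and \<epsilon>: "\<epsilon> > 0"
  shows "\<forall>\<^sub>F i in F. \<forall>x. norm (\<phi> i x) \<le> \<epsilon>"
proof -
  obtain bs where bs: "distinct bs" "set bs = (Basis :: (real^'n) set)"
    using finite_distinct_list[OF finite_Basis] by blast
  obtain C where C: "C \<ge> 0" "\<And>f x. schwartz f \<Longrightarrow> norm (f x) \<le> C * norm (one_plus_X bs (emb f))"
    using sobolev[OF bs] by metis
  have "null_fam F (\<lambda>i. one_plus_X bs (emb (\<phi> i)))"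
    using bs by (intro null_fam_one_plus_X null) auto
  then have "((\<lambda>i. Xw [] (one_plus_X bs (emb (\<phi> i)))) \<longlongrightarrow> 0) F"
    unfolding null_fam_def by (metis empty_subsetI list.set(1))
  then have "\<forall>\<^sub>F i in F. dist (one_plus_X bs (emb (\<phi> i))) 0 < \<epsilon> / (C + 1)"
    using \<epsilon> C(1) by (intro tendstoD) auto
  then show ?thesis
  proof (rule eventually_mono, intro allI)
    fix i x assume "dist (one_plus_X bs (emb (\<phi> i))) 0 < \<epsilon> / (C + 1)"
    then have "norm (one_plus_X bs (emb (\<phi> i))) \<le> \<epsilon> / (C + 1)" by simp
    have "norm (\<phi> i x) \<le> C * norm (one_plus_X bs (emb (\<phi> i)))" by (rule C(2)[OF \<phi>])
    also have "\<dots> \<le> (C + 1) * (\<epsilon> / (C + 1))"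
      using C(1) \<open>norm (one_plus_X bs (emb (\<phi> i))) \<le> \<epsilon> / (C + 1)\<close> by (intro mult_mono) auto
    finally show "norm (\<phi> i x) \<le> \<epsilon>" using C(1) by simp
  qed
qed

lemma null_fam_iter_pd:
  assumes \<phi>: "\<And>i. schwartz (\<phi> i)" and null: "null_fam F (\<lambda>i. emb (\<phi> i))"
  shows "set vs \<subseteq> Basis \<Longrightarrow> null_fam F (\<lambda>i. emb (iter_pd vs (\<phi> i)))"
proof (induction vs)
  case (Cons v vs)
  have "emb (dir_deriv (iter_pd vs (\<phi> i)) v) = - X (v, 0) (emb (iter_pd vs (\<phi> i)))" for i
    using Cons.prems
    by (simp add: X_emb schwartz_iter_pd \<phi> Basis_pairI gen_transl emb_minus schwartz_dir_deriv)
  then show ?case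
    using Cons by (simp add: null_fam_minus null_fam_X Basis_pairI)
qed (use null in simp)

text \<open>The square of \<open>X (0, b)\<close> is multiplication by \<open>- (x . b)^2\<close>,
  and these squares add up to \<open>- (x . x)\<close>.\<close>

lemma weight_mult:
  assumes f: "schwartz f"
  shows "schwartz (\<lambda>x. (1 + x \<bullet> x) *\<^sub>R f x)"
    and "emb (\<lambda>x. (1 + x \<bullet> x) *\<^sub>R f x) = emb f - (\<Sum>b\<in>Basis. X (0, b) (X (0, b) (emb f)))"
proof -
  let ?S = "\<lambda>x. \<Sum>b\<in>Basis. gen (0, b) (gen (0, b) f) x"
  have g: "schwartz (gen (0, b) (gen (0, b) f))" if "b \<in> Basis" for b
    using that by (intro schwartz_gen f Basis_pairI)
  have eq: "(\<lambda>x. (1 + x \<bullet> x) *\<^sub>R f x) = (\<lambda>x. f x - ?S x)"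
  proof
    fix x :: "real^'n"
    have "?S x = (\<Sum>b\<in>Basis. (- ((x \<bullet> b) * (x \<bullet> b))) *\<^sub>R f x)"
    proof (rule sum.cong[OF refl])
      fix b :: "real^'n"
      have "\<i> * complex_of_real (b \<bullet> x) * (\<i> * complex_of_real (b \<bullet> x)) = complex_of_real (- ((x \<bullet> b) * (x \<bullet> b)))"
        by (simp add: inner_commute algebra_simps)
      then show "gen (0, b) (gen (0, b) f) x = (- ((x \<bullet> b) * (x \<bullet> b))) *\<^sub>R f x"
        unfolding gen_coord cscale_simps(2) by (simp only: cscale_simps(1))
    qed
    also have "\<dots> = (\<Sum>b\<in>Basis. - ((x \<bullet> b) * (x \<bullet> b))) *\<^sub>R f x"
      by (rule scaleR_left.sum[symmetric])
    also have "\<dots> = (- (x \<bullet> x)) *\<^sub>R f x"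
      by (simp add: euclidean_inner[of x x] sum_negf)
    finally show "(1 + x \<bullet> x) *\<^sub>R f x = f x - ?S x"
      by (simp add: scaleR_left_distrib)
  qed
  show "schwartz (\<lambda>x. (1 + x \<bullet> x) *\<^sub>R f x)"
    unfolding eq by (intro schwartz_diff schwartz_sum f g finite_Basis)
  have "emb (\<lambda>x. f x - ?S x) = emb f - (\<Sum>b\<in>Basis. emb (gen (0, b) (gen (0, b) f)))"
    by (simp add: emb_diff emb_sum schwartz_sum f g)
  also have "\<dots> = emb f - (\<Sum>b\<in>Basis. X (0, b) (X (0, b) (emb f)))"
    by (simp add: X_emb f schwartz_gen Basis_pairI)
  finally show "emb (\<lambda>x. (1 + x \<bullet> x) *\<^sub>R f x) = emb f - (\<Sum>b\<in>Basis. X (0, b) (X (0, b) (emb f)))"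
    unfolding eq .
qed

lemma null_fam_weight:
  assumes \<phi>: "\<And>i. schwartz (\<phi> i)" and null: "null_fam F (\<lambda>i. emb (\<phi> i))"
  shows "(\<forall>i. schwartz (\<lambda>x. (1 + x \<bullet> x) ^ k *\<^sub>R \<phi> i x)) \<and>
    null_fam F (\<lambda>i. emb (\<lambda>x. (1 + x \<bullet> x) ^ k *\<^sub>R \<phi> i x))"
proof (induction k)
  case (Suc k)
  let ?\<psi> = "\<lambda>i x. (1 + x \<bullet> x) ^ k *\<^sub>R \<phi> i x"
  have eq: "(\<lambda>x. (1 + x \<bullet> x) ^ Suc k *\<^sub>R \<phi> i x) = (\<lambda>x. (1 + x \<bullet> x) *\<^sub>R ?\<psi> i x)" for i
    by simp
  have "null_fam F (\<lambda>i. emb (?\<psi> i) - (\<Sum>b\<in>Basis. X (0, b) (X (0, b) (emb (?\<psi> i)))))"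
    using Suc by (intro null_fam_diff null_fam_sum null_fam_X Basis_pairI finite_Basis) auto
  then have "null_fam F (\<lambda>i. emb (\<lambda>x. (1 + x \<bullet> x) *\<^sub>R ?\<psi> i x))"
    using Suc by (simp only: weight_mult(2))
  moreover have "schwartz (\<lambda>x. (1 + x \<bullet> x) *\<^sub>R ?\<psi> i x)" for i
    using Suc by (intro weight_mult(1)) blast
  ultimately show ?case
    unfolding eq by blast
qed (use assms in simp)

theorem smooth_vec_imp_emb:
  assumes h: "smooth_vec h"
  shows "\<exists>g. schwartz g \<and> h = emb g"
proof -
  obtain f where f: "\<And>k. schwartz (f k)"
    and lim: "\<And>vs. set vs \<subseteq> Basis \<Longrightarrow> (\<lambda>k. Xw vs (emb (f k) - h)) \<longlonglongrightarrow> 0"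
    using smooth_vec_approx_seq[OF h] by metis
  \<comment> \<open>Along the product filter, smallness of the differences indexed by pairs is the
    Cauchy property.\<close>
  let ?F = "sequentially \<times>\<^sub>F sequentially" and ?\<phi> = "\<lambda>p x. f (fst p) x - f (snd p) x"
  have \<phi>: "schwartz (?\<phi> p)" for p by (intro schwartz_diff f)
  have null1: "null_fam sequentially (\<lambda>k. emb (f k) - h)"
    unfolding null_fam_def by (simp add: lim smooth_vec_diff smooth_vec_emb f h)
  have null: "null_fam ?F (\<lambda>p. emb (?\<phi> p))"
  proof -
    have *: "null_fam ?F (\<lambda>p. emb (f (fst p)) - h)" "null_fam ?F (\<lambda>p. emb (f (snd p)) - h)"
      using null1 unfolding null_fam_def
      by (auto intro: filterlim_compose[OF _ filterlim_fst] filterlim_compose[OF _ filterlim_snd])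
    show ?thesis
      using null_fam_diff[OF *] by (simp add: emb_diff f)
  qed
  have "\<exists>N. \<forall>m\<ge>N. \<forall>n\<ge>N. \<forall>x. (1 + norm x) ^ k * norm (iter_pd vs (f m) x - iter_pd vs (f n) x) \<le> \<epsilon>"
    if vs: "set vs \<subseteq> Basis" and \<epsilon>: "\<epsilon> > 0" for vs k \<epsilon>
  proof -
    let ?\<psi> = "\<lambda>p x. (1 + x \<bullet> x) ^ k *\<^sub>R iter_pd vs (?\<phi> p) x"
    have w: "(\<forall>p. schwartz (?\<psi> p)) \<and> null_fam ?F (\<lambda>p. emb (?\<psi> p))"
      by (intro null_fam_weight null_fam_iter_pd[OF \<phi> null] schwartz_iter_pd \<phi> vs)
    have "\<forall>\<^sub>F p in ?F. \<forall>x. norm (?\<psi> p x) \<le> \<epsilon> / 2 ^ k"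
      using w \<epsilon> by (intro null_fam_uniform) auto
    then obtain N where N: "\<And>m n x. m \<ge> N \<Longrightarrow> n \<ge> N \<Longrightarrow> norm (?\<psi> (n, m) x) \<le> \<epsilon> / 2 ^ k"
      unfolding eventually_prod_sequentially by blast
    have "(1 + norm x) ^ k * norm (iter_pd vs (f m) x - iter_pd vs (f n) x) \<le> \<epsilon>" if "m \<ge> N" "n \<ge> N" for m n x
    proof -
      have "(1 + norm x) ^ k * norm (iter_pd vs (f m) x - iter_pd vs (f n) x) \<le>
          (2 ^ k * (1 + x \<bullet> x) ^ k) * norm (iter_pd vs (f m) x - iter_pd vs (f n) x)"
        by (intro mult_right_mono weight_le) auto
      also have "\<dots> = 2 ^ k * norm (?\<psi> (m, n) x)"
        by (simp add: iter_pd_diff[OF f f vs])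
      also have "\<dots> \<le> 2 ^ k * (\<epsilon> / 2 ^ k)"
        by (intro mult_left_mono N that) auto
      finally show ?thesis by simp
    qed
    then show ?thesis by blast
  qed
  from schwartz_limit[OF f this] obtain g where g: "schwartz g"
    "\<And>k \<epsilon>. \<epsilon> > 0 \<Longrightarrow> \<exists>N. \<forall>n\<ge>N. \<forall>x. (1 + norm x) ^ k * norm (f n x - g x) \<le> \<epsilon>"
    by metis
  \<comment> \<open>So far \<open>g\<close> is tied to the \<open>f n\<close> only by weighted
    uniform convergence. With the weight exponent \<open>2 * DIM\<close>, \<open>norm_emb_le\<close>
    turns this into convergence in \<open>E_n\<close>, where the limit is already known to be
    \<open>h\<close>.\<close>
  let ?C = "sqrt (integral UNIV (decay_weight :: real^'n \<Rightarrow> real))"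
  have C: "?C \<ge> 0" using integral_decay_weight_nonneg by simp
  have "(\<lambda>n. emb (f n)) \<longlonglongrightarrow> emb g"
  proof (rule metric_LIMSEQ_I)
    fix r :: real assume r: "r > 0"
    then have "r / (2 * (?C + 1)) > 0" using C by (simp add: add_nonneg_pos)
    then obtain N where N: "\<And>n x. n \<ge> N \<Longrightarrow> (1 + norm x) ^ (2 * DIM(real^'n)) * norm (f n x - g x) \<le> r / (2 * (?C + 1))"
      using g(2) by blast
    have "dist (emb (f n)) (emb g) < r" if "n \<ge> N" for n
    proof -
      have "norm (emb (\<lambda>x. f n x - g x)) \<le> ?C * (r / (2 * (?C + 1)))"
        by (intro norm_emb_le schwartz_diff f g N that)
      also have "\<dots> \<le> (?C + 1) * (r / (2 * (?C + 1)))"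
        using r C by (intro mult_right_mono) auto
      also have "\<dots> = r / 2"
      proof -
        have "y * (r / (2 * y)) = r / 2" if "y > 0" for y using that by simp
        from this[OF add_nonneg_pos[OF C zero_less_one]] show ?thesis .
      qed
      also have "\<dots> < r" using r by simp
      finally show ?thesis by (simp add: emb_diff f g dist_norm)
    qed
    then show "\<exists>N. \<forall>n\<ge>N. dist (emb (f n)) (emb g) < r" by blast
  qed
  moreover have "(\<lambda>n. emb (f n)) \<longlonglongrightarrow> h"
    using lim[of "[]"] LIM_zero_cancel by simp
  ultimately have "h = emb g" using LIMSEQ_unique by blast
  with g(1) show ?thesis by blast
qed

end

theorem theorem2p3:
  fixes cscale :: "complex \<Rightarrow> 'c::{real_normed_algebra_1,banach} \<Rightarrow> 'c"
    and star :: "'c \<Rightarrow> 'c"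
    and inn :: "'e::banach \<Rightarrow> 'e \<Rightarrow> 'c"
    and ract :: "'e \<Rightarrow> 'c \<Rightarrow> 'e"
    and emb :: "(real^'n \<Rightarrow> 'c) \<Rightarrow> 'e"
    and A :: "'e \<Rightarrow>\<^sub>L 'e"
  assumes "unital_cstar_algebra cscale star"
    and "En_completion star inn ract emb"
    and "adjointable inn (blinfun_apply A)"
    and "heisenberg_smooth cscale emb A"
  shows "\<forall>f. schwartz f \<longrightarrow> (\<exists>g. schwartz g \<and> blinfun_apply A (emb f) = emb g)"
proof (intro allI impI)
  fix f :: "real^'n \<Rightarrow> 'c" assume f: "schwartz f"
  interpret schwartz_module cscale star inn ract emb
    by unfold_locales (use assms in auto)
  have "smooth (\<lambda>p. conj_op p A)"
    using assms(4) unfolding heisenberg_smooth_def conj_op_def U_def .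
  then have "smooth_vec (A (emb f))"
    using smooth_vec_heisenberg_smooth[OF phase_linear_if_adjointable[OF assms(3)]] f by blast
  then show "\<exists>g. schwartz g \<and> A (emb f) = emb g"
    by (rule smooth_vec_imp_emb)
qed

end
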